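(* In the diffusion setting described in the context, for every $0<c<1$, the pseudometric $\overline{d}^c$ is the least fixpoint of $\mathcal{G}_c$ (among 1-bounded lower semi-continuous pseudometrics on $E$) that is greater than or equal to the pseudometric $(x,y)\mapsto|obs(x)-obs(y)|$.
   Context: Setting (diffusion). Let $E$ be a locally compact Hausdorff space with a countable base, with its Borel $\sigma$-algebra; $E$ is Polish and $\Delta$ is a fixed 1-bounded metric generating its topology $\mathcal{O}$. Let $(\hat P_t)_{t\ge 0}$ be an honest Feller–Dynkin semigroup on $C_0(E)$ with associated Markov (probability) kernels $P_t(x,\cdot)$. It is assumed to be a diffusion: the trajectory space is $\Omega=\{\omega:[0,\infty)\to E \text{ continuous}\}$ with the $\sigma$-algebra generated by evaluations and the topology generated by the uniform metric $U(\Delta)(\omega,\omega')=\sup_{t\ge0}\Delta(\omega(t),\omega'(t))$ (treated as Polish); for each $x\in E$, $\mathbb{P}^x$ is the law on $\Omega$ of the process started at $x$ (finite-dimensional distributions $\delta_x(\mathrm{d}x_0)P_{t_1}(x_0,\mathrm{d}x_1)\cdots P_{t_n-t_{n-1}}(x_{n-1},\mathrm{d}x_n)$); and $x\mapsto\mathbb{P}^x$ is weakly continuous. A continuous observable $obs:E\to[0,1]$ is given. Optimal transport: for Polish $\mathcal X$, lower semi-continuous $c:\mathcal X\times\mathcal X\to[0,1]$ with $c(x,x)=0$, and probability measures $\mu,\nu$, $W(c)(\mu,\nu)=\min_{\gamma\in\Gamma(\mu,\nu)}\int c\,\mathrm{d}\gamma$ over couplings. For a 1-bounded lower semi-continuous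 pseudometric $m$ on $E$: $U_c(m)(\omega,\omega')=\sup_{t\ge0}c^tm(\omega(t),\omega'(t))$ and $\mathcal{G}_c(m)(x,y)=W(U_c(m))(\mathbb{P}^x,\mathbb{P}^y)$. Define $d^c_0(x,y)=|obs(x)-obs(y)|$, $d^c_{n+1}=\mathcal{G}_c(d^c_n)$ for $n\ge0$, and $\overline{d}^c=\sup_{n}d^c_n$. *)

theory Defs
  imports "HOL-Probability.Probability"
begin

definition C0 :: "('a::topological_space \<Rightarrow> real) set" where
  "C0 = {f. continuous_on UNIV f \<and>
            (\<forall>\<epsilon>>0. \<exists>K. compact K \<and> (\<forall>x. x \<notin> K \<longrightarrow> \<bar>f x\<bar> < \<epsilon>))}"

text \<open>Operators act on all functions, but only their behaviour on \<open>C0\<close> at times \<open>t \<ge> 0\<close> is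
  constrained. Strong continuity (convergence in the sup norm as \<open>t\<close> decreases to 0) is expressed by
  \<open>uniform_limit\<close>; boundedness of the operators follows from the last clause.\<close>

definition feller_dynkin_semigroup ::
    "(real \<Rightarrow> ('a::topological_space \<Rightarrow> real) \<Rightarrow> ('a \<Rightarrow> real)) \<Rightarrow> bool" where
  "feller_dynkin_semigroup Phat \<longleftrightarrow>
     (\<forall>t\<ge>0. \<forall>f\<in>C0. Phat t f \<in> C0) \<and>
     (\<forall>t\<ge>0. \<forall>f\<in>C0. \<forall>g\<in>C0. \<forall>a b.
        Phat t (\<lambda>x. a * f x + b * g x) = (\<lambda>x. a * Phat t f x + b * Phat t g x)) \<and>
     (\<forall>f\<in>C0. Phat 0 f = f) \<and>
     (\<forall>s\<ge>0. \<forall>t\<ge>0. \<forall>f\<in>C0. Phat (s + t) f = Phat s (Phat t f)) \<and>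
     (\<forall>f\<in>C0. uniform_limit UNIV (\<lambda>t. Phat t f) f (at_right 0)) \<and>
     (\<forall>t\<ge>0. \<forall>f\<in>C0. (\<forall>x. 0 \<le> f x \<and> f x \<le> 1) \<longrightarrow> (\<forall>x. 0 \<le> Phat t f x \<and> Phat t f x \<le> 1))"

text \<open>The kernels representing the semigroup. Honesty is the requirement that they are
  probability (rather than sub-probability) kernels.\<close>

definition honest_kernels ::
    "(real \<Rightarrow> ('a::topological_space \<Rightarrow> real) \<Rightarrow> ('a \<Rightarrow> real)) \<Rightarrow> (real \<Rightarrow> 'a \<Rightarrow> 'a measure) \<Rightarrow> bool" where
  "honest_kernels Phat P \<longleftrightarrow>
     (\<forall>t\<ge>0. P t \<in> measurable borel (prob_algebra borel)) \<and>
     (\<forall>t\<ge>0. \<forall>f\<in>C0. \<forall>x. Phat t f x = (\<integral>y. f y \<partial>P t x))"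

text \<open>Trajectories are functions on \<open>{0..}\<close>, encoded as functions on \<open>real\<close> with the
  conventional value \<open>undefined\<close> at negative times.\<close>

definition paths :: "(real \<Rightarrow> 'a::topological_space) set" where
  "paths = {\<omega> \<in> extensional {0..}. continuous_on {0..} \<omega>}"

definition path_space :: "(real \<Rightarrow> 'a::topological_space) measure" where
  "path_space = sigma paths {{\<omega> \<in> paths. \<omega> t \<in> B} | t B. 0 \<le> t \<and> B \<in> sets borel}"

definition uniform_metric :: "('a \<Rightarrow> 'a \<Rightarrow> real) \<Rightarrow> (real \<Rightarrow> 'a) \<Rightarrow> (real \<Rightarrow> 'a) \<Rightarrow> real" where
  "uniform_metric \<Delta> \<omega> \<omega>' = (SUP t\<in>{0..}. \<Delta> (\<omega> t) (\<omega>' t))"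

text \<open>\<open>fdd P t x n\<close> is the measure
  \<open>\<delta>\<^sub>x(dx\<^sub>0) P\<^bsub>t 1 - t 0\<^esub>(x\<^sub>0, dx\<^sub>1) \<dots> P\<^bsub>t n - t (n-1)\<^esub>(x\<^bsub>n-1\<^esub>, dx\<^sub>n)\<close> on the product space
  indexed by \<open>{..n}\<close>.\<close>

primrec fdd :: "(real \<Rightarrow> 'a::topological_space \<Rightarrow> 'a measure) \<Rightarrow> (nat \<Rightarrow> real) \<Rightarrow> 'a \<Rightarrow> nat
    \<Rightarrow> (nat \<Rightarrow> 'a) measure" where
  "fdd P t x 0 = distr (return borel x) (\<Pi>\<^sub>M i\<in>{..0}. borel) (\<lambda>y. \<lambda>i\<in>{..0}. y)"
| "fdd P t x (Suc n) = fdd P t x n \<bind>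
     (\<lambda>z. distr (P (t (Suc n) - t n) (z n)) (\<Pi>\<^sub>M i\<in>{..Suc n}. borel) (\<lambda>y. z(Suc n := y)))"

text \<open>Weak continuity is with respect to the topology of the uniform metric. That topology need not
  be separable, and its Borel sets need not be generated by the evaluations, so test functions are
  required to be measurable in addition to being bounded and continuous.\<close>

definition weakly_continuous ::
    "('a \<Rightarrow> 'a \<Rightarrow> real) \<Rightarrow> ('a::topological_space \<Rightarrow> (real \<Rightarrow> 'a) measure) \<Rightarrow> bool" where
  "weakly_continuous \<Delta> Pr \<longleftrightarrow>
     (\<forall>F. continuous_map (Metric_space.mtopology paths (uniform_metric \<Delta>)) euclideanreal F \<and>
          F \<in> borel_measurable path_space \<and> (\<exists>B. \<forall>\<omega>\<in>paths. \<bar>F \<omega>\<bar> \<le> B)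
        \<longrightarrow> continuous_on UNIV (\<lambda>x. \<integral>\<omega>. F \<omega> \<partial>Pr x))"

text \<open>Polishness of the state space is not listed: it is a consequence of being locally compact,
  Hausdorff and second countable.\<close>

locale diffusion =
  fixes \<Delta> :: "'a::{t2_space, second_countable_topology} \<Rightarrow> 'a \<Rightarrow> real"
    and Phat :: "real \<Rightarrow> ('a \<Rightarrow> real) \<Rightarrow> ('a \<Rightarrow> real)"
    and P :: "real \<Rightarrow> 'a \<Rightarrow> 'a measure"
    and Pr :: "'a \<Rightarrow> (real \<Rightarrow> 'a) measure"
    and obs :: "'a \<Rightarrow> real"
  assumes locally_compact: "locally_compact_space (euclidean :: 'a topology)"
    and metric: "Metric_space UNIV \<Delta>"
    and metric_topology: "Metric_space.mtopology UNIV \<Delta> = euclidean"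
    and metric_le_1: "\<Delta> x y \<le> 1"
    and semigroup: "feller_dynkin_semigroup Phat"
    and kernels: "honest_kernels Phat P"
    and law_prob: "Pr x \<in> space (prob_algebra path_space)"
    and law_fdd: "\<lbrakk>t 0 = 0; mono t\<rbrakk> \<Longrightarrow>
          distr (Pr x) (\<Pi>\<^sub>M i\<in>{..n}. borel) (\<lambda>\<omega>. \<lambda>i\<in>{..n}. \<omega> (t i)) = fdd P t x n"
    and law_continuous: "weakly_continuous \<Delta> Pr"
    and obs_continuous: "continuous_on UNIV obs"
    and obs_range: "obs x \<in> {0..1}"

definition couplings :: "'b measure \<Rightarrow> 'b measure \<Rightarrow> ('b \<times> 'b) measure set" where
  "couplings \<mu> \<nu> = {\<gamma>. sets \<gamma> = sets (\<mu> \<Otimes>\<^sub>M \<nu>) \<and> distr \<gamma> \<mu> fst = \<mu> \<and> distr \<gamma> \<nu> snd = \<nu>}"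

text \<open>The infimum below is the minimum in the intended uses, where the cost is bounded and lower
  semicontinuous.\<close>

definition transport_cost :: "('b \<Rightarrow> 'b \<Rightarrow> real) \<Rightarrow> 'b measure \<Rightarrow> 'b measure \<Rightarrow> real" where
  "transport_cost c \<mu> \<nu> = (INF \<gamma>\<in>couplings \<mu> \<nu>. \<integral>p. c (fst p) (snd p) \<partial>\<gamma>)"

definition lsc_pseudometric :: "('a::topological_space \<Rightarrow> 'a \<Rightarrow> real) \<Rightarrow> bool" where
  "lsc_pseudometric m \<longleftrightarrow>
     (\<forall>x y. 0 \<le> m x y \<and> m x y \<le> 1) \<and>
     (\<forall>x. m x x = 0) \<and>
     (\<forall>x y. m x y = m y x) \<and>
     (\<forall>x y z. m x z \<le> m x y + m y z) \<and>
     (\<forall>a. open {p :: 'a \<times> 'a. a < m (fst p) (snd p)})"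

definition discounted_uniform ::
    "real \<Rightarrow> ('a \<Rightarrow> 'a \<Rightarrow> real) \<Rightarrow> (real \<Rightarrow> 'a) \<Rightarrow> (real \<Rightarrow> 'a) \<Rightarrow> real" where
  "discounted_uniform c m \<omega> \<omega>' = (SUP t\<in>{0..}. c powr t * m (\<omega> t) (\<omega>' t))"

definition transport_functional ::
    "('a \<Rightarrow> (real \<Rightarrow> 'a) measure) \<Rightarrow> real \<Rightarrow> ('a \<Rightarrow> 'a \<Rightarrow> real) \<Rightarrow> 'a \<Rightarrow> 'a \<Rightarrow> real" where
  "transport_functional Pr c m x y = transport_cost (discounted_uniform c m) (Pr x) (Pr y)"

definition obs_dist :: "('a \<Rightarrow> real) \<Rightarrow> 'a \<Rightarrow> 'a \<Rightarrow> real" where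
  "obs_dist obs x y = \<bar>obs x - obs y\<bar>"

primrec pseudometric_seq ::
    "('a \<Rightarrow> (real \<Rightarrow> 'a) measure) \<Rightarrow> ('a \<Rightarrow> real) \<Rightarrow> real \<Rightarrow> nat \<Rightarrow> 'a \<Rightarrow> 'a \<Rightarrow> real" where
  "pseudometric_seq Pr obs c 0 = obs_dist obs"
| "pseudometric_seq Pr obs c (Suc n) = transport_functional Pr c (pseudometric_seq Pr obs c n)"

definition dbar :: "('a \<Rightarrow> (real \<Rightarrow> 'a) measure) \<Rightarrow> ('a \<Rightarrow> real) \<Rightarrow> real \<Rightarrow> 'a \<Rightarrow> 'a \<Rightarrow> real" where
  "dbar Pr obs c x y = (SUP n. pseudometric_seq Pr obs c n x y)"

end

theory Submission
  imports Defs
begin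

text \<open>The heart of the matter is a compactness property of couplings of path laws. Reading a
  path at rational times through countably many functions \<open>\<Delta> (\<cdot>) e\<close>, with
  \<open>e\<close> running over a dense sequence, embeds path space into a Hilbert cube; the image
  is Borel because \<open>E\<close> is \<open>\<sigma>\<close>-compact, so the embedding has a
  measurable left inverse. Schoenberg's curve is a continuous surjection of the line onto the cube
  with a measurable section, hence Helly's theorem on the line yields weakly convergent subsequences
  on the cube. The marginals of a limit of couplings live on the image of path space, so the limit
  is again a coupling of path laws. The cost \<open>U\<^sub>c(m)\<close> is a supremum over rational
  times, hence lower semicontinuous for the embedding, and its integral is lower semicontinuous
  along such limits.

  Three consequences follow: \<open>\<G>\<^sub>c\<close> preserves lower semicontinuity; gluings of
  two couplings along a common marginal exist, as limits of gluings over finer and finer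
  discretisations, which gives the triangle inequality; and a limit of almost optimal couplings for
  \<open>d\<^sub>n\<close> shows \<open>\<G>\<^sub>c(sup d\<^sub>n) \<le> sup d\<^sub>n\<close>. The
  reverse inequality \<open>m \<le> \<G>\<^sub>c(m)\<close> holds because paths start at
  \<open>x\<close> and \<open>y\<close>.\<close>

section \<open>Weak compactness on the Hilbert cube\<close>

text \<open>The topology of the uniform metric on paths may fail to be separable, so no tightness
  argument is made there. Limits are taken in the coarser topology of codes, that is, of convergence
  of the positions at rational times. Two facts make it adequate. A bounded continuous function of
  codes is continuous for the uniform metric and measurable for the evaluations, hence an admissible
  test function for \<open>weakly_continuous\<close>. And a strict inequality
  \<open>a < discounted_uniform c m \<omega> \<omega>'\<close> is already visible at a single
  rational time. Optimal couplings are never selected: couplings with arbitrarily small excess cost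
  suffice.

  The wave below has its plateaus on the two thirds selected by the Cantor digits 0 and 2: the
  cosine is at least 1/2 on [0, \<pi>/3] and at most -1/2 on [2\<pi>/3, \<pi>], so truncating
  \<open>1/2 - cos\<close> to [0, 1] gives exactly 0 and 1 there, and the cosine supplies the period
  2.\<close>

definition schoenberg_wave :: "real \<Rightarrow> real" where
  "schoenberg_wave x = max 0 (min 1 (1/2 - cos (pi * x)))"

text \<open>Multiplying by \<open>3\<^sup>k\<close> turns the leading ternary digits into an even integer, which the period 2 of
  the wave removes; what is left lies in \<open>[0, 1/3]\<close> or \<open>[2/3, 1]\<close>, where the wave is constant.\<close>

lemma schoenberg_wave_ternary:
  fixes b :: "nat \<Rightarrow> nat"
  assumes b: "\<And>k. b k \<le> 1"
  shows "schoenberg_wave (3 ^ k * (\<Sum>j. 2 * real (b j) / 3 ^ Suc j)) = real (b k)"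
proof -
  define a where "a j = 2 * real (b j) / 3 ^ Suc j" for j
  have geo: "summable (\<lambda>j. C * (1/3::real) ^ j)" for C
    by (intro summable_mult summable_geometric) auto
  have a_le: "a j \<le> 2/3 * (1/3) ^ j" for j
    using b[of j] by (simp add: a_def divide_simps power_divide)
  have a_nonneg: "0 \<le> a j" for j by (simp add: a_def)
  have suma: "summable a"
    by (rule summable_comparison_test'[OF geo[of "2/3"], of 0]) (use a_le a_nonneg in auto)
  \<comment> \<open>\<open>r\<close> is the rescaled tail beyond digit \<open>k\<close>. The digit
    itself contributes 0 or 2/3, so the bound \<open>r \<le> 1/3\<close> decides on which plateau
    the argument lands; the extreme case is all later digits equal to 2.\<close>
  define r where "r = 3 ^ k * (\<Sum>j. a (j + Suc k))"
  have split: "3 ^ k * suminf a = r + 3 ^ k * sum a {..<k} + 2 * real (b k) / 3"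
    using suminf_split_initial_segment[OF suma, of "Suc k"]
    by (simp add: r_def algebra_simps a_def)
  have head: "3 ^ k * sum a {..<k} = 2 * real (\<Sum>j<k. b j * 3 ^ (k - Suc j))"
  proof -
    have "3 ^ k * a j = 2 * real (b j * 3 ^ (k - Suc j))" if "j < k" for j
    proof -
      have "(3::real) ^ k = 3 ^ (k - Suc j) * 3 ^ Suc j"
        using that by (simp flip: power_add del: power_Suc)
      then show ?thesis by (simp add: a_def)
    qed
    then show ?thesis by (simp add: sum_distrib_left)
  qed
  have r0: "0 \<le> r"
    unfolding r_def
    by (intro mult_nonneg_nonneg suminf_nonneg summable_ignore_initial_segment suma a_nonneg) simp
  have r1: "r \<le> 1/3"
  proof -
    have s: "summable (\<lambda>j. a (j + Suc k))" using suma by (rule summable_ignore_initial_segment)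
    have "r = (\<Sum>j. 3 ^ k * a (j + Suc k))"
      unfolding r_def using s by (rule suminf_mult[symmetric])
    also have "\<dots> \<le> (\<Sum>j. 2/9 * (1/3) ^ j)"
    proof (intro suminf_le geo)
      show "3 ^ k * a (j + Suc k) \<le> 2/9 * (1/3) ^ j" for j
        using a_le[of "j + Suc k"] mult_left_mono[OF a_le[of "j + Suc k"], of "3^k"]
        by (simp add: power_add power_divide)
    qed (use s in \<open>rule summable_mult\<close>)
    also have "\<dots> = 1/3"
      using suminf_mult[of "\<lambda>j. (1/3::real)^j" "2/9"] suminf_geometric[of "1/3::real"]
      by (simp add: summable_geometric)
    finally show ?thesis .
  qed
  define y where "y = r + 2 * real (b k) / 3"
  have per: "cos (pi * (3 ^ k * suminf a)) = cos (pi * y)"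
  proof -
    define N where "N = (\<Sum>j<k. b j * 3 ^ (k - Suc j))"
    have "pi * (3 ^ k * suminf a) = pi * y + 2 * real N * pi"
      unfolding split head y_def N_def by (simp only: algebra_simps)
    then show ?thesis by (simp only: cos_add cos_2npi sin_2npi)
  qed
  have "b k = 0 \<or> b k = 1" using b[of k] by auto
  then have "schoenberg_wave (3 ^ k * suminf a) = real (b k)"
  proof
    assume 0: "b k = 0"
    then have "cos (pi / 3) \<le> cos (pi * y)"
      using r0 r1 by (intro cos_monotone_0_pi_le) (auto simp: y_def)
    then show ?thesis using 0 unfolding schoenberg_wave_def per by (simp add: cos_60)
  next
    assume 1: "b k = 1"
    then have y: "2/3 \<le> y" "y \<le> 1" using r0 r1 by (auto simp: y_def)
    have "cos (pi * y) \<le> cos (2 / 3 * pi)"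
      using y by (intro cos_monotone_0_pi_le) (auto simp: mult.commute)
    then show ?thesis using 1 unfolding schoenberg_wave_def per by (simp add: cos_120)
  qed
  then show ?thesis by (simp add: a_def[abs_def])
qed

text \<open>The partial sums telescope to \<open>\<lfloor>2 ^ n * x\<rfloor> / 2 ^ n\<close>,
  starting from \<open>\<lfloor>x\<rfloor> = 0\<close>. This start is where \<open>x < 1\<close>
  enters, and why codes take values in [0, 1) throughout.\<close>

lemma binary_expansion_sums:
  fixes x :: real
  assumes "0 \<le> x" "x < 1"
  shows "(\<lambda>k. real (nat (\<lfloor>2 ^ Suc k * x\<rfloor> - 2 * \<lfloor>2 ^ k * x\<rfloor>)) / 2 ^ Suc k) sums x"
proof -
  have d: "\<lfloor>2 ^ Suc k * x\<rfloor> - 2 * \<lfloor>2 ^ k * x\<rfloor> \<ge> 0" for k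
  proof -
    have "2 * \<lfloor>2 ^ k * x\<rfloor> \<le> \<lfloor>2 ^ Suc k * x\<rfloor>"
      unfolding le_floor_iff using of_int_floor_le[of "2 ^ k * x"] by simp
    then show ?thesis by simp
  qed
  have part: "(\<Sum>k<n. real (nat (\<lfloor>2 ^ Suc k * x\<rfloor> - 2 * \<lfloor>2 ^ k * x\<rfloor>)) / 2 ^ Suc k) = \<lfloor>2 ^ n * x\<rfloor> / 2 ^ n" for n
  proof (induction n)
    case 0
    then show ?case using assms by (simp add: floor_eq_iff)
  next
    case (Suc n)
    then show ?case using d[of n] by (simp add: of_nat_nat field_simps)
  qed
  have "(\<lambda>n. \<lfloor>2 ^ n * x\<rfloor> / 2 ^ n) \<longlonglongrightarrow> x"
  proof (rule tendsto_sandwich[of "\<lambda>n. x - (1/2) ^ n" _ _ "\<lambda>n. x"])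
    have "x - (1/2) ^ n \<le> \<lfloor>2 ^ n * x\<rfloor> / 2 ^ n" for n
    proof -
      have "x - (1/2) ^ n = (2 ^ n * x - 1) / 2 ^ n" by (simp add: diff_divide_distrib power_divide)
      also have "\<dots> \<le> \<lfloor>2 ^ n * x\<rfloor> / 2 ^ n"
        using real_of_int_floor_gt_diff_one[of "2 ^ n * x"] by (intro divide_right_mono) auto
      finally show ?thesis .
    qed
    then show "\<forall>\<^sub>F n in sequentially. x - (1/2) ^ n \<le> \<lfloor>2 ^ n * x\<rfloor> / 2 ^ n" by simp
    have "\<lfloor>2 ^ n * x\<rfloor> / 2 ^ n \<le> x" for n
      using of_int_floor_le[of "2 ^ n * x"] by (simp add: field_simps)
    then show "\<forall>\<^sub>F n in sequentially. \<lfloor>2 ^ n * x\<rfloor> / 2 ^ n \<le> x" by simp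
    show "(\<lambda>n. x - (1/2) ^ n) \<longlonglongrightarrow> x"
      using tendsto_diff[OF tendsto_const[of x] LIMSEQ_power_zero[of "1/2::real"]] by simp
  qed simp
  then show ?thesis unfolding sums_def part .
qed

text \<open>The section writes the binary digits of all coordinates, interleaved by
  \<open>prod_encode\<close>, as ternary digits 0 and 2 of one number; the curve reads digit
  \<open>k\<close> back through the wave at \<open>3 ^ k * t\<close> and reassembles each
  coordinate. The curve is continuous as a uniform limit, whereas digits jump, so the section is
  only measurable. Its bounded range will provide tightness.\<close>

lemma schoenberg_curve:
  obtains \<Phi> :: "real \<Rightarrow> 'i::countable \<Rightarrow> real" and s :: "('i \<Rightarrow> real) \<Rightarrow> real"
  where "continuous_on UNIV \<Phi>" "s \<in> borel_measurable borel" "\<And>u. s u \<in> {0..1}"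
    "\<And>u. (\<And>i. 0 \<le> u i \<and> u i < 1) \<Longrightarrow> \<Phi> (s u) = u"
proof -
  \<comment> \<open>\<open>nat\<close> and \<open>min 1\<close> force digits 0 or 1 even when
    \<open>u\<close> leaves the cube, so that \<open>s u\<close> lies in [0, 1] for every
    \<open>u\<close>. Inside the cube the difference of floors is already 0 or 1.\<close>
  define d :: "('i \<Rightarrow> real) \<Rightarrow> nat \<Rightarrow> nat" where
    "d u k = (case prod_decode k of (i, j) \<Rightarrow>
       min 1 (nat (\<lfloor>2 ^ Suc j * u (from_nat i)\<rfloor> - 2 * \<lfloor>2 ^ j * u (from_nat i)\<rfloor>)))" for u k
  define s where "s u = (\<Sum>k. 2 * real (d u k) / 3 ^ Suc k)" for u
  define \<Phi> :: "real \<Rightarrow> 'i \<Rightarrow> real" where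
    "\<Phi> t i = (\<Sum>j. schoenberg_wave (3 ^ prod_encode (to_nat i, j) * t) / 2 ^ Suc j)" for t i
  have d1: "d u k \<le> 1" for u k by (simp add: d_def split: prod.split)
  have geo: "summable (\<lambda>j. C * (1/3::real) ^ j)" for C
    by (intro summable_mult summable_geometric) auto
  have term_le: "2 * real (d u k) / 3 ^ Suc k \<le> 2/3 * (1/3) ^ k" for u k
    using d1[of u k] by (simp add: divide_simps power_divide)
  have sums: "summable (\<lambda>k. 2 * real (d u k) / 3 ^ Suc k)" for u
    by (rule summable_comparison_test'[OF geo[of "2/3"], of 0]) (use term_le in auto)
  show thesis
  proof
    show "continuous_on UNIV \<Phi>"
    proof (rule continuous_on_coordinatewise_then_product)
      fix i
      have u: "uniform_limit UNIV (\<lambda>n t. \<Sum>j<n. schoenberg_wave (3 ^ prod_encode (to_nat i, j) * t) / 2 ^ Suc j)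
            (\<lambda>t. \<Phi> t i) sequentially"
        unfolding \<Phi>_def
      proof (rule Weierstrass_m_test)
        show "summable (\<lambda>j. 1 / 2 * (1/2::real) ^ j)" by (intro summable_mult summable_geometric) auto
        show "norm (schoenberg_wave (3 ^ prod_encode (to_nat i, n) * x) / 2 ^ Suc n) \<le> 1 / 2 * (1/2) ^ n" for n x
          by (simp add: schoenberg_wave_def power_divide divide_simps)
      qed
      show "continuous_on UNIV (\<lambda>t. \<Phi> t i)"
        by (rule uniform_limit_theorem[OF _ u])
           (auto intro!: always_eventually continuous_intros simp: schoenberg_wave_def)
    qed
    have [measurable]: "(\<lambda>u::'i \<Rightarrow> real. u i) \<in> borel_measurable borel" for i
      by (intro borel_measurable_continuous_onI continuous_on_product_coordinates)
    have [measurable]: "(\<lambda>u. real (d u k)) \<in> borel_measurable borel" for k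
      unfolding d_def by (cases "prod_decode k") (simp, measurable)
    show "s \<in> borel_measurable borel" unfolding s_def[abs_def] by measurable
    show "s u \<in> {0..1}" for u
    proof -
      have "s u \<le> (\<Sum>k. 2/3 * (1/3) ^ k)"
        unfolding s_def by (intro suminf_le term_le sums geo)
      also have "\<dots> = 1"
        using suminf_mult[of "\<lambda>j. (1/3::real)^j" "2/3"] suminf_geometric[of "1/3::real"]
        by (simp add: summable_geometric)
      finally show ?thesis unfolding s_def using sums by (auto intro!: suminf_nonneg)
    qed
    show "\<Phi> (s u) = u" if u: "\<And>i. 0 \<le> u i \<and> u i < 1" for u
    proof
      fix i
      have dig: "real (d u (prod_encode (to_nat i, j))) = real (nat (\<lfloor>2 ^ Suc j * u i\<rfloor> - 2 * \<lfloor>2 ^ j * u i\<rfloor>))" for j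
      proof -
        have "\<lfloor>2 ^ Suc j * u i\<rfloor> < 2 * \<lfloor>2 ^ j * u i\<rfloor> + 2"
          unfolding floor_less_iff using real_of_int_floor_add_one_gt[of "2 ^ j * u i"] unfolding power_Suc mult.assoc by linarith
        then show ?thesis by (simp add: d_def)
      qed
      have "\<Phi> (s u) i = (\<Sum>j. real (d u (prod_encode (to_nat i, j))) / 2 ^ Suc j)"
        unfolding \<Phi>_def s_def schoenberg_wave_ternary[of "d u", OF d1] ..
      also have "\<dots> = u i"
        unfolding dig using binary_expansion_sums[of "u i"] u[of i] by (simp add: sums_iff)
      finally show "\<Phi> (s u) i = u i" .
    qed
  qed
qed

text \<open>Discontinuity of the section does no harm: measures are moved to the line by
  \<open>s\<close> after \<open>e\<close>, where measurability is enough, and test functions are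
  moved there by the continuous curve. On the image of \<open>e\<close> the two cancel, since
  \<open>\<Phi> (s (e x)) = e x\<close>. Nothing is claimed yet about \<open>K\<close> being carried
  by that image.\<close>

lemma weakly_convergent_subsequence:
  fixes M :: "nat \<Rightarrow> 'm measure" and e :: "'m \<Rightarrow> 'i::countable \<Rightarrow> real"
  assumes M: "\<And>n. prob_space (M n)"
    and e: "\<And>n. e \<in> borel_measurable (M n)"
    and range: "\<And>n x i. x \<in> space (M n) \<Longrightarrow> 0 \<le> e x i \<and> e x i < 1"
  obtains r K where "strict_mono (r :: nat \<Rightarrow> nat)" "prob_space K" "sets K = sets borel"
    "\<And>(F :: _ \<Rightarrow> real) B. continuous_on UNIV F \<Longrightarrow> (\<And>u. \<bar>F u\<bar> \<le> B) \<Longrightarrow>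
       (\<lambda>n. \<integral>x. F (e x) \<partial>M (r n)) \<longlonglongrightarrow> (\<integral>u. F u \<partial>K)"
proof -
  obtain \<Phi> :: "real \<Rightarrow> 'i \<Rightarrow> real" and s where
    \<Phi>: "continuous_on UNIV \<Phi>" and s[measurable]: "s \<in> borel_measurable borel"
    and s01: "\<And>u. s u \<in> {0..1}" and inv: "\<And>u. (\<And>i. 0 \<le> u i \<and> u i < 1) \<Longrightarrow> \<Phi> (s u) = u"
    using schoenberg_curve by metis
  note e[measurable]
  have [measurable]: "\<Phi> \<in> borel_measurable borel"
    using \<Phi> by (rule borel_measurable_continuous_onI)
  define \<mu> where "\<mu> n = distr (M n) borel (\<lambda>x. s (e x))" for n
  have rd: "real_distribution (\<mu> n)" for n
    unfolding \<mu>_def real_distribution_def real_distribution_axioms_def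
    by (auto intro!: prob_space.prob_space_distr[OF M])
  \<comment> \<open>\<open>tight\<close> is stated with half-open intervals; the left end -1 keeps
    the value 0 of \<open>s\<close> inside.\<close>
  have "measure (\<mu> n) {-1<..1} = 1" for n
  proof -
    have "(\<lambda>x. s (e x)) -` {-1<..1} \<inter> space (M n) = space (M n)"
      using s01 by (force simp: less_eq_real_def)
    then show ?thesis
      unfolding \<mu>_def using prob_space.prob_space[OF M[of n]] by (subst measure_distr) auto
  qed
  then have "tight \<mu>"
    unfolding tight_def using rd by (intro conjI allI impI exI[of _ "-1"] exI[of _ 1]) auto
  from tight_imp_convergent_subsubsequence[OF this strict_mono_id]
  obtain r N where r: "strict_mono (r :: nat \<Rightarrow> nat)" and N: "real_distribution N"
    and conv: "weak_conv_m (\<mu> \<circ> r) N" by auto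
  interpret N: real_distribution N by fact
  show thesis
  proof
    show "strict_mono r" by fact
    show "prob_space (distr N borel \<Phi>)" by (intro N.prob_space_distr) simp
    show "sets (distr N borel \<Phi>) = sets borel" by simp
    fix F :: "('i \<Rightarrow> real) \<Rightarrow> real" and B
    assume F: "continuous_on UNIV F" and B: "\<And>u. \<bar>F u\<bar> \<le> B"
    have [measurable]: "F \<in> borel_measurable borel" using F by (rule borel_measurable_continuous_onI)
    have "continuous_on UNIV (\<lambda>t. F (\<Phi> t))"
      using continuous_on_compose2[OF F \<Phi>] by auto
    then have "(\<lambda>n. integral\<^sup>L ((\<mu> \<circ> r) n) (\<lambda>t. F (\<Phi> t))) \<longlonglongrightarrow> integral\<^sup>L N (\<lambda>t. F (\<Phi> t))"
      using rd B
      by (intro weak_conv_imp_integral_bdd_continuous_conv[OF _ N conv, of _ B])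
         (auto simp: continuous_on_eq_continuous_at)
    moreover have "integral\<^sup>L ((\<mu> \<circ> r) n) (\<lambda>t. F (\<Phi> t)) = (\<integral>x. F (e x) \<partial>M (r n))" for n
      unfolding \<mu>_def comp_def
      by (subst integral_distr) (auto intro!: Bochner_Integration.integral_cong simp: inv range)
    ultimately show "(\<lambda>n. \<integral>x. F (e x) \<partial>M (r n)) \<longlonglongrightarrow> (\<integral>u. F u \<partial>distr N borel \<Phi>)"
      by (simp add: integral_distr)
  qed
qed

section \<open>Limits of couplings\<close>

text \<open>Open sets form an intersection-stable generator of the Borel sets, and the indicator of
  an open \<open>U\<close> is the limit of the continuous functions
  \<open>min 1 (real n * infdist z (-U))\<close>. Test functions bounded by 1 therefore determine
  the measure.\<close>

lemma borel_prob_eqI: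
  fixes A B :: "'z::metric_space measure"
  assumes A: "prob_space A" "sets A = sets borel" and B: "prob_space B" "sets B = sets borel"
    and eq: "\<And>F :: 'z \<Rightarrow> real. continuous_on UNIV F \<Longrightarrow> (\<And>z. \<bar>F z\<bar> \<le> 1) \<Longrightarrow> integral\<^sup>L A F = integral\<^sup>L B F"
  shows "A = B"
proof -
  interpret A: prob_space A by fact
  interpret B: prob_space B by fact
  have op: "emeasure A U = emeasure B U" if U: "open U" for U
  \<comment> \<open>For \<open>U = UNIV\<close> the complement is empty and \<open>infdist\<close>
    is 0 by convention, so the approximation used in the other case would fail.\<close>
  proof (cases "U = UNIV")
    case True
    then show ?thesis
      using A.emeasure_space_1 B.emeasure_space_1 sets_eq_imp_space_eq[OF A(2)] sets_eq_imp_space_eq[OF B(2)] by simp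
  next
    case False
    define F where "F n z = min 1 (real n * infdist z (-U))" for n z
    have cont: "continuous_on UNIV (F n)" for n
      unfolding F_def by (intro continuous_intros)
    have bd: "\<bar>F n z\<bar> \<le> 1" for n z unfolding F_def by (auto simp: infdist_nonneg)
    have lim: "(\<lambda>n. F n z) \<longlonglongrightarrow> indicator U z" for z
    proof (cases "z \<in> U")
      case z: True
      then have "infdist z (-U) \<noteq> 0"
        using in_closed_iff_infdist_zero[of "-U" z] U False by auto
      then have pos: "0 < infdist z (-U)" using infdist_nonneg[of z "-U"] by linarith
      obtain N :: nat where N: "1 / infdist z (-U) < real N" using reals_Archimedean2 by blast
      have "F n z = 1" if "n \<ge> N" for n
      proof -
        have "1 / infdist z (-U) \<le> real n" using N that by linarith
        then show ?thesis using pos by (simp add: F_def field_simps)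
      qed
      then have "\<forall>\<^sub>F n in sequentially. F n z = 1" unfolding eventually_sequentially by blast
      then show ?thesis using z by (simp add: tendsto_eventually)
    next
      case False
      then show ?thesis by (simp add: F_def)
    qed
    have conv: "(\<lambda>n. integral\<^sup>L M (F n)) \<longlonglongrightarrow> measure M U" if M: "prob_space M" "sets M = sets borel" for M
    proof -
      interpret prob_space M by fact
      have [measurable]: "F n \<in> borel_measurable M" "U \<in> sets M" for n
        using borel_measurable_continuous_onI[OF cont[of n]] U M(2) by (auto cong: measurable_cong_sets)
      have "(\<lambda>n. integral\<^sup>L M (F n)) \<longlonglongrightarrow> integral\<^sup>L M (indicator U :: _ \<Rightarrow> real)"
        by (rule integral_dominated_convergence[where w = "\<lambda>_. 1"]) (use lim bd in auto)
      then show ?thesis by simp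
    qed
    have "measure A U = measure B U"
      using LIMSEQ_unique[OF conv[OF A] ] conv[OF B] eq[OF cont bd] by simp
    then show ?thesis by (simp add: A.emeasure_eq_measure B.emeasure_eq_measure)
  qed
  show ?thesis
    by (rule measure_eqI_generator_eq[where \<Omega> = UNIV and E = "{U. open U}" and A = "\<lambda>_. UNIV"])
       (auto simp: op A B borel_def Int_stable_def)
qed

section \<open>Elementary facts on couplings, and codes of pairs\<close>

lemma couplings_sets: "\<gamma> \<in> couplings \<mu> \<nu> \<Longrightarrow> sets \<gamma> = sets (\<mu> \<Otimes>\<^sub>M \<nu>)"
  by (simp add: couplings_def)

lemma couplings_space: "\<gamma> \<in> couplings \<mu> \<nu> \<Longrightarrow> space \<gamma> = space \<mu> \<times> space \<nu>"
  using sets_eq_imp_space_eq[OF couplings_sets] by (simp add: space_pair_measure)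

lemma couplings_prob:
  assumes "\<gamma> \<in> couplings \<mu> \<nu>" "prob_space \<mu>"
  shows "prob_space \<gamma>"
proof (rule prob_space_distrD)
  show "fst \<in> measurable \<gamma> \<mu>"
    using couplings_sets[OF assms(1)] by (simp cong: measurable_cong_sets)
  show "prob_space (distr \<gamma> \<mu> fst)"
    using assms by (simp add: couplings_def)
qed

lemma continuous_on_comp_index: "continuous_on UNIV (\<lambda>u :: 'b \<Rightarrow> real. u \<circ> (g :: 'a \<Rightarrow> 'b))"
  by (intro continuous_on_coordinatewise_then_product) (simp add: continuous_on_product_coordinates)

lemma borel_measurable_comp_index:
  "(\<lambda>u :: 'b::countable \<Rightarrow> real. u \<circ> (g :: 'a::countable \<Rightarrow> 'b)) \<in> borel_measurable borel"
  by (intro borel_measurable_continuous_onI continuous_on_comp_index)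

text \<open>\<open>R\<close> embeds \<open>M\<close> into a cube as a standard Borel space with left inverse \<open>T\<close>; it also fixes the
  topology to which limits and lower semicontinuity on \<open>M\<close> refer.\<close>

definition coded ::
    "'m measure \<Rightarrow> ('m \<Rightarrow> 'i::countable \<Rightarrow> real) \<Rightarrow> (('i \<Rightarrow> real) \<Rightarrow> 'm) \<Rightarrow> bool" where
  "coded M R T \<longleftrightarrow> R \<in> borel_measurable M \<and> T \<in> measurable borel M \<and>
     (\<forall>x\<in>space M. T (R x) = x \<and> (\<forall>i. 0 \<le> R x i \<and> R x i < 1))"

lemma borel_measurable_case_sum:
  fixes R :: "'m \<Rightarrow> 'i::countable \<Rightarrow> real" and R' :: "'n \<Rightarrow> 'j::countable \<Rightarrow> real"
  assumes "R \<in> borel_measurable M" "R' \<in> borel_measurable N"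
  shows "(\<lambda>p. case_sum (R (fst p)) (R' (snd p))) \<in> borel_measurable (M \<Otimes>\<^sub>M N)"
proof (rule measurable_coordinatewise_then_product)
  fix k :: "'i + 'j"
  have [measurable]: "(\<lambda>x. R x i) \<in> borel_measurable M" "(\<lambda>x. R' x j) \<in> borel_measurable N" for i j
    by (rule measurable_product_then_coordinatewise[OF assms(1)] measurable_product_then_coordinatewise[OF assms(2)])+
  show "(\<lambda>p. case_sum (R (fst p)) (R' (snd p)) k) \<in> borel_measurable (M \<Otimes>\<^sub>M N)"
    by (cases k) simp_all
qed

text \<open>Gluing works with couplings of couplings, whose points are pairs. The code of a pair is
  indexed by the disjoint sum of the two index types, which is again countable.\<close>

lemma coded_pair:
  assumes "coded M R T" "coded N R' T'"
  shows "coded (M \<Otimes>\<^sub>M N) (\<lambda>p. case_sum (R (fst p)) (R' (snd p))) (\<lambda>u. (T (u \<circ> Inl), T' (u \<circ> Inr)))"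
proof -
  note [measurable] = borel_measurable_comp_index
  have [measurable]: "T \<in> measurable borel M" "T' \<in> measurable borel N"
    using assms by (auto simp: coded_def)
  have "(\<lambda>p. case_sum (R (fst p)) (R' (snd p))) \<in> borel_measurable (M \<Otimes>\<^sub>M N)"
    using assms by (intro borel_measurable_case_sum) (auto simp: coded_def)
  moreover have "(\<lambda>u. (T (u \<circ> Inl), T' (u \<circ> Inr))) \<in> measurable borel (M \<Otimes>\<^sub>M N)"
    by measurable
  ultimately show ?thesis
    using assms unfolding coded_def by (auto simp: space_pair_measure comp_def split: sum.split)
qed

text \<open>By uniqueness of weak limits, the marginals of the cube limit \<open>K\<close> are the
  laws of \<open>R\<close> under \<open>\<mu>\<close> and of \<open>R'\<close> under
  \<open>\<nu>\<close>. The set where \<open>R (T a) = a\<close> replaces the image of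
  \<open>R\<close>: it is measurable and has full measure for the first marginal, and likewise for
  the second. Hence decoding followed by encoding is \<open>K\<close>-almost everywhere the
  identity, so integrals of continuous functions of codes do not change when \<open>K\<close> is
  decoded to \<open>\<kappa>\<close>. The marginals may vary with \<open>n\<close>, as lower
  semicontinuity in the starting points demands.\<close>

lemma coupling_limit:
  fixes R :: "'m \<Rightarrow> 'i::countable \<Rightarrow> real" and R' :: "'m \<Rightarrow> 'j::countable \<Rightarrow> real"
  assumes M: "coded M R T" and N: "coded N R' T'"
    and \<mu>n: "\<And>n. prob_space (\<mu>n n)" "\<And>n. sets (\<mu>n n) = sets M" and \<mu>: "prob_space \<mu>" "sets \<mu> = sets M"
    and \<nu>n: "\<And>n. prob_space (\<nu>n n)" "\<And>n. sets (\<nu>n n) = sets N" and \<nu>: "prob_space \<nu>" "sets \<nu> = sets N"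
    and \<mu>_lim: "\<And>F :: _ \<Rightarrow> real. continuous_on UNIV F \<Longrightarrow> (\<And>u. \<bar>F u\<bar> \<le> 1) \<Longrightarrow>
           (\<lambda>n. \<integral>x. F (R x) \<partial>\<mu>n n) \<longlonglongrightarrow> (\<integral>x. F (R x) \<partial>\<mu>)"
    and \<nu>_lim: "\<And>F :: _ \<Rightarrow> real. continuous_on UNIV F \<Longrightarrow> (\<And>u. \<bar>F u\<bar> \<le> 1) \<Longrightarrow>
           (\<lambda>n. \<integral>x. F (R' x) \<partial>\<nu>n n) \<longlonglongrightarrow> (\<integral>x. F (R' x) \<partial>\<nu>)"
    and \<gamma>: "\<And>n. \<gamma> n \<in> couplings (\<mu>n n) (\<nu>n n)"
  obtains r \<kappa> where "strict_mono (r :: nat \<Rightarrow> nat)" "\<kappa> \<in> couplings \<mu> \<nu>"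
    "\<And>(F :: _ \<Rightarrow> real) B. continuous_on UNIV F \<Longrightarrow> (\<And>z. \<bar>F z\<bar> \<le> B) \<Longrightarrow>
       (\<lambda>n. \<integral>p. F (R (fst p), R' (snd p)) \<partial>\<gamma> (r n)) \<longlonglongrightarrow> (\<integral>p. F (R (fst p), R' (snd p)) \<partial>\<kappa>)"
proof -
  define e where "e p = case_sum (R (fst p)) (R' (snd p))" for p
  have eI: "e p \<circ> Inl = R (fst p)" "e p \<circ> Inr = R' (snd p)" for p
    by (auto simp: e_def)
  note [measurable] = borel_measurable_comp_index
  have [measurable]: "R \<in> borel_measurable M" "T \<in> measurable borel M"
      "R' \<in> borel_measurable N" "T' \<in> measurable borel N"
    and inv: "\<And>x. x \<in> space M \<Longrightarrow> T (R x) = x" "\<And>x. x \<in> space N \<Longrightarrow> T' (R' x) = x"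
    and R01: "\<And>x i. x \<in> space M \<Longrightarrow> 0 \<le> R x i \<and> R x i < 1" "\<And>x i. x \<in> space N \<Longrightarrow> 0 \<le> R' x i \<and> R' x i < 1"
    using M N by (auto simp: coded_def)
  have sets\<gamma>: "sets (\<gamma> n) = sets (M \<Otimes>\<^sub>M N)" for n
    using couplings_sets[OF \<gamma>[of n]] sets_pair_measure_cong[OF \<mu>n(2)[of n] \<nu>n(2)[of n]] by simp
  have space\<gamma>: "space (\<gamma> n) = space M \<times> space N" for n
    using sets_eq_imp_space_eq[OF sets\<gamma>[of n]] by (simp add: space_pair_measure)
  have e[measurable]: "e \<in> borel_measurable (M \<Otimes>\<^sub>M N)"
    unfolding e_def[abs_def] by (intro borel_measurable_case_sum) auto
  have e': "e \<in> borel_measurable (\<gamma> n)" for n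
    using e measurable_cong_sets[OF sets\<gamma> refl] by blast
  have e01: "0 \<le> e p i \<and> e p i < 1" if "p \<in> space (\<gamma> n)" for n p i
    using that R01 by (cases i) (auto simp: e_def space\<gamma>)
  obtain r K where r: "strict_mono (r :: nat \<Rightarrow> nat)" and K: "prob_space K" "sets K = sets borel"
    and conv: "\<And>(F :: _ \<Rightarrow> real) B. continuous_on UNIV F \<Longrightarrow> (\<And>u. \<bar>F u\<bar> \<le> B) \<Longrightarrow>
       (\<lambda>n. \<integral>p. F (e p) \<partial>\<gamma> (r n)) \<longlonglongrightarrow> (\<integral>u. F u \<partial>K)"
  proof (rule weakly_convergent_subsequence[of \<gamma> e, OF couplings_prob[OF \<gamma> \<mu>n(1)] e' e01], goal_cases)
    case (2 r K)
    show ?case by (rule 2(1)[OF 2(2-5)])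
  qed
  interpret K: prob_space K by fact
  have distr_fst: "distr (\<gamma> n) (\<mu>n n) fst = \<mu>n n" "distr (\<gamma> n) (\<nu>n n) snd = \<nu>n n" for n
    using \<gamma>[of n] by (auto simp: couplings_def)
  have marg1: "(\<integral>p. f (fst p) \<partial>\<gamma> n) = (\<integral>x. f x \<partial>\<mu>n n)" if "f \<in> borel_measurable M" for f :: "'m \<Rightarrow> real" and n
  proof -
    have [measurable]: "fst \<in> measurable (\<gamma> n) (\<mu>n n)"
      using couplings_sets[OF \<gamma>[of n]] by (simp cong: measurable_cong_sets)
    have [measurable]: "f \<in> borel_measurable (\<mu>n n)" using that \<mu>n(2) by (simp cong: measurable_cong_sets)
    show ?thesis
      by (subst distr_fst(1)[symmetric], subst integral_distr) auto
  qed
  have marg2: "(\<integral>p. f (snd p) \<partial>\<gamma> n) = (\<integral>x. f x \<partial>\<nu>n n)" if "f \<in> borel_measurable N" for f :: "'m \<Rightarrow> real" and n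
  proof -
    have [measurable]: "snd \<in> measurable (\<gamma> n) (\<nu>n n)"
      using couplings_sets[OF \<gamma>[of n]] by (simp cong: measurable_cong_sets)
    have [measurable]: "f \<in> borel_measurable (\<nu>n n)" using that \<nu>n(2) by (simp cong: measurable_cong_sets)
    show ?thesis
      by (subst distr_fst(2)[symmetric], subst integral_distr) auto
  qed
  have Rm: "R \<in> borel_measurable \<mu>" "R' \<in> borel_measurable \<nu>"
    using \<mu>(2) \<nu>(2) by (simp_all cong: measurable_cong_sets)
  have KI: "(\<lambda>u. u \<circ> Inl) \<in> measurable K borel" "(\<lambda>u. u \<circ> Inr) \<in> measurable K borel"
    using K(2) by (simp_all cong: measurable_cong_sets)
  have A: "distr K borel (\<lambda>u. u \<circ> Inl) = distr \<mu> borel R"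
  proof (rule borel_prob_eqI)
    show "prob_space (distr K borel (\<lambda>u. u \<circ> Inl))" by (rule K.prob_space_distr) (rule KI)
    show "prob_space (distr \<mu> borel R)" by (rule prob_space.prob_space_distr[OF \<mu>(1) Rm(1)])
    fix F :: "('i \<Rightarrow> real) \<Rightarrow> real"
    assume F: "continuous_on UNIV F" "\<And>z. \<bar>F z\<bar> \<le> 1"
    have [measurable]: "F \<in> borel_measurable borel" using F by (intro borel_measurable_continuous_onI)
    have "continuous_on UNIV (\<lambda>u. F (u \<circ> (Inl :: 'i \<Rightarrow> 'i + 'j)))"
      using continuous_on_compose2[OF F(1) continuous_on_comp_index] by auto
    from conv[OF this F(2)] have "(\<lambda>n. \<integral>p. F (R (fst p)) \<partial>\<gamma> (r n)) \<longlonglongrightarrow> (\<integral>u. F (u \<circ> Inl) \<partial>K)"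
      by (simp add: eI)
    moreover have "(\<lambda>n. \<integral>p. F (R (fst p)) \<partial>\<gamma> (r n)) \<longlonglongrightarrow> (\<integral>x. F (R x) \<partial>\<mu>)"
      using LIMSEQ_subseq_LIMSEQ[OF \<mu>_lim[OF F] r] marg1[of "\<lambda>x. F (R x)"] by (simp add: comp_def)
    ultimately show "integral\<^sup>L (distr K borel (\<lambda>u. u \<circ> Inl)) F = integral\<^sup>L (distr \<mu> borel R) F"
      using KI Rm by (simp add: integral_distr LIMSEQ_unique)
  qed simp_all
  have B: "distr K borel (\<lambda>u. u \<circ> Inr) = distr \<nu> borel R'"
  proof (rule borel_prob_eqI)
    show "prob_space (distr K borel (\<lambda>u. u \<circ> Inr))" by (rule K.prob_space_distr) (rule KI)
    show "prob_space (distr \<nu> borel R')" by (rule prob_space.prob_space_distr[OF \<nu>(1) Rm(2)])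
    fix F :: "('j \<Rightarrow> real) \<Rightarrow> real"
    assume F: "continuous_on UNIV F" "\<And>z. \<bar>F z\<bar> \<le> 1"
    have [measurable]: "F \<in> borel_measurable borel" using F by (intro borel_measurable_continuous_onI)
    have "continuous_on UNIV (\<lambda>u. F (u \<circ> (Inr :: 'j \<Rightarrow> 'i + 'j)))"
      using continuous_on_compose2[OF F(1) continuous_on_comp_index] by auto
    from conv[OF this F(2)] have "(\<lambda>n. \<integral>p. F (R' (snd p)) \<partial>\<gamma> (r n)) \<longlonglongrightarrow> (\<integral>u. F (u \<circ> Inr) \<partial>K)"
      by (simp add: eI)
    moreover have "(\<lambda>n. \<integral>p. F (R' (snd p)) \<partial>\<gamma> (r n)) \<longlonglongrightarrow> (\<integral>x. F (R' x) \<partial>\<nu>)"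
      using LIMSEQ_subseq_LIMSEQ[OF \<nu>_lim[OF F] r] marg2[of "\<lambda>x. F (R' x)"] by (simp add: comp_def)
    ultimately show "integral\<^sup>L (distr K borel (\<lambda>u. u \<circ> Inr)) F = integral\<^sup>L (distr \<nu> borel R') F"
      using KI Rm by (simp add: integral_distr LIMSEQ_unique)
  qed simp_all
  define S where "S u = (T (u \<circ> Inl), T' (u \<circ> Inr))" for u
  have S: "S \<in> measurable K (\<mu> \<Otimes>\<^sub>M \<nu>)" "S \<in> measurable K (M \<Otimes>\<^sub>M N)"
  proof -
    show 1: "S \<in> measurable K (M \<Otimes>\<^sub>M N)"
      unfolding S_def using K(2) by (simp cong: measurable_cong_sets)
    show "S \<in> measurable K (\<mu> \<Otimes>\<^sub>M \<nu>)"
      using 1 measurable_cong_sets[OF refl sets_pair_measure_cong[OF \<mu>(2) \<nu>(2)]] by blast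
  qed
  define \<kappa> where "\<kappa> = distr K (\<mu> \<Otimes>\<^sub>M \<nu>) S"
  have TM: "T \<in> measurable borel \<mu>" "T' \<in> measurable borel \<nu>"
    using \<mu>(2) \<nu>(2) by (simp_all cong: measurable_cong_sets)
  have sp: "space \<mu> = space M" "space \<nu> = space N" using sets_eq_imp_space_eq[OF \<mu>(2)] sets_eq_imp_space_eq[OF \<nu>(2)] by auto
  have \<kappa>: "\<kappa> \<in> couplings \<mu> \<nu>"
  proof -
    have "distr \<kappa> \<mu> fst = distr K \<mu> (T \<circ> (\<lambda>u. u \<circ> Inl))"
      unfolding \<kappa>_def using S by (subst distr_distr) (auto simp: S_def comp_def)
    also have "\<dots> = distr \<mu> \<mu> (T \<circ> R)"
      unfolding distr_distr[OF TM(1) KI(1), symmetric] A using TM Rm by (rule_tac distr_distr)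
    also have "\<dots> = distr \<mu> \<mu> (\<lambda>x. x)"
      by (intro distr_cong) (auto simp: inv sp)
    finally have 1: "distr \<kappa> \<mu> fst = \<mu>" by simp
    have "distr \<kappa> \<nu> snd = distr K \<nu> (T' \<circ> (\<lambda>u. u \<circ> Inr))"
      unfolding \<kappa>_def using S by (subst distr_distr) (auto simp: S_def comp_def)
    also have "\<dots> = distr \<nu> \<nu> (T' \<circ> R')"
      unfolding distr_distr[OF TM(2) KI(2), symmetric] B using TM Rm by (rule_tac distr_distr)
    also have "\<dots> = distr \<nu> \<nu> (\<lambda>x. x)"
      by (intro distr_cong) (auto simp: inv sp)
    finally show ?thesis using 1 by (simp add: couplings_def \<kappa>_def)
  qed
  \<comment> \<open>The equation holds at every \<open>R x\<close>, hence almost everywhere for the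
    law of \<open>R\<close>; the identity \<open>A\<close> transfers this to the first marginal of
    \<open>K\<close>.\<close>
  have AE1: "AE u in K. R (T (u \<circ> Inl)) = u \<circ> Inl"
  proof -
    have "AE x in \<mu>. R (T (R x)) = R x" by (rule AE_I2) (simp add: inv sp)
    moreover have "{a \<in> space borel. R (T a) = a} \<in> sets borel" by (rule measurable_equality_set) measurable
    ultimately have "AE a in distr \<mu> borel R. R (T a) = a"
      using AE_distr_iff[OF Rm(1), of "\<lambda>a. R (T a) = a"] by blast
    then show ?thesis unfolding A[symmetric] by (rule AE_distrD[OF KI(1)])
  qed
  have AE2: "AE u in K. R' (T' (u \<circ> Inr)) = u \<circ> Inr"
  proof -
    have "AE x in \<nu>. R' (T' (R' x)) = R' x" by (rule AE_I2) (simp add: inv sp)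
    moreover have "{a \<in> space borel. R' (T' a) = a} \<in> sets borel" by (rule measurable_equality_set) measurable
    ultimately have "AE a in distr \<nu> borel R'. R' (T' a) = a"
      using AE_distr_iff[OF Rm(2), of "\<lambda>a. R' (T' a) = a"] by blast
    then show ?thesis unfolding B[symmetric] by (rule AE_distrD[OF KI(2)])
  qed
  show thesis
  proof
    show "strict_mono r" "\<kappa> \<in> couplings \<mu> \<nu>" by fact+
    fix F :: "('i \<Rightarrow> real) \<times> ('j \<Rightarrow> real) \<Rightarrow> real" and B
    assume F: "continuous_on UNIV F" "\<And>z. \<bar>F z\<bar> \<le> B"
    have Fm: "F \<in> borel_measurable (borel \<Otimes>\<^sub>M borel)"
      unfolding borel_prod using F by (intro borel_measurable_continuous_onI)
    have Fm1: "(\<lambda>p. F (R (fst p), R' (snd p))) \<in> borel_measurable (M \<Otimes>\<^sub>M N)"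
      using Fm by measurable
    then have Fm2: "(\<lambda>p. F (R (fst p), R' (snd p))) \<in> borel_measurable (\<mu> \<Otimes>\<^sub>M \<nu>)"
      using measurable_cong_sets[OF sets_pair_measure_cong[OF \<mu>(2) \<nu>(2)] refl] by blast
    have "continuous_on UNIV (\<lambda>u. F (u \<circ> (Inl :: 'i \<Rightarrow> 'i + 'j), u \<circ> (Inr :: 'j \<Rightarrow> 'i + 'j)))"
      using continuous_on_compose2[OF F(1) continuous_on_Pair[OF continuous_on_comp_index continuous_on_comp_index]] by auto
    from conv[OF this F(2)]
    have "(\<lambda>n. \<integral>p. F (R (fst p), R' (snd p)) \<partial>\<gamma> (r n)) \<longlonglongrightarrow> (\<integral>u. F (u \<circ> Inl, u \<circ> Inr) \<partial>K)"
      by (simp add: eI)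
    also have "(\<integral>u. F (u \<circ> Inl, u \<circ> Inr) \<partial>K) = (\<integral>u. F (R (fst (S u)), R' (snd (S u))) \<partial>K)"
    proof (rule integral_cong_AE)
      show "(\<lambda>u. F (u \<circ> Inl, u \<circ> Inr)) \<in> borel_measurable K"
        using KI Fm by measurable
      show "(\<lambda>u. F (R (fst (S u)), R' (snd (S u)))) \<in> borel_measurable K"
        using measurable_compose[OF S(2) Fm1] by simp
      show "AE u in K. F (u \<circ> Inl, u \<circ> Inr) = F (R (fst (S u)), R' (snd (S u)))"
        using AE1 AE2 by eventually_elim (simp add: S_def)
    qed
    also have "\<dots> = (\<integral>p. F (R (fst p), R' (snd p)) \<partial>\<kappa>)"
      unfolding \<kappa>_def using S Fm2 by (subst integral_distr) auto
    finally show "(\<lambda>n. \<integral>p. F (R (fst p), R' (snd p)) \<partial>\<gamma> (r n)) \<longlonglongrightarrow> (\<integral>p. F (R (fst p), R' (snd p)) \<partial>\<kappa>)" .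
  qed
qed

text \<open>This is Lipschitz regularisation (the Pasch-Hausdorff envelope): \<open>I k\<close> is
  the infimal convolution of \<open>f\<close> with \<open>real k\<close> times the distance, hence
  Lipschitz on the whole target space although \<open>f\<close> lives on \<open>X\<close> only.
  Close to \<open>h x\<close> lower semicontinuity keeps \<open>f\<close> above \<open>a\<close>;
  further away the penalty alone exceeds \<open>a\<close> once \<open>k\<close> is large.\<close>

lemma lsc_approx:
  fixes h :: "'x \<Rightarrow> 'z::metric_space" and f :: "'x \<Rightarrow> real"
  assumes f01: "\<And>x. x \<in> X \<Longrightarrow> 0 \<le> f x \<and> f x \<le> 1" and "X \<noteq> {}"
    and lsc: "\<And>x a. x \<in> X \<Longrightarrow> a < f x \<Longrightarrow> \<exists>V. open V \<and> h x \<in> V \<and> (\<forall>y\<in>X. h y \<in> V \<longrightarrow> a < f y)"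
  obtains F :: "nat \<Rightarrow> 'z \<Rightarrow> real" where "\<And>k. continuous_on UNIV (F k)" "\<And>k z. 0 \<le> F k z \<and> F k z \<le> 1"
    "\<And>k x. x \<in> X \<Longrightarrow> F k (h x) \<le> f x" "\<And>x. x \<in> X \<Longrightarrow> (\<lambda>k. F k (h x)) \<longlonglongrightarrow> f x"
proof -
  define I where "I k z = (INF w\<in>X. f w + real k * dist z (h w))" for k z
  have bdd: "bdd_below ((\<lambda>w. f w + real k * dist z (h w)) ` X)" for k z
    using f01 by (intro bdd_belowI2[of _ 0]) auto
  have lower: "I k z \<le> f w + real k * dist z (h w)" if "w \<in> X" for k z w
    unfolding I_def by (intro cINF_lower bdd that)
  have greatest: "a \<le> I k z" if "\<And>w. w \<in> X \<Longrightarrow> a \<le> f w + real k * dist z (h w)" for a k z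
    unfolding I_def using \<open>X \<noteq> {}\<close> that by (intro cINF_greatest)
  have lip: "I k z \<le> I k z' + real k * dist z z'" for k z z'
  proof -
    have "I k z - real k * dist z z' \<le> I k z'"
    proof (rule greatest)
      fix w assume "w \<in> X"
      have "real k * dist z (h w) \<le> real k * (dist z z' + dist z' (h w))"
        by (intro mult_left_mono dist_triangle) simp
      then show "I k z - real k * dist z z' \<le> f w + real k * dist z' (h w)"
        using lower[OF \<open>w \<in> X\<close>, of k z] by (simp add: algebra_simps)
    qed
    then show ?thesis by simp
  qed
  have "(real k)-lipschitz_on UNIV (I k)" for k
  proof (rule lipschitz_onI)
    fix z z'
    show "dist (I k z) (I k z') \<le> real k * dist z z'"
      using lip[of k z z'] lip[of k z' z] by (simp add: dist_real_def dist_commute abs_le_iff)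
  qed simp
  then have cont: "continuous_on UNIV (I k)" for k by (rule lipschitz_on_continuous_on)
  have le: "I k (h x) \<le> f x" if "x \<in> X" for k x
    using lower[OF that, of k "h x"] by simp
  have nonneg: "0 \<le> I k z" for k z by (rule greatest) (use f01 in auto)
  define F where "F k z = min 1 (I k z)" for k z
  show thesis
  proof
    show "continuous_on UNIV (F k)" for k unfolding F_def by (intro continuous_intros cont)
    show "0 \<le> F k z \<and> F k z \<le> 1" for k z using nonneg[of k z] by (simp add: F_def)
    show F_le: "F k (h x) \<le> f x" if "x \<in> X" for k x using le[OF that, of k] by (simp add: F_def)
    show "(\<lambda>k. F k (h x)) \<longlonglongrightarrow> f x" if x: "x \<in> X" for x
    proof (rule order_tendstoI)
      fix a assume "f x < a"
      then show "\<forall>\<^sub>F k in sequentially. F k (h x) < a"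
        using F_le[OF x] le_less_trans by (auto intro!: always_eventually)
    next
      fix a' assume "a' < f x"
      then obtain a where a: "a' < a" "a < f x" using dense by blast
      obtain V where V: "open V" "h x \<in> V" "\<And>y. y \<in> X \<Longrightarrow> h y \<in> V \<Longrightarrow> a < f y"
        using lsc[OF x a(2)] by blast
      obtain e where e: "e > 0" "\<And>z. dist z (h x) < e \<Longrightarrow> z \<in> V"
        using V(1,2) unfolding open_dist by blast
      \<comment> \<open>For \<open>k \<ge> N\<close> the penalty at distance \<open>e\<close> is at
        least 1, and \<open>a < f x \<le> 1\<close>.\<close>
      obtain N :: nat where N: "1 / e < real N" using reals_Archimedean2 by blast
      have a1: "a < 1" using a(2) f01[OF x] by linarith
      have "a' < F k (h x)" if "k \<ge> N" for k
      proof -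
        have "a \<le> I k (h x)"
        proof (rule greatest)
          fix w assume w: "w \<in> X"
          show "a \<le> f w + real k * dist (h x) (h w)"
          proof (cases "dist (h w) (h x) < e")
            case True
            then have "a < f w" using V(3)[OF w] e(2) by blast
            moreover have "0 \<le> real k * dist (h x) (h w)" by simp
            ultimately show ?thesis by linarith
          next
            case False
            have "1 \<le> real N * e" using N e(1) by (simp add: field_simps)
            also have "\<dots> \<le> real k * dist (h x) (h w)"
              using False that e(1) by (intro mult_mono) (auto simp: dist_commute)
            finally show ?thesis using f01[OF w] a1 by linarith
          qed
        qed
        then show ?thesis using a(1) a1 by (simp add: F_def)
      qed
      then show "\<forall>\<^sub>F k in sequentially. a' < F k (h x)" unfolding eventually_sequentially by blast
    qed
  qed
qed

section \<open>Lower semicontinuous transport costs and gluing\<close>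

text \<open>Neighbourhoods are taken in code space. For paths this is the topology of convergence at
  rational times, so the requirement is stronger than lower semicontinuity for the uniform
  metric.\<close>

definition lsc_cost :: "'m measure \<Rightarrow> ('m \<Rightarrow> 'i::countable \<Rightarrow> real) \<Rightarrow> ('m \<Rightarrow> 'm \<Rightarrow> real) \<Rightarrow> bool" where
  "lsc_cost M R C \<longleftrightarrow>
     (\<lambda>p. C (fst p) (snd p)) \<in> borel_measurable (M \<Otimes>\<^sub>M M) \<and>
     (\<forall>x\<in>space M. \<forall>y\<in>space M. 0 \<le> C x y \<and> C x y \<le> 1) \<and>
     (\<forall>x\<in>space M. \<forall>y\<in>space M. \<forall>a < C x y. \<exists>V. open V \<and> (R x, R y) \<in> V \<and>
        (\<forall>x'\<in>space M. \<forall>y'\<in>space M. (R x', R y') \<in> V \<longrightarrow> a < C x' y'))"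

lemma prob_integrable_bounded:
  fixes f :: "'m \<Rightarrow> real"
  assumes "prob_space \<mu>" "f \<in> borel_measurable \<mu>" "\<And>x. x \<in> space \<mu> \<Longrightarrow> \<bar>f x\<bar> \<le> B"
  shows "integrable \<mu> f"
proof -
  interpret prob_space \<mu> by fact
  show ?thesis by (rule integrable_const_bound[of _ B]) (use assms in auto)
qed

lemma lsc_cost_measurable:
  assumes "lsc_cost M R C" "sets \<gamma> = sets (M \<Otimes>\<^sub>M M)"
  shows "(\<lambda>p. C (fst p) (snd p)) \<in> borel_measurable \<gamma>"
  unfolding measurable_cong_sets[OF assms(2) refl] using assms(1) by (simp add: lsc_cost_def)

lemma lsc_cost_integrable:
  assumes "lsc_cost M R C" "prob_space \<gamma>" "sets \<gamma> = sets (M \<Otimes>\<^sub>M M)"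
  shows "integrable \<gamma> (\<lambda>p. C (fst p) (snd p))"
proof (rule prob_integrable_bounded[where B = 1])
  have "space \<gamma> = space M \<times> space M"
    using sets_eq_imp_space_eq[OF assms(3)] by (simp add: space_pair_measure)
  then show "\<bar>C (fst p) (snd p)\<bar> \<le> 1" if "p \<in> space \<gamma>" for p
    using that assms(1) by (auto simp: lsc_cost_def)
qed (use assms lsc_cost_measurable in auto)

text \<open>One half of the portmanteau theorem: for a fixed continuous minorant \<open>F k\<close>
  the limit in \<open>n\<close> is weak convergence, and only afterwards \<open>k\<close> grows, by
  dominated convergence under \<open>\<kappa>\<close>. The opposite order of limits would need
  uniformity in \<open>n\<close>.\<close>

lemma lsc_cost_integral_limit:
  fixes \<gamma> :: "nat \<Rightarrow> ('m \<times> 'm) measure" and R :: "'m \<Rightarrow> 'i::countable \<Rightarrow> real"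
  assumes R: "R \<in> borel_measurable M" and C: "lsc_cost M R C"
    and \<gamma>: "\<And>n. prob_space (\<gamma> n)" "\<And>n. sets (\<gamma> n) = sets (M \<Otimes>\<^sub>M M)"
    and \<kappa>: "prob_space \<kappa>" "sets \<kappa> = sets (M \<Otimes>\<^sub>M M)"
    and conv: "\<And>(F :: _ \<Rightarrow> real) B. continuous_on UNIV F \<Longrightarrow> (\<And>z. \<bar>F z\<bar> \<le> B) \<Longrightarrow>
       (\<lambda>n. \<integral>p. F (R (fst p), R (snd p)) \<partial>\<gamma> n) \<longlonglongrightarrow> (\<integral>p. F (R (fst p), R (snd p)) \<partial>\<kappa>)"
    and le: "\<And>n. (\<integral>p. C (fst p) (snd p) \<partial>\<gamma> n) \<le> a n" and a: "a \<longlonglongrightarrow> l"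
  shows "(\<integral>p. C (fst p) (snd p) \<partial>\<kappa>) \<le> l"
proof -
  have sp: "space \<gamma> = space M \<times> space M" if "sets \<gamma> = sets (M \<Otimes>\<^sub>M M)" for \<gamma>
    using sets_eq_imp_space_eq[OF that] by (simp add: space_pair_measure)
  have ne: "space M \<times> space M \<noteq> {}"
    using prob_space.not_empty[OF \<kappa>(1)] sp[OF \<kappa>(2)] by simp
  obtain F :: "nat \<Rightarrow> _ \<Rightarrow> real" where F: "\<And>k. continuous_on UNIV (F k)" "\<And>k z. 0 \<le> F k z \<and> F k z \<le> 1"
    "\<And>k p. p \<in> space M \<times> space M \<Longrightarrow> F k (R (fst p), R (snd p)) \<le> C (fst p) (snd p)"
    "\<And>p. p \<in> space M \<times> space M \<Longrightarrow> (\<lambda>k. F k (R (fst p), R (snd p))) \<longlonglongrightarrow> C (fst p) (snd p)"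
    by (rule lsc_approx[of "space M \<times> space M" "\<lambda>p. C (fst p) (snd p)" "\<lambda>p. (R (fst p), R (snd p))"])
       (use C ne in \<open>auto simp: lsc_cost_def\<close>)
  have Fm: "(\<lambda>p. F k (R (fst p), R (snd p))) \<in> borel_measurable \<gamma>" if "sets \<gamma> = sets (M \<Otimes>\<^sub>M M)" for k \<gamma>
  proof -
    have [measurable]: "F k \<in> borel_measurable (borel \<Otimes>\<^sub>M borel)"
      unfolding borel_prod by (rule borel_measurable_continuous_onI[OF F(1)])
    note R[measurable]
    have "(\<lambda>p. F k (R (fst p), R (snd p))) \<in> borel_measurable (M \<Otimes>\<^sub>M M)" by measurable
    then show ?thesis using measurable_cong_sets[OF that refl] by blast
  qed
  have Fl: "(\<integral>p. F k (R (fst p), R (snd p)) \<partial>\<kappa>) \<le> l" for k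
  proof (rule LIMSEQ_le[OF conv a])
    show "continuous_on UNIV (F k)" "\<bar>F k z\<bar> \<le> 1" for z using F by auto
    have "(\<integral>p. F k (R (fst p), R (snd p)) \<partial>\<gamma> n) \<le> a n" for n
    proof (rule order_trans[OF integral_mono le])
      show "integrable (\<gamma> n) (\<lambda>p. F k (R (fst p), R (snd p)))"
        using F(2) Fm[OF \<gamma>(2)] by (intro prob_integrable_bounded[where B = 1] \<gamma>) auto
      show "integrable (\<gamma> n) (\<lambda>p. C (fst p) (snd p))" by (rule lsc_cost_integrable[OF C \<gamma>])
      show "F k (R (fst p), R (snd p)) \<le> C (fst p) (snd p)" if "p \<in> space (\<gamma> n)" for p
        using F(3) that sp[OF \<gamma>(2)] by auto
    qed
    then show "\<exists>N. \<forall>n\<ge>N. (\<integral>p. F k (R (fst p), R (snd p)) \<partial>\<gamma> n) \<le> a n" by blast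
  qed
  interpret \<kappa>: prob_space \<kappa> by fact
  have "(\<lambda>k. \<integral>p. F k (R (fst p), R (snd p)) \<partial>\<kappa>) \<longlonglongrightarrow> (\<integral>p. C (fst p) (snd p) \<partial>\<kappa>)"
  proof (rule integral_dominated_convergence[where w = "\<lambda>_. 1"])
    show "AE p in \<kappa>. (\<lambda>k. F k (R (fst p), R (snd p))) \<longlonglongrightarrow> C (fst p) (snd p)"
      using F(4) sp[OF \<kappa>(2)] by auto
    show "AE p in \<kappa>. norm (F k (R (fst p), R (snd p))) \<le> 1" for k using F(2) by auto
  qed (use Fm[OF \<kappa>(2)] lsc_cost_measurable[OF C \<kappa>(2)] in auto)
  from LIMSEQ_le_const2[OF this] Fl show ?thesis by blast
qed

text \<open>The subsequence and \<open>\<kappa>\<close> are chosen before the cost, so one limit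
  serves all costs \<open>C\<close>; the fixpoint inequality tests a single \<open>\<kappa>\<close>
  against every iterate. The threshold \<open>N\<close> admits bounds that hold only from some index
  on.\<close>

lemma transport_limit:
  fixes R :: "'m \<Rightarrow> 'i::countable \<Rightarrow> real"
  assumes M: "coded M R T"
    and \<mu>n: "\<And>n. prob_space (\<mu>n n)" "\<And>n. sets (\<mu>n n) = sets M" and \<mu>: "prob_space \<mu>" "sets \<mu> = sets M"
    and \<nu>n: "\<And>n. prob_space (\<nu>n n)" "\<And>n. sets (\<nu>n n) = sets M" and \<nu>: "prob_space \<nu>" "sets \<nu> = sets M"
    and \<mu>_lim: "\<And>F :: _ \<Rightarrow> real. continuous_on UNIV F \<Longrightarrow> (\<And>u. \<bar>F u\<bar> \<le> 1) \<Longrightarrow>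
           (\<lambda>n. \<integral>x. F (R x) \<partial>\<mu>n n) \<longlonglongrightarrow> (\<integral>x. F (R x) \<partial>\<mu>)"
    and \<nu>_lim: "\<And>F :: _ \<Rightarrow> real. continuous_on UNIV F \<Longrightarrow> (\<And>u. \<bar>F u\<bar> \<le> 1) \<Longrightarrow>
           (\<lambda>n. \<integral>x. F (R x) \<partial>\<nu>n n) \<longlonglongrightarrow> (\<integral>x. F (R x) \<partial>\<nu>)"
    and \<gamma>: "\<And>n. \<gamma> n \<in> couplings (\<mu>n n) (\<nu>n n)"
  obtains r \<kappa> where "strict_mono (r :: nat \<Rightarrow> nat)" "\<kappa> \<in> couplings \<mu> \<nu>"
    "\<And>C a l N. lsc_cost M R C \<Longrightarrow> (\<And>n. N \<le> n \<Longrightarrow> (\<integral>p. C (fst p) (snd p) \<partial>\<gamma> (r n)) \<le> a n) \<Longrightarrow> a \<longlonglongrightarrow> l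
       \<Longrightarrow> (\<integral>p. C (fst p) (snd p) \<partial>\<kappa>) \<le> l"
proof (rule coupling_limit[OF M M \<mu>n \<mu> \<nu>n \<nu> \<mu>_lim \<nu>_lim \<gamma>], goal_cases)
  case (5 r \<kappa>)
  have R: "R \<in> borel_measurable M" using M by (simp add: coded_def)
  show ?case
  proof (rule 5(1)[OF 5(2,3)])
    fix C :: "'m \<Rightarrow> 'm \<Rightarrow> real" and a l N
    assume C: "lsc_cost M R C" and le: "\<And>n. N \<le> n \<Longrightarrow> (\<integral>p. C (fst p) (snd p) \<partial>\<gamma> (r n)) \<le> a n" and a: "a \<longlonglongrightarrow> l"
    show "(\<integral>p. C (fst p) (snd p) \<partial>\<kappa>) \<le> l"
    proof (rule lsc_cost_integral_limit[OF R C, of "\<lambda>n. \<gamma> (r (n + N))"])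
      show "prob_space (\<gamma> (r (n + N)))" for n by (rule couplings_prob[OF \<gamma> \<mu>n(1)])
      show "sets (\<gamma> (r (n + N))) = sets (M \<Otimes>\<^sub>M M)" for n
        using couplings_sets[OF \<gamma>] sets_pair_measure_cong[OF \<mu>n(2) \<nu>n(2)] by metis
      show "prob_space \<kappa>" by (rule couplings_prob[OF 5(3) \<mu>(1)])
      show "sets \<kappa> = sets (M \<Otimes>\<^sub>M M)"
        using couplings_sets[OF 5(3)] sets_pair_measure_cong[OF \<mu>(2) \<nu>(2)] by metis
      show "(\<lambda>n. \<integral>p. F (R (fst p), R (snd p)) \<partial>\<gamma> (r (n + N))) \<longlonglongrightarrow> (\<integral>p. F (R (fst p), R (snd p)) \<partial>\<kappa>)"
        if "continuous_on UNIV F" "\<And>z. \<bar>F z\<bar> \<le> B" for F :: "_ \<Rightarrow> real" and B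
        using LIMSEQ_ignore_initial_segment[OF 5(4)[OF that], of N] .
      show "(\<integral>p. C (fst p) (snd p) \<partial>\<gamma> (r (n + N))) \<le> a (n + N)" for n using le by simp
      show "(\<lambda>n. a (n + N)) \<longlonglongrightarrow> l" using a by (rule LIMSEQ_ignore_initial_segment)
    qed
  qed
qed

section \<open>Couplings, transport costs and gluing\<close>

lemma couplings_distr:
  assumes \<mu>: "sets \<mu> = sets M" and \<nu>: "sets \<nu> = sets M"
    and f: "f \<in> measurable K M" and g: "g \<in> measurable K M"
    and "distr K M f = \<mu>" "distr K M g = \<nu>"
  shows "distr K (\<mu> \<Otimes>\<^sub>M \<nu>) (\<lambda>x. (f x, g x)) \<in> couplings \<mu> \<nu>"
proof -
  have m: "(\<lambda>x. (f x, g x)) \<in> measurable K (\<mu> \<Otimes>\<^sub>M \<nu>)"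
    using f g \<mu> \<nu> by (intro measurable_Pair) (simp_all cong: measurable_cong_sets)
  have "distr K \<mu> f = \<mu>" "distr K \<nu> g = \<nu>"
    using assms distr_cong[OF refl \<mu>, of K f f] distr_cong[OF refl \<nu>, of K g g] by auto
  then show ?thesis
    using m by (simp add: couplings_def distr_distr comp_def)
qed

lemma couplings_nonempty:
  assumes "prob_space \<mu>" "prob_space \<nu>"
  shows "couplings \<mu> \<nu> \<noteq> {}"
proof -
  interpret \<mu>: prob_space \<mu> by fact
  interpret \<nu>: prob_space \<nu> by fact
  interpret pair_prob_space \<mu> \<nu> ..
  have "\<mu> \<Otimes>\<^sub>M \<nu> \<in> couplings \<mu> \<nu>"
    unfolding couplings_def
  proof (safe intro!: measure_eqI)
    fix A assume "A \<in> sets (distr (\<mu> \<Otimes>\<^sub>M \<nu>) \<mu> fst)"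
    then have A: "A \<in> sets \<mu>" by simp
    have "fst -` A \<inter> space (\<mu> \<Otimes>\<^sub>M \<nu>) = A \<times> space \<nu>"
      using sets.sets_into_space[OF A] by (auto simp: space_pair_measure)
    then show "emeasure (distr (\<mu> \<Otimes>\<^sub>M \<nu>) \<mu> fst) A = emeasure \<mu> A"
      using A by (simp add: emeasure_distr \<nu>.emeasure_pair_measure_Times \<nu>.emeasure_space_1)
  next
    fix A assume "A \<in> sets (distr (\<mu> \<Otimes>\<^sub>M \<nu>) \<nu> snd)"
    then have A: "A \<in> sets \<nu>" by simp
    have "snd -` A \<inter> space (\<mu> \<Otimes>\<^sub>M \<nu>) = space \<mu> \<times> A"
      using sets.sets_into_space[OF A] by (auto simp: space_pair_measure)
    then show "emeasure (distr (\<mu> \<Otimes>\<^sub>M \<nu>) \<nu> snd) A = emeasure \<nu> A"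
      using A by (simp add: emeasure_distr \<nu>.emeasure_pair_measure_Times \<mu>.emeasure_space_1)
  qed simp_all
  then show ?thesis by blast
qed

lemma coupling_cost_nonneg:
  fixes C :: "'m \<Rightarrow> 'm \<Rightarrow> real"
  assumes "\<gamma> \<in> couplings \<mu> \<nu>" "\<And>x y. x \<in> space \<mu> \<Longrightarrow> y \<in> space \<nu> \<Longrightarrow> 0 \<le> C x y"
  shows "0 \<le> (\<integral>p. C (fst p) (snd p) \<partial>\<gamma>)"
  by (rule Bochner_Integration.integral_nonneg_AE, rule AE_I2)
     (use couplings_space[OF assms(1)] assms(2) in auto)

lemma transport_cost_le:
  assumes "\<gamma> \<in> couplings \<mu> \<nu>" "\<And>x y. x \<in> space \<mu> \<Longrightarrow> y \<in> space \<nu> \<Longrightarrow> 0 \<le> C x y"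
  shows "transport_cost C \<mu> \<nu> \<le> (\<integral>p. C (fst p) (snd p) \<partial>\<gamma>)"
  unfolding transport_cost_def
proof (rule cINF_lower)
  show "bdd_below ((\<lambda>\<gamma>. \<integral>p. C (fst p) (snd p) \<partial>\<gamma>) ` couplings \<mu> \<nu>)"
    by (rule bdd_belowI2[of _ 0]) (rule coupling_cost_nonneg[OF _ assms(2)])
qed fact

lemma transport_cost_greatest:
  assumes "prob_space \<mu>" "prob_space \<nu>"
    and "\<And>\<gamma>. \<gamma> \<in> couplings \<mu> \<nu> \<Longrightarrow> a \<le> (\<integral>p. C (fst p) (snd p) \<partial>\<gamma>)"
  shows "a \<le> transport_cost C \<mu> \<nu>"
  unfolding transport_cost_def by (intro cINF_greatest couplings_nonempty assms)

lemma almost_optimal_coupling: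
  assumes "prob_space \<mu>" "prob_space \<nu>" and "transport_cost C \<mu> \<nu> < a"
  obtains \<gamma> where "\<gamma> \<in> couplings \<mu> \<nu>" "(\<integral>p. C (fst p) (snd p) \<partial>\<gamma>) < a"
proof -
  have "\<not> (\<forall>\<gamma>\<in>couplings \<mu> \<nu>. a \<le> (\<integral>p. C (fst p) (snd p) \<partial>\<gamma>))"
    using transport_cost_greatest[OF assms(1,2), of a C] assms(3) by auto
  then show thesis using that by force
qed

text \<open>The two points are made conditionally independent given their common label: relative to
  the product measure the density is \<open>inverse (emeasure D {k})\<close> on the rectangle where
  \<open>b\<close> and \<open>b'\<close> both equal \<open>k\<close>, and 0 elsewhere. Integrating
  out either variable leaves \<open>emeasure D {k}\<close> times its inverse, which is 1 for labels
  of positive mass.\<close>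

lemma discrete_gluing:
  fixes b :: "'m \<Rightarrow> 'k::countable" and b' :: "'m \<Rightarrow> 'k"
  assumes A: "prob_space A" and B: "prob_space B"
    and b[measurable]: "b \<in> measurable A (count_space UNIV)"
    and b'[measurable]: "b' \<in> measurable B (count_space UNIV)"
    and eq: "distr A (count_space UNIV) b = distr B (count_space UNIV) b'"
  obtains \<kappa> where "\<kappa> \<in> couplings A B" "AE p in \<kappa>. b (fst p) = b' (snd p)"
proof -
  interpret A: prob_space A by fact
  interpret B: prob_space B by fact
  interpret AB: pair_prob_space A B ..
  define D where "D = distr A (count_space UNIV) b"
  interpret D: prob_space D unfolding D_def by (rule A.prob_space_distr) measurable
  have DA: "emeasure D {k} = emeasure A {x \<in> space A. b x = k}" for k
    unfolding D_def by (subst emeasure_distr) (auto intro!: arg_cong[where f = "emeasure A"])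
  have DB: "emeasure D {k} = emeasure B {x \<in> space B. b' x = k}" for k
    unfolding D_def eq by (subst emeasure_distr) (auto intro!: arg_cong[where f = "emeasure B"])
  define w where "w p = (if b (fst p) = b' (snd p) then inverse (emeasure D {b (fst p)}) else 0)" for p
  \<comment> \<open>Over a countable type, equality of the labels is a countable union of
    rectangles, hence measurable.\<close>
  have [measurable]: "Measurable.pred (A \<Otimes>\<^sub>M B) (\<lambda>p. b (fst p) = b' (snd p))"
  proof -
    have "Measurable.pred (A \<Otimes>\<^sub>M B) (\<lambda>p. \<exists>k. b (fst p) = k \<and> b' (snd p) = k)" by measurable
    then show ?thesis by simp
  qed
  have [measurable]: "(\<lambda>p. inverse (emeasure D {b (fst p)})) \<in> borel_measurable (A \<Otimes>\<^sub>M B)"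
    by (rule measurable_compose[of "\<lambda>p. b (fst p)" _ "count_space UNIV"]) simp_all
  have [measurable]: "w \<in> borel_measurable (A \<Otimes>\<^sub>M B)" unfolding w_def by measurable
  define \<kappa> where "\<kappa> = density (A \<Otimes>\<^sub>M B) w"
  \<comment> \<open>For a label of mass 0 the inverse is infinite and the product of the two is 0
    instead of 1. There are countably many labels, so those of mass 0 are together a null
    set.\<close>
  have nonnull: "AE k in D. emeasure D {k} \<noteq> 0"
  proof (rule AE_I')
    have "(\<Union>k\<in>{k. emeasure D {k} = 0}. {k}) \<in> null_sets D"
      by (intro null_sets_UN' countableI_type) (auto simp: null_sets_def D_def)
    then show "{k. emeasure D {k} = 0} \<in> null_sets D" by simp
  qed (auto simp: D_def)
  have finD: "emeasure D {k} \<noteq> \<infinity>" for k by simp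
  have nA: "AE x in A. emeasure D {b x} \<noteq> 0"
    using nonnull unfolding D_def by (rule AE_distrD[OF b])
  have nB: "AE x in B. emeasure D {b' x} \<noteq> 0"
    using nonnull unfolding D_def eq by (rule AE_distrD[OF b'])
  have inner1: "(\<integral>\<^sup>+y. w (x, y) \<partial>B) = emeasure D {b x} * inverse (emeasure D {b x})" if "x \<in> space A" for x
  proof -
    have "(\<integral>\<^sup>+y. w (x, y) \<partial>B) = (\<integral>\<^sup>+y. inverse (emeasure D {b x}) * indicator {y \<in> space B. b' y = b x} y \<partial>B)"
      by (intro nn_integral_cong) (auto simp: w_def)
    also have "\<dots> = inverse (emeasure D {b x}) * emeasure B {y \<in> space B. b' y = b x}"
      by (intro nn_integral_cmult_indicator) measurable
    finally show ?thesis by (simp add: DB mult.commute)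
  qed
  have inner2: "(\<integral>\<^sup>+x. w (x, y) \<partial>A) = emeasure D {b' y} * inverse (emeasure D {b' y})" if "y \<in> space B" for y
  proof -
    have "(\<integral>\<^sup>+x. w (x, y) \<partial>A) = (\<integral>\<^sup>+x. inverse (emeasure D {b' y}) * indicator {x \<in> space A. b x = b' y} x \<partial>A)"
      by (intro nn_integral_cong) (auto simp: w_def)
    also have "\<dots> = inverse (emeasure D {b' y}) * emeasure A {x \<in> space A. b x = b' y}"
      by (intro nn_integral_cmult_indicator) measurable
    finally show ?thesis by (simp add: DA mult.commute)
  qed
  have one: "d * inverse d = 1" if "d \<noteq> 0" "d \<noteq> \<infinity>" for d :: ennreal
    using that by (simp add: ennreal_divide_self less_top flip: divide_ennreal_def)
  show thesis
  proof
    have "distr \<kappa> A fst = A"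
    proof (rule measure_eqI)
      fix X assume "X \<in> sets (distr \<kappa> A fst)"
      then have X[measurable]: "X \<in> sets A" by simp
      have "emeasure (distr \<kappa> A fst) X = (\<integral>\<^sup>+p. w p * indicator X (fst p) \<partial>(A \<Otimes>\<^sub>M B))"
        unfolding \<kappa>_def by (subst emeasure_distr) (auto simp: emeasure_density intro!: nn_integral_cong split: split_indicator)
      also have "\<dots> = (\<integral>\<^sup>+x. \<integral>\<^sup>+y. w (x, y) * indicator X x \<partial>B \<partial>A)"
        by (subst B.nn_integral_fst[symmetric]) simp_all
      also have "\<dots> = (\<integral>\<^sup>+x. emeasure D {b x} * inverse (emeasure D {b x}) * indicator X x \<partial>A)"
        by (intro nn_integral_cong) (simp add: nn_integral_multc inner1)
      also have "\<dots> = (\<integral>\<^sup>+x. indicator X x \<partial>A)"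
        by (intro nn_integral_cong_AE) (use nA in eventually_elim, simp add: one[OF _ finD])
      finally show "emeasure (distr \<kappa> A fst) X = emeasure A X" by simp
    qed simp
    moreover have "distr \<kappa> B snd = B"
    proof (rule measure_eqI)
      fix X assume "X \<in> sets (distr \<kappa> B snd)"
      then have X[measurable]: "X \<in> sets B" by simp
      have "emeasure (distr \<kappa> B snd) X = (\<integral>\<^sup>+p. w p * indicator X (snd p) \<partial>(A \<Otimes>\<^sub>M B))"
        unfolding \<kappa>_def by (subst emeasure_distr) (auto simp: emeasure_density intro!: nn_integral_cong split: split_indicator)
      also have "\<dots> = (\<integral>\<^sup>+y. \<integral>\<^sup>+x. w (x, y) * indicator X y \<partial>A \<partial>B)"
        by (subst AB.nn_integral_snd[symmetric]) (simp_all add: split_beta')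
      also have "\<dots> = (\<integral>\<^sup>+y. emeasure D {b' y} * inverse (emeasure D {b' y}) * indicator X y \<partial>B)"
        by (intro nn_integral_cong) (simp add: nn_integral_multc inner2)
      also have "\<dots> = (\<integral>\<^sup>+y. indicator X y \<partial>B)"
        by (intro nn_integral_cong_AE) (use nB in eventually_elim, simp add: one[OF _ finD])
      finally show "emeasure (distr \<kappa> B snd) X = emeasure B X" by simp
    qed simp
    ultimately show "\<kappa> \<in> couplings A B" by (simp add: couplings_def \<kappa>_def)
    show "AE p in \<kappa>. b (fst p) = b' (snd p)"
      unfolding \<kappa>_def by (subst AE_density) (auto simp: w_def split: if_splits)
  qed
qed

text \<open>Gluing is insensitive to the topology, so it may be done with a single real coordinate.\<close>

lemma coded_real:
  fixes R :: "'m \<Rightarrow> 'i::countable \<Rightarrow> real"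
  assumes "coded M R T"
  obtains \<sigma> \<tau> where "coded M (\<lambda>x (_ :: unit). \<sigma> x) \<tau>"
proof -
  obtain \<Phi> :: "real \<Rightarrow> 'i \<Rightarrow> real" and s where
    \<Phi>: "continuous_on UNIV \<Phi>" and s[measurable]: "s \<in> borel_measurable borel"
    and s01: "\<And>u. s u \<in> {0..1}" and inv: "\<And>u. (\<And>i. 0 \<le> u i \<and> u i < 1) \<Longrightarrow> \<Phi> (s u) = u"
    using schoenberg_curve by metis
  have [measurable]: "R \<in> borel_measurable M" "T \<in> measurable borel M" "\<Phi> \<in> borel_measurable borel"
    "(\<lambda>u :: unit \<Rightarrow> real. u ()) \<in> borel_measurable borel"
    using assms borel_measurable_continuous_onI[OF \<Phi>]
    by (auto simp: coded_def intro!: borel_measurable_continuous_onI continuous_on_product_coordinates)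
  \<comment> \<open>\<open>s\<close> ranges over the closed interval [0, 1], while codes must stay
    strictly below 1; hence the halving, which the factor 2 in the decoder undoes.\<close>
  have "coded M (\<lambda>x (_ :: unit). s (R x) / 2) (\<lambda>u. T (\<Phi> (2 * u ())))"
    unfolding coded_def
  proof (intro conjI ballI allI)
    show "(\<lambda>x (_ :: unit). s (R x) / 2) \<in> borel_measurable M"
      by (rule measurable_coordinatewise_then_product) measurable
    fix x assume "x \<in> space M"
    then show "T (\<Phi> (2 * (s (R x) / 2))) = x"
      using assms by (simp add: inv coded_def)
    show "0 \<le> s (R x) / 2" "s (R x) / 2 < 1" using s01[of "R x"] by auto
  qed measurable
  then show thesis by (rule that)
qed

text \<open>No disintegration is involved. At level \<open>n\<close> the middle points are
  identified only up to dyadic cells of length \<open>(1/2) ^ n\<close>, which are discrete labels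
  with the same law on both sides because both middle marginals are \<open>\<nu>\<close>. The
  discrepancy of the middle codes is a continuous function of codes with integral at most
  \<open>(1/2) ^ n\<close>, so it vanishes almost everywhere in the limit, and injectivity of the
  code gives equality.\<close>

lemma gluing:
  fixes R :: "'m \<Rightarrow> 'i::countable \<Rightarrow> real"
  assumes M: "coded M R T"
    and \<mu>: "prob_space \<mu>" "sets \<mu> = sets M" and \<nu>: "prob_space \<nu>" "sets \<nu> = sets M" and \<rho>: "prob_space \<rho>" "sets \<rho> = sets M"
    and \<gamma>: "\<gamma> \<in> couplings \<mu> \<nu>" and \<gamma>': "\<gamma>' \<in> couplings \<nu> \<rho>"
  obtains \<kappa> where "\<kappa> \<in> couplings \<gamma> \<gamma>'" "AE p in \<kappa>. snd (fst p) = fst (snd p)"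
proof -
  obtain \<sigma> \<tau> where c: "coded M (\<lambda>x (_ :: unit). \<sigma> x) \<tau>" using coded_real[OF M] .
  note cc = coded_pair[OF c c]
  have "(\<lambda>x (_ :: unit). \<sigma> x) \<in> borel_measurable M" using c by (simp add: coded_def)
  then have \<sigma>[measurable]: "\<sigma> \<in> borel_measurable M"
    by (rule measurable_product_then_coordinatewise)
  have \<tau>: "\<And>x. x \<in> space M \<Longrightarrow> \<tau> (\<lambda>_. \<sigma> x) = x" and \<sigma>01: "\<And>x. x \<in> space M \<Longrightarrow> 0 \<le> \<sigma> x"
    using c by (auto simp: coded_def)
  have P: "prob_space \<gamma>" "prob_space \<gamma>'"
    by (rule couplings_prob[OF \<gamma> \<mu>(1)], rule couplings_prob[OF \<gamma>' \<nu>(1)])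
  have S: "sets \<gamma> = sets (M \<Otimes>\<^sub>M M)" "sets \<gamma>' = sets (M \<Otimes>\<^sub>M M)"
    using couplings_sets[OF \<gamma>] couplings_sets[OF \<gamma>'] sets_pair_measure_cong \<mu>(2) \<nu>(2) \<rho>(2) by metis+
  have sp: "space \<gamma> = space M \<times> space M" "space \<gamma>' = space M \<times> space M"
    using sets_eq_imp_space_eq[OF S(1)] sets_eq_imp_space_eq[OF S(2)] by (auto simp: space_pair_measure)
  define b where "b n x = nat \<lfloor>2 ^ n * \<sigma> x\<rfloor>" for n :: nat and x
  have bM: "b n \<in> measurable M (count_space UNIV)" for n unfolding b_def[abs_def] by measurable
  have b_close: "\<bar>\<sigma> x - \<sigma> y\<bar> \<le> (1/2) ^ n" if "b n x = b n y" "x \<in> space M" "y \<in> space M" for n x y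
  proof -
    have "\<lfloor>2 ^ n * \<sigma> x\<rfloor> = \<lfloor>2 ^ n * \<sigma> y\<rfloor>"
      using that \<sigma>01 by (simp add: b_def eq_nat_nat_iff)
    then have "\<bar>2 ^ n * \<sigma> x - 2 ^ n * \<sigma> y\<bar> \<le> 1" by linarith
    moreover have "\<bar>2 ^ n * \<sigma> x - 2 ^ n * \<sigma> y\<bar> = 2 ^ n * \<bar>\<sigma> x - \<sigma> y\<bar>"
      by (simp add: abs_mult flip: right_diff_distrib)
    ultimately show ?thesis by (simp add: field_simps power_divide)
  qed
  have "\<exists>\<kappa>. \<kappa> \<in> couplings \<gamma> \<gamma>' \<and> (AE p in \<kappa>. b n (snd (fst p)) = b n (fst (snd p)))" for n
  proof -
    have snd: "snd \<in> measurable \<gamma> \<nu>" and fst: "fst \<in> measurable \<gamma>' \<nu>"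
      using couplings_sets[OF \<gamma>] couplings_sets[OF \<gamma>'] by (simp_all cong: measurable_cong_sets)
    have b\<nu>: "b n \<in> measurable \<nu> (count_space UNIV)"
      using bM \<nu>(2) by (simp cong: measurable_cong_sets)
    have "distr \<gamma> (count_space UNIV) (b n \<circ> snd) = distr \<nu> (count_space UNIV) (b n)"
      using \<gamma> unfolding distr_distr[OF b\<nu> snd, symmetric] by (simp add: couplings_def)
    also have "\<dots> = distr \<gamma>' (count_space UNIV) (b n \<circ> fst)"
      using \<gamma>' unfolding distr_distr[OF b\<nu> fst, symmetric] by (simp add: couplings_def)
    finally have eq: "distr \<gamma> (count_space UNIV) (b n \<circ> snd) = distr \<gamma>' (count_space UNIV) (b n \<circ> fst)" .
    show ?thesis
      by (rule discrete_gluing[OF P measurable_comp[OF snd b\<nu>] measurable_comp[OF fst b\<nu>] eq]) auto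
  qed
  then have "\<exists>\<kappa>n. \<forall>n. \<kappa>n n \<in> couplings \<gamma> \<gamma>' \<and> (AE p in \<kappa>n n. b n (snd (fst p)) = b n (fst (snd p)))"
    by (intro choice allI)
  then obtain \<kappa>n where
    "\<forall>n. \<kappa>n n \<in> couplings \<gamma> \<gamma>' \<and> (AE p in \<kappa>n n. b n (snd (fst p)) = b n (fst (snd p)))" ..
  then have \<kappa>n: "\<And>n. \<kappa>n n \<in> couplings \<gamma> \<gamma>'"
    "\<And>n. AE p in \<kappa>n n. b n (snd (fst p)) = b n (fst (snd p))" by simp_all
  let ?R = "\<lambda>p. case_sum (\<lambda>_ :: unit. \<sigma> (fst p)) (\<lambda>_ :: unit. \<sigma> (snd p))"
  show thesis
  proof (rule coupling_limit[OF cc cc, where \<mu>n = "\<lambda>_. \<gamma>" and \<mu> = \<gamma> and \<nu>n = "\<lambda>_. \<gamma>'" and \<nu> = \<gamma>' and \<gamma> = \<kappa>n], goal_cases)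
    case (12 r \<kappa>)
    \<comment> \<open>\<open>Inr\<close> of the first code and \<open>Inl\<close> of the second are
      the two copies of the middle point; truncation at 1 makes this an admissible bounded test
      function.\<close>
    define F :: "(unit + unit \<Rightarrow> real) \<times> (unit + unit \<Rightarrow> real) \<Rightarrow> real"
      where "F z = min 1 \<bar>fst z (Inr ()) - snd z (Inl ())\<bar>" for z
    have F1: "\<bar>F z\<bar> \<le> 1" and F0: "0 \<le> F z" for z by (auto simp: F_def)
    have contF: "continuous_on UNIV F"
    proof -
      have "continuous_on UNIV (\<lambda>z :: (unit + unit \<Rightarrow> real) \<times> (unit + unit \<Rightarrow> real). fst z i)"
        "continuous_on UNIV (\<lambda>z :: (unit + unit \<Rightarrow> real) \<times> (unit + unit \<Rightarrow> real). snd z i)" for i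
        by (rule continuous_on_compose2[OF continuous_on_product_coordinates, of UNIV]; auto intro: continuous_intros)+
      then show ?thesis unfolding F_def by (intro continuous_intros)
    qed
    have spk: "space \<kappa>' = (space M \<times> space M) \<times> (space M \<times> space M)" if "\<kappa>' \<in> couplings \<gamma> \<gamma>'" for \<kappa>'
      using couplings_space[OF that] sp by simp
    have Fm: "(\<lambda>p. F (?R (fst p), ?R (snd p))) \<in> borel_measurable \<kappa>'" if "\<kappa>' \<in> couplings \<gamma> \<gamma>'" for \<kappa>'
    proof -
      have "(\<lambda>p. min 1 \<bar>\<sigma> (snd (fst p)) - \<sigma> (fst (snd p))\<bar>) \<in> borel_measurable ((M \<Otimes>\<^sub>M M) \<Otimes>\<^sub>M (M \<Otimes>\<^sub>M M))"
        by measurable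
      moreover have "sets \<kappa>' = sets ((M \<Otimes>\<^sub>M M) \<Otimes>\<^sub>M (M \<Otimes>\<^sub>M M))"
        using couplings_sets[OF that] sets_pair_measure_cong[OF S] by simp
      ultimately show ?thesis by (simp add: F_def cong: measurable_cong_sets)
    qed
    have int: "integrable \<kappa>' (\<lambda>p. F (?R (fst p), ?R (snd p)))" if "\<kappa>' \<in> couplings \<gamma> \<gamma>'" for \<kappa>'
      using F1 by (intro prob_integrable_bounded[where B = 1] couplings_prob[OF that P(1)] Fm that)
    have le: "(\<integral>p. F (?R (fst p), ?R (snd p)) \<partial>\<kappa>n n) \<le> (1/2) ^ n" for n
    proof -
      interpret prob_space "\<kappa>n n" by (rule couplings_prob[OF \<kappa>n(1) P(1)])
      have "(\<integral>p. F (?R (fst p), ?R (snd p)) \<partial>\<kappa>n n) \<le> (\<integral>p. (1/2) ^ n \<partial>\<kappa>n n)"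
      proof (rule integral_mono_AE[OF int[OF \<kappa>n(1)]])
        show "AE p in \<kappa>n n. F (?R (fst p), ?R (snd p)) \<le> (1/2) ^ n"
          using \<kappa>n(2)[of n] AE_space
        proof eventually_elim
          case (elim p)
          then show ?case using b_close[of n "snd (fst p)" "fst (snd p)"] spk[OF \<kappa>n(1)]
            by (auto simp: F_def)
        qed
      qed simp
      then show ?thesis by (simp add: prob_space)
    qed
    have "(\<lambda>n. \<integral>p. F (?R (fst p), ?R (snd p)) \<partial>\<kappa>n (r n)) \<longlonglongrightarrow> (\<integral>p. F (?R (fst p), ?R (snd p)) \<partial>\<kappa>)"
      by (rule 12(3)[OF contF F1])
    moreover have "(\<lambda>n. (1/2 :: real) ^ r n) \<longlonglongrightarrow> 0"
      using LIMSEQ_subseq_LIMSEQ[OF LIMSEQ_power_zero[of "1/2 :: real"] 12(1)] by (simp add: comp_def)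
    ultimately have "(\<integral>p. F (?R (fst p), ?R (snd p)) \<partial>\<kappa>) \<le> 0"
      by (rule LIMSEQ_le) (use le in blast)
    moreover have "0 \<le> (\<integral>p. F (?R (fst p), ?R (snd p)) \<partial>\<kappa>)"
      by (rule Bochner_Integration.integral_nonneg_AE) (use F0 in auto)
    ultimately have "AE p in \<kappa>. F (?R (fst p), ?R (snd p)) = 0"
      using integral_nonneg_eq_0_iff_AE[OF int[OF 12(2)]] F0 by simp
    then have "AE p in \<kappa>. snd (fst p) = fst (snd p)"
      using AE_space
    proof eventually_elim
      case (elim p)
      from elim(1) have "min 1 \<bar>\<sigma> (snd (fst p)) - \<sigma> (fst (snd p))\<bar> = 0" unfolding F_def by simp
      then have eq: "\<sigma> (snd (fst p)) = \<sigma> (fst (snd p))" by (simp add: min_def split: if_split_asm)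
      have mem: "snd (fst p) \<in> space M" "fst (snd p) \<in> space M"
        using elim(2) unfolding spk[OF 12(2)] mem_Times_iff by blast+
      from \<tau>[OF mem(1)] show ?case unfolding eq \<tau>[OF mem(2)] by (rule sym)
    qed
    then show ?case by (rule that[OF 12(2)])
  qed (use P S \<kappa>n in auto)
qed

text \<open>The glued measure lives on quadruples whose inner coordinates agree; projecting to the
  outer ones couples \<open>\<mu>\<close> and \<open>\<rho>\<close>, and the pointwise inequality
  for \<open>C\<close> is integrated. The slack \<open>e\<close> is split evenly between two almost
  optimal couplings.\<close>

lemma transport_cost_triangle:
  fixes R :: "'m \<Rightarrow> 'i::countable \<Rightarrow> real"
  assumes M: "coded M R T" and C: "lsc_cost M R C"
    and tri: "\<And>x y z. x \<in> space M \<Longrightarrow> y \<in> space M \<Longrightarrow> z \<in> space M \<Longrightarrow> C x z \<le> C x y + C y z"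
    and \<mu>: "prob_space \<mu>" "sets \<mu> = sets M" and \<nu>: "prob_space \<nu>" "sets \<nu> = sets M" and \<rho>: "prob_space \<rho>" "sets \<rho> = sets M"
  shows "transport_cost C \<mu> \<rho> \<le> transport_cost C \<mu> \<nu> + transport_cost C \<nu> \<rho>"
proof (rule field_le_epsilon)
  fix e :: real assume e: "0 < e"
  obtain \<gamma> where \<gamma>: "\<gamma> \<in> couplings \<mu> \<nu>" "(\<integral>p. C (fst p) (snd p) \<partial>\<gamma>) < transport_cost C \<mu> \<nu> + e / 2"
    using almost_optimal_coupling[OF \<mu>(1) \<nu>(1), of C "transport_cost C \<mu> \<nu> + e / 2"] e by auto
  obtain \<gamma>' where \<gamma>': "\<gamma>' \<in> couplings \<nu> \<rho>" "(\<integral>p. C (fst p) (snd p) \<partial>\<gamma>') < transport_cost C \<nu> \<rho> + e / 2"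
    using almost_optimal_coupling[OF \<nu>(1) \<rho>(1), of C "transport_cost C \<nu> \<rho> + e / 2"] e by auto
  obtain \<kappa> where \<kappa>: "\<kappa> \<in> couplings \<gamma> \<gamma>'" "AE p in \<kappa>. snd (fst p) = fst (snd p)"
    by (rule gluing[OF M \<mu> \<nu> \<rho> \<gamma>(1) \<gamma>'(1)])
  have P: "prob_space \<gamma>" "prob_space \<gamma>'"
    by (rule couplings_prob[OF \<gamma>(1) \<mu>(1)], rule couplings_prob[OF \<gamma>'(1) \<nu>(1)])
  interpret \<kappa>: prob_space \<kappa> by (rule couplings_prob[OF \<kappa>(1) P(1)])
  have S: "sets \<gamma> = sets (M \<Otimes>\<^sub>M M)" "sets \<gamma>' = sets (M \<Otimes>\<^sub>M M)"
    using couplings_sets[OF \<gamma>(1)] couplings_sets[OF \<gamma>'(1)] sets_pair_measure_cong \<mu>(2) \<nu>(2) \<rho>(2) by metis+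
  have S\<kappa>: "sets \<kappa> = sets ((M \<Otimes>\<^sub>M M) \<Otimes>\<^sub>M (M \<Otimes>\<^sub>M M))"
    using couplings_sets[OF \<kappa>(1)] sets_pair_measure_cong[OF S] by simp
  have sp\<kappa>: "space \<kappa> = (space M \<times> space M) \<times> (space M \<times> space M)"
    using sets_eq_imp_space_eq[OF S\<kappa>] by (simp add: space_pair_measure)
  have sp: "space \<mu> = space M" "space \<rho> = space M"
    using sets_eq_imp_space_eq[OF \<mu>(2)] sets_eq_imp_space_eq[OF \<rho>(2)] by auto
  have [measurable]: "(\<lambda>p. C (fst p) (snd p)) \<in> borel_measurable (M \<Otimes>\<^sub>M M)"
    and C01: "\<And>x y. x \<in> space M \<Longrightarrow> y \<in> space M \<Longrightarrow> 0 \<le> C x y \<and> C x y \<le> 1"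
    using C by (auto simp: lsc_cost_def)
  have int: "integrable \<kappa> (\<lambda>p. C (f p) (g p))"
    if "f \<in> measurable ((M \<Otimes>\<^sub>M M) \<Otimes>\<^sub>M (M \<Otimes>\<^sub>M M)) M" "g \<in> measurable ((M \<Otimes>\<^sub>M M) \<Otimes>\<^sub>M (M \<Otimes>\<^sub>M M)) M" for f g
  proof (rule prob_integrable_bounded[where B = 1])
    note that[measurable]
    have "(\<lambda>p. (f p, g p)) \<in> measurable ((M \<Otimes>\<^sub>M M) \<Otimes>\<^sub>M (M \<Otimes>\<^sub>M M)) (M \<Otimes>\<^sub>M M)" by measurable
    from measurable_compose[OF this \<open>(\<lambda>p. C (fst p) (snd p)) \<in> borel_measurable (M \<Otimes>\<^sub>M M)\<close>]
    show "(\<lambda>p. C (f p) (g p)) \<in> borel_measurable \<kappa>"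
      unfolding measurable_cong_sets[OF S\<kappa> refl] by simp
    show "\<bar>C (f p) (g p)\<bar> \<le> 1" if "p \<in> space \<kappa>" for p
      using C01 measurable_space[OF \<open>f \<in> _\<close>] measurable_space[OF \<open>g \<in> _\<close>] that sp\<kappa>
      by (simp add: space_pair_measure)
  qed unfold_locales
  have f1: "(\<lambda>p. fst (fst p)) \<in> measurable \<kappa> M" and f2: "(\<lambda>p. snd (snd p)) \<in> measurable \<kappa> M"
    and ffst: "fst \<in> measurable \<kappa> \<gamma>" and fsnd: "snd \<in> measurable \<kappa> \<gamma>'"
    using S S\<kappa> by (simp_all cong: measurable_cong_sets)
  have d1: "distr \<kappa> \<gamma> fst = \<gamma>" and d2: "distr \<kappa> \<gamma>' snd = \<gamma>'" using \<kappa> by (auto simp: couplings_def)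
  define \<zeta> where "\<zeta> = distr \<kappa> (\<mu> \<Otimes>\<^sub>M \<rho>) (\<lambda>p. (fst (fst p), snd (snd p)))"
  have \<zeta>: "\<zeta> \<in> couplings \<mu> \<rho>"
    unfolding \<zeta>_def
  proof (rule couplings_distr[OF \<mu>(2) \<rho>(2) f1 f2])
    have m: "fst \<in> measurable \<gamma> \<mu>" "snd \<in> measurable \<gamma>' \<rho>"
      using S \<mu>(2) \<rho>(2) by (simp_all cong: measurable_cong_sets)
    from distr_distr[OF m(1) ffst] distr_distr[OF m(2) fsnd] have "distr \<kappa> \<mu> (fst \<circ> fst) = \<mu>" "distr \<kappa> \<rho> (snd \<circ> snd) = \<rho>"
      using \<gamma>(1) \<gamma>'(1) d1 d2 by (auto simp: couplings_def)
    then show "distr \<kappa> M (\<lambda>p. fst (fst p)) = \<mu>" "distr \<kappa> M (\<lambda>p. snd (snd p)) = \<rho>"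
      using distr_cong[OF refl \<mu>(2), of \<kappa> "fst \<circ> fst" "fst \<circ> fst"] distr_cong[OF refl \<rho>(2), of \<kappa> "snd \<circ> snd" "snd \<circ> snd"]
      by (auto simp: comp_def)
  qed
  have "transport_cost C \<mu> \<rho> \<le> (\<integral>p. C (fst p) (snd p) \<partial>\<zeta>)"
    by (rule transport_cost_le[OF \<zeta>]) (use C01 sp in auto)
  also have "\<dots> = (\<integral>p. C (fst (fst p)) (snd (snd p)) \<partial>\<kappa>)"
  proof -
    have "(\<lambda>p. (fst (fst p), snd (snd p))) \<in> measurable \<kappa> (\<mu> \<Otimes>\<^sub>M \<rho>)"
      using f1 f2 \<mu>(2) \<rho>(2) by (intro measurable_Pair) (simp_all cong: measurable_cong_sets)
    moreover have "(\<lambda>p. C (fst p) (snd p)) \<in> borel_measurable (\<mu> \<Otimes>\<^sub>M \<rho>)"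
      using lsc_cost_measurable[OF C sets_pair_measure_cong[OF \<mu>(2) \<rho>(2)]] .
    ultimately show ?thesis unfolding \<zeta>_def by (subst integral_distr) auto
  qed
  also have "\<dots> \<le> (\<integral>p. C (fst (fst p)) (snd (fst p)) + C (fst (snd p)) (snd (snd p)) \<partial>\<kappa>)"
  proof (rule integral_mono_AE)
    show "AE p in \<kappa>. C (fst (fst p)) (snd (snd p)) \<le> C (fst (fst p)) (snd (fst p)) + C (fst (snd p)) (snd (snd p))"
      using \<kappa>(2) AE_space
    proof eventually_elim
      case (elim p)
      then show ?case using tri[of "fst (fst p)" "snd (fst p)" "snd (snd p)"]
        unfolding sp\<kappa> mem_Times_iff by simp
    qed
    show "integrable \<kappa> (\<lambda>p. C (fst (fst p)) (snd (snd p)))" by (rule int) measurable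
    show "integrable \<kappa> (\<lambda>p. C (fst (fst p)) (snd (fst p)) + C (fst (snd p)) (snd (snd p)))"
      by (rule Bochner_Integration.integrable_add; rule int) measurable
  qed
  also have "\<dots> = (\<integral>p. C (fst (fst p)) (snd (fst p)) \<partial>\<kappa>) + (\<integral>p. C (fst (snd p)) (snd (snd p)) \<partial>\<kappa>)"
    by (rule Bochner_Integration.integral_add; rule int) measurable
  also have "(\<integral>p. C (fst (fst p)) (snd (fst p)) \<partial>\<kappa>) = (\<integral>p. C (fst p) (snd p) \<partial>\<gamma>)"
    using integral_distr[OF ffst lsc_cost_measurable[OF C S(1)]] d1 by simp
  also have "(\<integral>p. C (fst (snd p)) (snd (snd p)) \<partial>\<kappa>) = (\<integral>p. C (fst p) (snd p) \<partial>\<gamma>')"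
    using integral_distr[OF fsnd lsc_cost_measurable[OF C S(2)]] d2 by simp
  finally show "transport_cost C \<mu> \<rho> \<le> transport_cost C \<mu> \<nu> + transport_cost C \<nu> \<rho> + e"
    using \<gamma>(2) \<gamma>'(2) by linarith
qed

section \<open>Path space in the Hilbert cube\<close>

lemma space_path_space: "space path_space = paths"
  unfolding path_space_def by (rule space_measure_of) auto

lemma measurable_path_eval: "0 \<le> t \<Longrightarrow> (\<lambda>\<omega>. \<omega> t) \<in> borel_measurable path_space"
proof (rule measurableI)
  fix B :: "'a set" assume "0 \<le> t" "B \<in> sets borel"
  then have "{\<omega> \<in> paths. \<omega> t \<in> B} \<in> sets path_space"
    unfolding path_space_def by (subst sets_measure_of) auto
  moreover have "(\<lambda>\<omega>. \<omega> t) -` B \<inter> space path_space = {\<omega> \<in> paths. \<omega> t \<in> B}"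
    by (auto simp: space_path_space)
  ultimately show "(\<lambda>\<omega>. \<omega> t) -` B \<inter> space path_space \<in> sets path_space" by simp
qed simp

lemma measurable_path_spaceI:
  fixes f :: "'n \<Rightarrow> real \<Rightarrow> 'a::topological_space"
  assumes "f \<in> space N \<rightarrow> paths" "\<And>t. 0 \<le> t \<Longrightarrow> (\<lambda>x. f x t) \<in> borel_measurable N"
  shows "f \<in> measurable N path_space"
  unfolding path_space_def
proof (rule measurable_measure_of)
  fix A :: "(real \<Rightarrow> 'a) set" assume "A \<in> {{\<omega> \<in> paths. \<omega> t \<in> B} | t B. 0 \<le> t \<and> B \<in> sets borel}"
  then obtain t B where A: "A = {\<omega> \<in> paths. \<omega> t \<in> B}" "0 \<le> t" "B \<in> sets borel" by auto
  have "f -` A \<inter> space N = (\<lambda>x. f x t) -` B \<inter> space N" using assms(1) by (auto simp: A)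
  then show "f -` A \<inter> space N \<in> sets N" using assms(2)[OF A(2)] A(3) by (simp add: measurable_sets)
qed (use assms in auto)

text \<open>Nonnegative rational times are enumerated with repetitions; \<open>approx t\<close> converges to \<open>t\<close> from below.\<close>

definition ratio :: "nat \<times> nat \<Rightarrow> real" where
  "ratio q = real (fst q) / real (Suc (snd q))"

definition approx :: "real \<Rightarrow> nat \<Rightarrow> nat \<times> nat" where
  "approx t n = (nat \<lfloor>real (Suc n) * t\<rfloor>, n)"

lemma ratio_nonneg [simp]: "0 \<le> ratio q"
  by (simp add: ratio_def)

lemma ratio_approx:
  assumes "0 \<le> t"
  shows "ratio (approx t n) \<le> t" "t - 1 / real (Suc n) \<le> ratio (approx t n)"
proof -
  have r: "ratio (approx t n) = \<lfloor>real (Suc n) * t\<rfloor> / real (Suc n)"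
    using assms by (simp add: ratio_def approx_def)
  have "\<lfloor>real (Suc n) * t\<rfloor> \<le> real (Suc n) * t" by (rule of_int_floor_le)
  then show "ratio (approx t n) \<le> t"
    unfolding r by (subst pos_divide_le_eq) (simp_all add: mult.commute)
  have "t - 1 / real (Suc n) = (real (Suc n) * t - 1) / real (Suc n)"
    by (simp add: diff_divide_distrib)
  also have "\<dots> \<le> \<lfloor>real (Suc n) * t\<rfloor> / real (Suc n)"
    using real_of_int_floor_gt_diff_one[of "real (Suc n) * t"] by (intro divide_right_mono) auto
  finally show "t - 1 / real (Suc n) \<le> ratio (approx t n)" unfolding r .
qed

lemma ratio_approx_tendsto:
  assumes "0 \<le> t"
  shows "(\<lambda>n. ratio (approx t n)) \<longlonglongrightarrow> t"
proof (rule tendsto_sandwich)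
  show "\<forall>\<^sub>F n in sequentially. t - 1 / real (Suc n) \<le> ratio (approx t n)"
    "\<forall>\<^sub>F n in sequentially. ratio (approx t n) \<le> t"
    using ratio_approx[OF assms] by auto
  show "(\<lambda>n. t - 1 / real (Suc n)) \<longlonglongrightarrow> t"
    using tendsto_diff[OF tendsto_const[of t] LIMSEQ_Suc[OF lim_1_over_n]] by simp
qed simp

text \<open>The hypothesis is uniform continuity on bounded time intervals, with moduli
  \<open>1 / real (Suc d)\<close> so that only countably many conditions occur; the same formula
  later describes a Borel set. At distance 0 it forces equal values at different pairs with the same
  ratio, without which \<open>v (ratio q) = f q\<close> could not hold.\<close>

lemma ratio_extension:
  fixes f :: "nat \<times> nat \<Rightarrow> real"
  assumes unif: "\<And>N k :: nat. \<exists>d :: nat. \<forall>q q'. ratio q \<le> real N \<longrightarrow> ratio q' \<le> real N \<longrightarrow>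
      \<bar>ratio q - ratio q'\<bar> \<le> 1 / real (Suc d) \<longrightarrow> \<bar>f q - f q'\<bar> \<le> 1 / real (Suc k)"
  defines "v \<equiv> \<lambda>t. lim (\<lambda>n. f (approx t n))"
  shows "\<And>t. 0 \<le> t \<Longrightarrow> (\<lambda>n. f (approx t n)) \<longlonglongrightarrow> v t"
    and "continuous_on {0..} v"
    and "\<And>q. v (ratio q) = f q"
proof -
  have evd: "\<forall>\<^sub>F n in sequentially. ratio (approx t n) \<le> real N" if "0 \<le> t" "t \<le> real N" for t N
    using ratio_approx(1)[OF that(1)] that(2) by (intro always_eventually) (meson order_trans)
  have conv: "(\<lambda>n. f (approx t n)) \<longlonglongrightarrow> v t" if t: "0 \<le> t" for t
  proof -
    have "Cauchy (\<lambda>n. f (approx t n))"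
    proof (rule CauchyI)
      fix e :: real assume "0 < e"
      then obtain k where k: "1 / real (Suc k) < e" by (rule nat_approx_posE)
      obtain N :: nat where N: "t \<le> real N" using real_arch_simple by blast
      obtain d where d: "\<And>q q'. ratio q \<le> real N \<Longrightarrow> ratio q' \<le> real N \<Longrightarrow>
          \<bar>ratio q - ratio q'\<bar> \<le> 1 / real (Suc d) \<Longrightarrow> \<bar>f q - f q'\<bar> \<le> 1 / real (Suc k)"
        using unif[of N k] by blast
      have "norm (f (approx t m) - f (approx t n)) < e" if mn: "m \<ge> d" "n \<ge> d" for m n
      proof -
        have le: "1 / real (Suc m) \<le> 1 / real (Suc d)" "1 / real (Suc n) \<le> 1 / real (Suc d)"
          using mn by (simp_all add: frac_le)
        have "\<bar>ratio (approx t m) - ratio (approx t n)\<bar> \<le> 1 / real (Suc d)"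
          using ratio_approx[OF t, of m] ratio_approx[OF t, of n] le unfolding abs_le_iff by linarith
        then have "\<bar>f (approx t m) - f (approx t n)\<bar> \<le> 1 / real (Suc k)"
          using ratio_approx(1)[OF t, of m] ratio_approx(1)[OF t, of n] N by (intro d) auto
        then show ?thesis using k by simp
      qed
      then show "\<exists>M. \<forall>m\<ge>M. \<forall>n\<ge>M. norm (f (approx t m) - f (approx t n)) < e" by blast
    qed
    then show ?thesis unfolding v_def by (simp add: Cauchy_convergent convergent_LIMSEQ_iff[symmetric])
  qed
  show "\<And>t. 0 \<le> t \<Longrightarrow> (\<lambda>n. f (approx t n)) \<longlonglongrightarrow> v t" by fact
  show "continuous_on {0..} v"
    unfolding continuous_on_iff
  proof (intro ballI allI impI)
    fix t e :: real assume t: "t \<in> {0..}" and e: "0 < e"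
    from t have t0: "0 \<le> t" by simp
    from e obtain k where k: "1 / real (Suc k) < e" by (meson nat_approx_posE)
    \<comment> \<open>The extra unit leaves room for every \<open>t'\<close> at distance below 1
      from \<open>t\<close>, whence the \<open>min 1\<close> in the radius.\<close>
    obtain N :: nat where N: "t + 1 \<le> real N" using real_arch_simple by blast
    then have tN: "t \<le> real N" by simp
    obtain d where d: "\<And>q q'. ratio q \<le> real N \<Longrightarrow> ratio q' \<le> real N \<Longrightarrow>
        \<bar>ratio q - ratio q'\<bar> \<le> 1 / real (Suc d) \<Longrightarrow> \<bar>f q - f q'\<bar> \<le> 1 / real (Suc k)"
      using unif[of N k] by blast
    have "dist (v t') (v t) < e" if t': "0 \<le> t'" "dist t' t < min 1 (1 / real (Suc d))" for t'
    proof -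
      have "(\<lambda>n. \<bar>ratio (approx t' n) - ratio (approx t n)\<bar>) \<longlonglongrightarrow> \<bar>t' - t\<bar>"
        using t t' by (intro tendsto_intros ratio_approx_tendsto) auto
      moreover have "\<bar>t' - t\<bar> < 1 / real (Suc d)" using t' by (simp add: dist_real_def)
      ultimately have ev: "\<forall>\<^sub>F n in sequentially. \<bar>ratio (approx t' n) - ratio (approx t n)\<bar> < 1 / real (Suc d)"
        by (rule order_tendstoD)
      have "\<bar>t' - t\<bar> < 1" using t' by (simp only: dist_real_def min_less_iff_conj)
      then have N': "t' \<le> real N" using N by linarith
      have "\<forall>\<^sub>F n in sequentially. \<bar>f (approx t' n) - f (approx t n)\<bar> \<le> 1 / real (Suc k)"
        using ev evd[OF t'(1) N'] evd[OF t0 tN] by eventually_elim (rule d, auto)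
      moreover have "(\<lambda>n. \<bar>f (approx t' n) - f (approx t n)\<bar>) \<longlonglongrightarrow> \<bar>v t' - v t\<bar>"
        using t t' by (intro tendsto_intros conv) auto
      ultimately have "\<bar>v t' - v t\<bar> \<le> 1 / real (Suc k)"
        by (intro tendsto_upperbound) auto
      then show ?thesis using k by (simp add: dist_real_def)
    qed
    then show "\<exists>\<delta>>0. \<forall>t'\<in>{0..}. dist t' t < \<delta> \<longrightarrow> dist (v t') (v t) < e"
      by (intro exI[of _ "min 1 (1 / real (Suc d))"]) auto
  qed
  \<comment> \<open>\<open>approx (ratio q) n\<close> is in general a different pair from
    \<open>q\<close>, so the values are compared through the modulus and not by eventual
    equality.\<close>
  show "v (ratio q) = f q" for q
  proof -
    have "\<bar>v (ratio q) - f q\<bar> \<le> 1 / real (Suc k)" for k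
    proof -
      obtain N :: nat where N: "ratio q \<le> real N" using real_arch_simple by blast
      obtain d where d: "\<And>q q'. ratio q \<le> real N \<Longrightarrow> ratio q' \<le> real N \<Longrightarrow>
          \<bar>ratio q - ratio q'\<bar> \<le> 1 / real (Suc d) \<Longrightarrow> \<bar>f q - f q'\<bar> \<le> 1 / real (Suc k)"
        using unif[of N k] by blast
      have "(\<lambda>n. \<bar>ratio (approx (ratio q) n) - ratio q\<bar>) \<longlonglongrightarrow> \<bar>ratio q - ratio q\<bar>"
        by (intro tendsto_intros ratio_approx_tendsto) auto
      then have ev: "\<forall>\<^sub>F n in sequentially. \<bar>ratio (approx (ratio q) n) - ratio q\<bar> < 1 / real (Suc d)"
        by (rule order_tendstoD) simp
      have "\<forall>\<^sub>F n in sequentially. \<bar>f (approx (ratio q) n) - f q\<bar> \<le> 1 / real (Suc k)"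
        using ev evd[OF ratio_nonneg N] by eventually_elim (rule d[OF _ N], auto)
      moreover have "(\<lambda>n. \<bar>f (approx (ratio q) n) - f q\<bar>) \<longlonglongrightarrow> \<bar>v (ratio q) - f q\<bar>"
        by (intro tendsto_intros conv) auto
      ultimately show ?thesis by (intro tendsto_upperbound) auto
    qed
    moreover have "(\<lambda>k. 1 / real (Suc k)) \<longlonglongrightarrow> 0" by (rule LIMSEQ_Suc[OF lim_1_over_n])
    ultimately have "\<bar>v (ratio q) - f q\<bar> \<le> 0" by (intro LIMSEQ_le_const) auto
    then show ?thesis by simp
  qed
qed

lemma tendsto_coordinatewise:
  fixes f :: "'b \<Rightarrow> 'i \<Rightarrow> 'c::topological_space"
  assumes "\<And>i. ((\<lambda>n. f n i) \<longlongrightarrow> l i) F"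
  shows "(f \<longlongrightarrow> l) F"
  using assms limitin_componentwise[of "\<lambda>_. euclidean" UNIV f l F]
  by (simp add: euclidean_product_topology)

definition dense_seq :: "nat \<Rightarrow> 'a::second_countable_topology" where
  "dense_seq = from_nat_into (SOME D. countable D \<and> (\<forall>X. open X \<longrightarrow> X \<noteq> {} \<longrightarrow> (\<exists>d\<in>D. d \<in> X)))"

lemma dense_seq:
  assumes "open (X :: 'a::second_countable_topology set)" "X \<noteq> {}"
  obtains j where "dense_seq j \<in> X"
proof -
  define D where "D = (SOME D :: 'a set. countable D \<and> (\<forall>X. open X \<longrightarrow> X \<noteq> {} \<longrightarrow> (\<exists>d\<in>D. d \<in> X)))"
  have D: "countable D" "\<And>X. open X \<Longrightarrow> X \<noteq> {} \<Longrightarrow> \<exists>d\<in>D. d \<in> X"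
    using someI_ex[OF countable_dense_exists] unfolding D_def by blast+
  obtain d where d: "d \<in> D" "d \<in> X" using D(2)[OF assms] by blast
  then obtain j where "from_nat_into D j = d" using from_nat_into_surj[OF D(1)] by blast
  then have "dense_seq j = d" unfolding dense_seq_def D_def .
  then show thesis using d that[of j] by simp
qed

section \<open>The state space inside the cube\<close>

context diffusion
begin

lemma \<Delta>_nonneg [simp]: "0 \<le> \<Delta> x y"
  and \<Delta>_commute: "\<Delta> x y = \<Delta> y x"
  and \<Delta>_self [simp]: "\<Delta> x x = 0"
  and \<Delta>_triangle: "\<Delta> x z \<le> \<Delta> x y + \<Delta> y z"
proof -
  interpret Metric_space UNIV \<Delta> by (rule metric)
  show "0 \<le> \<Delta> x y" "\<Delta> x y = \<Delta> y x" "\<Delta> x x = 0" "\<Delta> x z \<le> \<Delta> x y + \<Delta> y z"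
    using commute triangle by auto
qed

lemma \<Delta>_zero_iff: "\<Delta> x y = 0 \<longleftrightarrow> x = y"
  using Metric_space.zero[OF metric] by simp

lemma open_iff_\<Delta>: "open U \<longleftrightarrow> (\<forall>x\<in>U. \<exists>r>0. \<forall>y. \<Delta> x y < r \<longrightarrow> y \<in> U)"
proof -
  interpret Metric_space UNIV \<Delta> by (rule metric)
  have "open U \<longleftrightarrow> openin mtopology U" unfolding metric_topology by simp
  then show ?thesis unfolding openin_mtopology by (auto simp: subset_iff)
qed

lemma open_\<Delta>_ball: "open {y. \<Delta> x y < r}"
  unfolding open_iff_\<Delta>
proof
  fix y assume "y \<in> {y. \<Delta> x y < r}"
  then have y: "\<Delta> x y < r" by simp
  have "\<Delta> x z < r" if "\<Delta> y z < r - \<Delta> x y" for z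
    using \<Delta>_triangle[of x z y] that by linarith
  then show "\<exists>r'>0. \<forall>z. \<Delta> y z < r' \<longrightarrow> z \<in> {y. \<Delta> x y < r}"
    using y by (intro exI[of _ "r - \<Delta> x y"]) auto
qed

lemma abs_\<Delta>_diff_le: "\<bar>\<Delta> x z - \<Delta> y z\<bar> \<le> \<Delta> x y"
  using \<Delta>_triangle[of x z y] \<Delta>_triangle[of y z x] \<Delta>_commute[of x y] by linarith

lemma continuous_\<Delta>: "continuous_on UNIV (\<lambda>x. \<Delta> x a)"
  unfolding continuous_on_topological
proof (intro ballI allI impI)
  fix x and S :: "real set" assume "open S" "\<Delta> x a \<in> S"
  then obtain e where e: "e > 0" "\<And>y. dist y (\<Delta> x a) < e \<Longrightarrow> y \<in> S" unfolding open_dist by blast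
  have "\<Delta> y a \<in> S" if "\<Delta> x y < e" for y
    using abs_\<Delta>_diff_le[of y a x] that by (intro e) (simp add: dist_real_def \<Delta>_commute)
  then show "\<exists>T. open T \<and> x \<in> T \<and> (\<forall>y\<in>UNIV. y \<in> T \<longrightarrow> \<Delta> y a \<in> S)"
    using e(1) by (intro exI[of _ "{y. \<Delta> x y < e}"]) (auto simp: open_\<Delta>_ball)
qed

text \<open>As \<open>\<Delta>\<close> is bounded by 1, halving keeps the coordinates strictly below
  1, as the binary digits require.\<close>

definition embed :: "'a \<Rightarrow> nat \<Rightarrow> real" where
  "embed x j = \<Delta> x (dense_seq j) / 2"

lemma embed_bounds: "0 \<le> embed x j \<and> embed x j < 1"
  using metric_le_1[of x "dense_seq j"] by (simp add: embed_def)

lemma continuous_embed: "continuous_on UNIV embed"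
  unfolding embed_def[abs_def]
  by (intro continuous_on_coordinatewise_then_product continuous_on_divide continuous_\<Delta>) auto

text \<open>Together with continuity this makes \<open>embed\<close> a homeomorphism onto its image.
  A single coordinate suffices: given a dense point within \<open>r / 2\<close> of \<open>x\<close>,
  every \<open>y\<close> within \<open>r / 2\<close> of that point is within \<open>r\<close> of
  \<open>x\<close>. The threshold \<open>r / 4\<close> accounts for the halving in
  \<open>embed\<close>.\<close>

lemma embed_nbhd:
  assumes "open U" "x \<in> U"
  obtains V where "open V" "embed x \<in> V" "embed -` V \<subseteq> U"
proof -
  obtain r where r: "r > 0" "\<And>y. \<Delta> x y < r \<Longrightarrow> y \<in> U" using assms open_iff_\<Delta>[of U] by blast
  obtain j where j: "dense_seq j \<in> {y. \<Delta> x y < r / 2}"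
    using dense_seq[OF open_\<Delta>_ball, of x "r / 2"] r(1) by (metis \<Delta>_self empty_iff half_gt_zero mem_Collect_eq)
  show thesis
  proof
    show "open {v :: nat \<Rightarrow> real. v j < r / 4}"
      by (intro open_Collect_less continuous_on_product_coordinates continuous_on_const)
    show "embed x \<in> {v. v j < r / 4}" using j by (simp add: embed_def)
    show "embed -` {v. v j < r / 4} \<subseteq> U"
    proof
      fix y assume "y \<in> embed -` {v. v j < r / 4}"
      then have "\<Delta> y (dense_seq j) < r / 2" by (simp add: embed_def)
      then show "y \<in> U"
        using \<Delta>_triangle[of x y "dense_seq j"] j by (intro r(2)) (simp add: \<Delta>_commute)
    qed
  qed
qed

lemma inj_embed: "inj embed"
proof (rule injI, rule ccontr)
  fix x y assume eq: "embed x = embed y" and "x \<noteq> y"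
  then have "open (- {y})" "x \<in> - {y}" by auto
  then obtain V where "embed x \<in> V" "embed -` V \<subseteq> - {y}" by (rule embed_nbhd)
  then show False using eq by auto
qed

text \<open>Local compactness enters here. More than \<sigma>-compactness is required: each compact
  set must lie in a single \<open>K n\<close>, so that staying in some compact set becomes a
  countable disjunction. Countably many relatively compact open sets cover the space by Lindelof,
  and finite unions of their compact supersets do the rest.\<close>

lemma compact_exhaustion:
  "\<exists>K :: nat \<Rightarrow> 'a set. (\<forall>n. compact (K n)) \<and> (\<forall>C. compact C \<longrightarrow> (\<exists>n. C \<subseteq> K n))"
proof -
  define F where "F = {U :: 'a set. open U \<and> (\<exists>C. compact C \<and> U \<subseteq> C)}"
  have "\<Union>F = UNIV"
    using locally_compact unfolding locally_compact_space_def F_def by fastforce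
  moreover obtain F' where F': "F' \<subseteq> F" "countable F'" "\<Union>F' = \<Union>F"
    by (rule Lindelof[of F]) (auto simp: F_def)
  ultimately have "F' \<noteq> {}" by auto
  define U where "U = from_nat_into F'"
  have U: "U n \<in> F" for n using from_nat_into[OF \<open>F' \<noteq> {}\<close>] F'(1) unfolding U_def by blast
  have cover: "(\<Union>n. U n) = UNIV"
    using range_from_nat_into[OF \<open>F' \<noteq> {}\<close> F'(2)] F'(3) \<open>\<Union>F = UNIV\<close> unfolding U_def by simp
  obtain C where C: "\<And>n. compact (C n)" "\<And>n. U n \<subseteq> C n"
    using U unfolding F_def by (simp, metis)
  show ?thesis
  proof (intro exI[of _ "\<lambda>n. \<Union>i\<le>n. C i"] conjI allI impI)
    show "compact (\<Union>i\<le>n. C i)" for n using C by (intro compact_UN) auto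
    fix L :: "'a set" assume "compact L"
    then obtain I where I: "finite I" "L \<subseteq> (\<Union>n\<in>I. U n)"
      by (rule compactE_image[of L UNIV U]) (use U cover in \<open>auto simp: F_def\<close>)
    have "L \<subseteq> (\<Union>i\<le>Max I. C i)"
    proof
      fix x assume "x \<in> L"
      then obtain n where "n \<in> I" "x \<in> U n" using I by blast
      then show "x \<in> (\<Union>i\<le>Max I. C i)" using C(2) I(1) by (auto intro!: bexI[of _ n])
    qed
    then show "\<exists>n. L \<subseteq> (\<Union>i\<le>n. C i)" by blast
  qed
qed

section \<open>Codes of paths and their decoding\<close>

definition path_code :: "(real \<Rightarrow> 'a) \<Rightarrow> (nat \<times> nat) \<times> nat \<Rightarrow> real" where
  "path_code \<omega> k = embed (\<omega> (ratio (fst k))) (snd k)"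

text \<open>A code comes from a path iff it is locally uniformly continuous in time and stays in a compact
  set on bounded time intervals. Only countably many conditions are involved.\<close>

lemma path_codes_eq:
  assumes K: "\<And>n. compact (K n)" "\<And>C. compact C \<Longrightarrow> \<exists>n. C \<subseteq> K n"
  shows "path_code ` paths =
    {u. (\<forall>N :: nat. \<exists>j :: nat. \<forall>q. ratio q \<le> real N \<longrightarrow> (\<lambda>i. u (q, i)) \<in> embed ` K j) \<and>
        (\<forall>i. \<forall>N k :: nat. \<exists>d :: nat. \<forall>q q'. ratio q \<le> real N \<longrightarrow> ratio q' \<le> real N \<longrightarrow>
           \<bar>ratio q - ratio q'\<bar> \<le> 1 / real (Suc d) \<longrightarrow> \<bar>u (q, i) - u (q', i)\<bar> \<le> 1 / real (Suc k))}"
    (is "_ = {u. ?comp u \<and> (\<forall>i. ?unif u i)}")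
proof (intro equalityI subsetI)
  fix u assume "u \<in> path_code ` paths"
  then obtain \<omega> where \<omega>: "\<omega> \<in> paths" "u = path_code \<omega>" by blast
  have cont: "continuous_on {0..real N} \<omega>" for N
    using \<omega>(1) unfolding paths_def by (auto intro: continuous_on_subset)
  have "?comp u"
  proof
    fix N :: nat
    obtain j where "\<omega> ` {0..real N} \<subseteq> K j"
      using K(2)[OF compact_continuous_image[OF cont]] by auto
    then have "\<forall>q. ratio q \<le> real N \<longrightarrow> (\<lambda>i. u (q, i)) \<in> embed ` K j"
      unfolding \<omega>(2) path_code_def fst_conv snd_conv by (auto intro!: imageI)
    then show "\<exists>j. \<forall>q. ratio q \<le> real N \<longrightarrow> (\<lambda>i. u (q, i)) \<in> embed ` K j" ..
  qed
  moreover have "?unif u i" for i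
  proof (intro allI)
    fix N k :: nat
    have ci: "continuous_on {0..real N} (\<lambda>t. embed (\<omega> t) i)"
      using continuous_on_compose2[OF continuous_on_product_then_coordinatewise[OF continuous_embed, of i] cont] by auto
    then have uc: "uniformly_continuous_on {0..real N} (\<lambda>t. embed (\<omega> t) i)"
      by (rule compact_uniformly_continuous) simp
    then obtain \<delta> where \<delta>: "\<delta> > 0" "\<And>t t'. t \<in> {0..real N} \<Longrightarrow> t' \<in> {0..real N} \<Longrightarrow> dist t' t < \<delta> \<Longrightarrow>
        dist (embed (\<omega> t') i) (embed (\<omega> t) i) < 1 / real (Suc k)"
      unfolding uniformly_continuous_on_def by (metis of_nat_0_less_iff zero_less_Suc zero_less_divide_1_iff)
    obtain d where d: "1 / real (Suc d) < \<delta>" using \<delta>(1) by (rule nat_approx_posE)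
    have "\<bar>u (q, i) - u (q', i)\<bar> \<le> 1 / real (Suc k)"
      if "ratio q \<le> real N" "ratio q' \<le> real N" "\<bar>ratio q - ratio q'\<bar> \<le> 1 / real (Suc d)" for q q'
      using \<delta>(2)[of "ratio q'" "ratio q"] that d by (simp add: \<omega>(2) path_code_def dist_real_def)
    then show "\<exists>d. \<forall>q q'. ratio q \<le> real N \<longrightarrow> ratio q' \<le> real N \<longrightarrow>
        \<bar>ratio q - ratio q'\<bar> \<le> 1 / real (Suc d) \<longrightarrow> \<bar>u (q, i) - u (q', i)\<bar> \<le> 1 / real (Suc k)" by blast
  qed
  ultimately show "u \<in> {u. ?comp u \<and> (\<forall>i. ?unif u i)}" by blast
next
  fix u assume "u \<in> {u. ?comp u \<and> (\<forall>i. ?unif u i)}"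
  then have comp: "?comp u" and unif: "\<And>i. ?unif u i" by blast+
  define v where "v i t = lim (\<lambda>n. u (approx t n, i))" for i t
  have v: "\<And>t. 0 \<le> t \<Longrightarrow> (\<lambda>n. u (approx t n, i)) \<longlonglongrightarrow> v i t"
    "continuous_on {0..} (v i)" "\<And>q. v i (ratio q) = u (q, i)" for i
    using ratio_extension[of "\<lambda>q. u (q, i)"] unif[of i] unfolding v_def[abs_def] by blast+
  \<comment> \<open>Coordinatewise limits of codes could leave the image of \<open>embed\<close>.
    The image of \<open>K j\<close> is compact, hence closed, and retains them; this is the purpose
    of the compactness condition.\<close>
  have range: "(\<lambda>i. v i t) \<in> range embed" if t: "0 \<le> t" for t
  proof -
    obtain N :: nat where N: "t \<le> real N" using real_arch_simple by blast
    obtain j where j: "\<And>q. ratio q \<le> real N \<Longrightarrow> (\<lambda>i. u (q, i)) \<in> embed ` K j" using comp by blast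
    have "closed (embed ` K j)"
      by (intro compact_imp_closed compact_continuous_image continuous_on_subset[OF continuous_embed] K) simp
    moreover have "(\<lambda>i. u (approx t n, i)) \<in> embed ` K j" for n
      using ratio_approx(1)[OF t, of n] N by (intro j) simp
    moreover have "(\<lambda>n. (\<lambda>i. u (approx t n, i))) \<longlonglongrightarrow> (\<lambda>i. v i t)"
      by (rule tendsto_coordinatewise) (rule v(1)[OF t])
    ultimately have "(\<lambda>i. v i t) \<in> embed ` K j" by (rule closed_sequentially)
    then show ?thesis by blast
  qed
  define \<omega> where "\<omega> t = (if 0 \<le> t then inv embed (\<lambda>i. v i t) else undefined)" for t
  have e\<omega>: "embed (\<omega> t) = (\<lambda>i. v i t)" if "0 \<le> t" for t
    using f_inv_into_f[OF range[OF that]] that by (simp add: \<omega>_def)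
  have contv: "continuous_on {0..} (\<lambda>t i. v i t)"
    by (intro continuous_on_coordinatewise_then_product v(2))
  have "continuous_on {0..} \<omega>"
    unfolding continuous_on_topological
  proof (intro ballI allI impI)
    fix t and U assume t: "t \<in> {0..}" and U: "open U" "\<omega> t \<in> U"
    obtain V where V: "open V" "embed (\<omega> t) \<in> V" "embed -` V \<subseteq> U"
      by (rule embed_nbhd[OF U])
    obtain A where A: "open A" "t \<in> A" "\<And>s. s \<in> {0..} \<Longrightarrow> s \<in> A \<Longrightarrow> (\<lambda>i. v i s) \<in> V"
      using contv[unfolded continuous_on_topological] t V(1,2) e\<omega>[of t] by (metis atLeast_iff)
    then show "\<exists>A. open A \<and> t \<in> A \<and> (\<forall>s\<in>{0..}. s \<in> A \<longrightarrow> \<omega> s \<in> U)"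
      using V(3) e\<omega> by (intro exI[of _ A]) auto
  qed
  then have "\<omega> \<in> paths" by (auto simp: paths_def \<omega>_def extensional_def)
  moreover have "path_code \<omega> = u"
    by (auto simp: path_code_def e\<omega> v(3))
  ultimately show "u \<in> path_code ` paths" by blast
qed

lemma borel_path_codes: "path_code ` paths \<in> sets borel"
proof -
  from compact_exhaustion obtain K :: "nat \<Rightarrow> 'a set"
    where "(\<forall>n. compact (K n)) \<and> (\<forall>C. compact C \<longrightarrow> (\<exists>n. C \<subseteq> K n))" ..
  then have K: "\<And>n. compact (K n)" "\<And>C. compact C \<Longrightarrow> \<exists>n. C \<subseteq> K n" by simp_all
  have [measurable]: "Measurable.pred borel (\<lambda>u :: (nat \<times> nat) \<times> nat \<Rightarrow> real. (\<lambda>i. u (q, i)) \<in> embed ` K j)" for q j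
  proof -
    have "closed (embed ` K j)"
      by (intro compact_imp_closed compact_continuous_image continuous_on_subset[OF continuous_embed] K) simp
    moreover have "continuous_on UNIV (\<lambda>u :: (nat \<times> nat) \<times> nat \<Rightarrow> real. \<lambda>i. u (q, i))"
      by (intro continuous_on_coordinatewise_then_product continuous_on_product_coordinates)
    ultimately have "closed ((\<lambda>u :: (nat \<times> nat) \<times> nat \<Rightarrow> real. \<lambda>i. u (q, i)) -` (embed ` K j))"
      by (intro closed_vimage) auto
    then show ?thesis by (simp add: pred_def vimage_def)
  qed
  have [measurable]: "(\<lambda>u :: (nat \<times> nat) \<times> nat \<Rightarrow> real. u k) \<in> borel_measurable borel" for k
    by (intro borel_measurable_continuous_onI continuous_on_product_coordinates)
  have "{u \<in> space borel. (\<forall>N :: nat. \<exists>j :: nat. \<forall>q. ratio q \<le> real N \<longrightarrow> (\<lambda>i. u (q, i)) \<in> embed ` K j) \<and>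
        (\<forall>i. \<forall>N k :: nat. \<exists>d :: nat. \<forall>q q'. ratio q \<le> real N \<longrightarrow> ratio q' \<le> real N \<longrightarrow>
           \<bar>ratio q - ratio q'\<bar> \<le> 1 / real (Suc d) \<longrightarrow> \<bar>u (q, i) - u (q', i)\<bar> \<le> 1 / real (Suc k))} \<in> sets borel"
    by measurable
  then show ?thesis by (subst path_codes_eq[OF K]) (simp_all only: space_borel UNIV_I simp_thms)
qed

definition unembed :: "(nat \<Rightarrow> real) \<Rightarrow> 'a" where
  "unembed v = (if v \<in> range embed then inv embed v else undefined)"

lemma unembed_embed [simp]: "unembed (embed x) = x"
  by (simp add: unembed_def inj_embed)

text \<open>The image of \<open>embed\<close> is a countable union of compact sets, hence Borel, and
  on it the inverse is continuous.\<close>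

lemma measurable_unembed: "unembed \<in> borel_measurable borel"
proof (rule borel_measurableI)
  fix U :: "'a set" assume U: "open U"
  from compact_exhaustion obtain K :: "nat \<Rightarrow> 'a set"
    where "(\<forall>n. compact (K n)) \<and> (\<forall>C. compact C \<longrightarrow> (\<exists>n. C \<subseteq> K n))" ..
  then have K: "\<And>n. compact (K n)" "\<And>C. compact C \<Longrightarrow> \<exists>n. C \<subseteq> K n" by simp_all
  have "\<exists>n. x \<in> K n" for x using K(2)[of "{x}"] by auto
  then have "range embed = (\<Union>n. embed ` K n)" by blast
  moreover have "closed (embed ` K n)" for n
    by (intro compact_imp_closed compact_continuous_image continuous_on_subset[OF continuous_embed] K) simp
  ultimately have range: "range embed \<in> sets borel" by (auto intro!: sets.countable_UN borel_closed)
  \<comment> \<open>\<open>W\<close> is an open set whose trace on the image of \<open>embed\<close>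
    is the image of \<open>U\<close>.\<close>
  define W where "W = \<Union>{V. open V \<and> embed -` V \<subseteq> U}"
  have W: "embed y \<in> W \<longleftrightarrow> y \<in> U" for y
  proof
    show "embed y \<in> W \<Longrightarrow> y \<in> U" unfolding W_def by blast
    assume y: "y \<in> U"
    obtain V where "open V" "embed y \<in> V" "embed -` V \<subseteq> U" by (rule embed_nbhd[OF U y])
    then show "embed y \<in> W" unfolding W_def by blast
  qed
  \<comment> \<open>Off the image the value is the constant \<open>undefined\<close>, so the
    preimage contains all or nothing of the complement.\<close>
  have "unembed -` U = (range embed \<inter> W) \<union> (if undefined \<in> U then - range embed else {})"
    by (auto simp: unembed_def W inj_embed split: if_splits)
  moreover have "open W" unfolding W_def by blast
  ultimately show "unembed -` U \<inter> space borel \<in> sets borel"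
    using range by (auto intro!: sets.Un sets.Int borel_comp)
qed

text \<open>Off the codes the value is a constant path, so that the decoder maps every point into
  \<open>paths\<close>, as \<open>coded\<close> demands.\<close>

definition path_decode :: "((nat \<times> nat) \<times> nat \<Rightarrow> real) \<Rightarrow> real \<Rightarrow> 'a" where
  "path_decode u = (if u \<in> path_code ` paths then inv_into paths path_code u else (\<lambda>t\<in>{0..}. undefined))"

lemma path_limit:
  assumes "\<omega> \<in> paths" "0 \<le> t"
  shows "(\<lambda>n. \<omega> (ratio (approx t n))) \<longlonglongrightarrow> \<omega> t"
  using assms ratio_approx_tendsto[OF assms(2)]
  by (intro continuous_on_tendsto_compose[of "{0..}" \<omega>]) (auto simp: paths_def)

lemma path_code_limit:
  assumes "\<omega> \<in> paths" "0 \<le> t"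
  shows "embed (\<omega> t) = (\<lambda>i. lim (\<lambda>n. path_code \<omega> (approx t n, i)))"
proof
  fix i
  have "(\<lambda>n. embed (\<omega> (ratio (approx t n))) i) \<longlonglongrightarrow> embed (\<omega> t) i"
    using continuous_on_product_then_coordinatewise[OF continuous_embed, of i] path_limit[OF assms]
    by (intro continuous_on_tendsto_compose[of UNIV "\<lambda>x. embed x i"]) auto
  then show "embed (\<omega> t) i = lim (\<lambda>n. path_code \<omega> (approx t n, i))"
    by (simp add: path_code_def limI)
qed

lemma inj_path_code: "inj_on path_code paths"
proof (rule inj_onI, rule ext)
  fix \<omega> \<omega>' t assume \<omega>: "\<omega> \<in> paths" "\<omega>' \<in> paths" and eq: "path_code \<omega> = path_code \<omega>'"
  show "\<omega> t = \<omega>' t"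
  proof (cases "0 \<le> t")
    case True
    then have "embed (\<omega> t) = embed (\<omega>' t)"
      using path_code_limit \<omega> eq by simp
    then show ?thesis using inj_embed by (simp add: inj_eq)
  next
    case False
    then show ?thesis using \<omega> by (simp add: paths_def extensional_def)
  qed
qed

lemma path_decode_code: "\<omega> \<in> paths \<Longrightarrow> path_decode (path_code \<omega>) = \<omega>"
  by (simp add: path_decode_def inj_path_code)

text \<open>The description by \<open>inv_into\<close> hides measurability; as a limit of
  coordinates followed by \<open>unembed\<close>, each evaluation of the decoder is visibly
  measurable.\<close>

lemma path_decode_eq:
  assumes "u \<in> path_code ` paths" "0 \<le> t"
  shows "path_decode u t = unembed (\<lambda>i. lim (\<lambda>n. u (approx t n, i)))"
proof -
  obtain \<omega> where \<omega>: "\<omega> \<in> paths" "u = path_code \<omega>" using assms(1) by blast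
  show ?thesis
    using path_code_limit[OF \<omega>(1) assms(2), symmetric] by (simp add: \<omega> path_decode_code)
qed

lemma measurable_embed: "embed \<in> borel_measurable borel"
  by (intro borel_measurable_continuous_onI continuous_embed)

text \<open>Evaluations generate \<open>path_space\<close>, so the decoder is checked one time at a
  time, the Borel set of codes separating the limit formula from the default.\<close>

lemma coded_path_space: "coded path_space path_code path_decode"
  unfolding coded_def
proof (intro conjI ballI allI)
  show "path_code \<in> borel_measurable path_space"
  proof (rule measurable_coordinatewise_then_product)
    fix k :: "(nat \<times> nat) \<times> nat"
    have "(\<lambda>x. embed x (snd k)) \<in> borel_measurable borel"
      by (rule measurable_product_then_coordinatewise[OF measurable_embed])
    from measurable_compose[OF measurable_path_eval this]
    show "(\<lambda>\<omega>. path_code \<omega> k) \<in> borel_measurable path_space"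
      by (simp add: path_code_def)
  qed
  show "path_decode \<in> measurable borel path_space"
  proof (rule measurable_path_spaceI)
    have "continuous_on {0..} (\<lambda>t\<in>{0::real..}. undefined :: 'a)"
      using continuous_on_const[of "{0..}" "undefined :: 'a"] by (rule continuous_on_cong[THEN iffD1, rotated 2]) auto
    then have "(\<lambda>t\<in>{0..}. undefined :: 'a) \<in> paths" by (simp add: paths_def)
    then show "path_decode \<in> space borel \<rightarrow> paths"
      by (auto simp: path_decode_def inv_into_into simp del: inv_into_f_f)
    fix t :: real assume t: "0 \<le> t"
    have [measurable]: "(\<lambda>u :: (nat \<times> nat) \<times> nat \<Rightarrow> real. u k) \<in> borel_measurable borel" for k
      by (intro borel_measurable_continuous_onI continuous_on_product_coordinates)
    have "(\<lambda>u :: (nat \<times> nat) \<times> nat \<Rightarrow> real. \<lambda>i. lim (\<lambda>n. u (approx t n, i))) \<in> borel_measurable borel"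
      by (rule measurable_coordinatewise_then_product) measurable
    then have [measurable]: "(\<lambda>u :: (nat \<times> nat) \<times> nat \<Rightarrow> real. unembed (\<lambda>i. lim (\<lambda>n. u (approx t n, i)))) \<in> borel_measurable borel"
      by (rule measurable_compose[OF _ measurable_unembed])
    have [measurable]: "path_code ` paths \<in> sets borel" by (rule borel_path_codes)
    have "(\<lambda>u. if u \<in> path_code ` paths then unembed (\<lambda>i. lim (\<lambda>n. u (approx t n, i))) else undefined) \<in> borel_measurable borel"
      by measurable
    also have "(\<lambda>u. if u \<in> path_code ` paths then unembed (\<lambda>i. lim (\<lambda>n. u (approx t n, i))) else undefined) = (\<lambda>u. path_decode u t)"
    proof
      fix u
      show "(if u \<in> path_code ` paths then unembed (\<lambda>i. lim (\<lambda>n. u (approx t n, i))) else undefined) = path_decode u t"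
        using t path_decode_eq[of u t] by (cases "u \<in> path_code ` paths") (simp_all add: path_decode_def)
    qed
    finally show "(\<lambda>u. path_decode u t) \<in> borel_measurable borel" .
  qed
  show "path_decode (path_code \<omega>) = \<omega>" if "\<omega> \<in> space path_space" for \<omega>
    using that by (simp add: path_decode_code space_path_space)
  show "0 \<le> path_code \<omega> k" "path_code \<omega> k < 1" for \<omega> k
    using embed_bounds by (auto simp: path_code_def)
qed

end

section \<open>The transport functional\<close>

lemma lsc_pseudometricD:
  assumes "lsc_pseudometric m"
  shows "0 \<le> m x y" "m x y \<le> 1" "m x x = 0" "m x y = m y x" "m x z \<le> m x y + m y z"
    "open {p. a < m (fst p) (snd p)}"
  using assms by (auto simp: lsc_pseudometric_def)

lemma lsc_pseudometric_measurable:
  fixes m :: "'a::second_countable_topology \<Rightarrow> 'a \<Rightarrow> real"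
  assumes "lsc_pseudometric m"
  shows "(\<lambda>p. m (fst p) (snd p)) \<in> borel_measurable (borel \<Otimes>\<^sub>M borel)"
  unfolding borel_prod borel_measurable_iff_greater
  using lsc_pseudometricD(6)[OF assms] by simp

lemma lsc_pseudometric_SUP:
  fixes d :: "nat \<Rightarrow> 'a::topological_space \<Rightarrow> 'a \<Rightarrow> real"
  assumes d: "\<And>n. lsc_pseudometric (d n)"
  shows "lsc_pseudometric (\<lambda>x y. SUP n. d n x y)"
proof -
  note D = lsc_pseudometricD[OF d]
  have bdd: "bdd_above (range (\<lambda>n. d n x y))" for x y using D(2) by (intro bdd_aboveI2)
  have upper: "d n x y \<le> (SUP n. d n x y)" for n x y by (rule cSUP_upper[OF UNIV_I bdd])
  have "0 \<le> (SUP n. d n x y)" for x y using D(1) upper order_trans by blast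
  moreover have "(SUP n. d n x y) \<le> 1" for x y by (rule cSUP_least) (use D(2) in auto)
  moreover have "(SUP n. d n x z) \<le> (SUP n. d n x y) + (SUP n. d n y z)" for x y z
    by (rule cSUP_least) (auto intro: order_trans[OF D(5)[of _ x z y]] add_mono upper)
  moreover have "open {p. a < (SUP n. d n (fst p) (snd p))}" for a
  proof -
    have "{p. a < (SUP n. d n (fst p) (snd p))} = (\<Union>n. {p. a < d n (fst p) (snd p)})"
      by (auto simp: less_cSUP_iff[OF _ bdd])
    then show ?thesis using D(6) by (simp add: open_UN)
  qed
  moreover have "(SUP n. d n x y) = (SUP n. d n y x)" for x y by (simp only: D(4)[of _ x y])
  moreover have "(SUP n. d n x x) = 0" for x by (simp add: D(3))
  ultimately show ?thesis unfolding lsc_pseudometric_def by blast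
qed

lemma transport_cost_swap:
  assumes C: "lsc_cost M R C" and sym: "\<And>x y. x \<in> space M \<Longrightarrow> y \<in> space M \<Longrightarrow> C x y = C y x"
    and \<mu>: "prob_space \<mu>" "sets \<mu> = sets M" and \<nu>: "prob_space \<nu>" "sets \<nu> = sets M"
  shows "transport_cost C \<mu> \<nu> \<le> transport_cost C \<nu> \<mu>"
proof (rule transport_cost_greatest[OF \<nu>(1) \<mu>(1)])
  fix \<gamma> assume \<gamma>: "\<gamma> \<in> couplings \<nu> \<mu>"
  have S: "sets \<gamma> = sets (M \<Otimes>\<^sub>M M)"
    using couplings_sets[OF \<gamma>] sets_pair_measure_cong[OF \<nu>(2) \<mu>(2)] by simp
  have sp: "space \<gamma> = space M \<times> space M"
    using sets_eq_imp_space_eq[OF S] by (simp add: space_pair_measure)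
  have sp': "space \<mu> = space M" "space \<nu> = space M"
    using sets_eq_imp_space_eq[OF \<mu>(2)] sets_eq_imp_space_eq[OF \<nu>(2)] by auto
  have m: "snd \<in> measurable \<gamma> M" "fst \<in> measurable \<gamma> M" using S by (simp_all cong: measurable_cong_sets)
  define \<gamma>' where "\<gamma>' = distr \<gamma> (\<mu> \<Otimes>\<^sub>M \<nu>) (\<lambda>p. (snd p, fst p))"
  have "distr \<gamma> M snd = \<mu>" "distr \<gamma> M fst = \<nu>"
    using \<gamma> distr_cong[OF refl \<mu>(2), of \<gamma> snd snd] distr_cong[OF refl \<nu>(2), of \<gamma> fst fst]
    by (auto simp: couplings_def)
  then have \<gamma>': "\<gamma>' \<in> couplings \<mu> \<nu>"
    unfolding \<gamma>'_def by (intro couplings_distr[OF \<mu>(2) \<nu>(2) m])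
  have "transport_cost C \<mu> \<nu> \<le> (\<integral>p. C (fst p) (snd p) \<partial>\<gamma>')"
    by (rule transport_cost_le[OF \<gamma>']) (use C sp' in \<open>auto simp: lsc_cost_def\<close>)
  also have "\<dots> = (\<integral>p. C (snd p) (fst p) \<partial>\<gamma>)"
  proof -
    have "(\<lambda>p. (snd p, fst p)) \<in> measurable \<gamma> (\<mu> \<Otimes>\<^sub>M \<nu>)"
      using m \<mu>(2) \<nu>(2) by (intro measurable_Pair) (simp_all cong: measurable_cong_sets)
    moreover have "(\<lambda>p. C (fst p) (snd p)) \<in> borel_measurable (\<mu> \<Otimes>\<^sub>M \<nu>)"
      using lsc_cost_measurable[OF C sets_pair_measure_cong[OF \<mu>(2) \<nu>(2)]] .
    ultimately show ?thesis unfolding \<gamma>'_def by (subst integral_distr) auto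
  qed
  also have "\<dots> = (\<integral>p. C (fst p) (snd p) \<partial>\<gamma>)"
    by (intro Bochner_Integration.integral_cong refl sym) (auto simp: sp)
  finally show "transport_cost C \<mu> \<nu> \<le> (\<integral>p. C (fst p) (snd p) \<partial>\<gamma>)" .
qed

lemma transport_cost_self:
  assumes C: "lsc_cost M R C" and zero: "\<And>x. x \<in> space M \<Longrightarrow> C x x = 0"
    and \<mu>: "prob_space \<mu>" "sets \<mu> = sets M"
  shows "transport_cost C \<mu> \<mu> \<le> 0"
proof -
  have sp: "space \<mu> = space M" using sets_eq_imp_space_eq[OF \<mu>(2)] by auto
  have id: "(\<lambda>x. x) \<in> measurable \<mu> M" using \<mu>(2) by (simp cong: measurable_cong_sets)
  have "distr \<mu> M (\<lambda>x. x) = \<mu>" using distr_cong[OF refl \<mu>(2), of \<mu> "\<lambda>x. x" "\<lambda>x. x"] by simp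
  then have c: "distr \<mu> (\<mu> \<Otimes>\<^sub>M \<mu>) (\<lambda>x. (x, x)) \<in> couplings \<mu> \<mu>"
    by (intro couplings_distr[OF \<mu>(2) \<mu>(2) id id])
  have "transport_cost C \<mu> \<mu> \<le> (\<integral>p. C (fst p) (snd p) \<partial>distr \<mu> (\<mu> \<Otimes>\<^sub>M \<mu>) (\<lambda>x. (x, x)))"
    by (rule transport_cost_le[OF c]) (use C sp in \<open>auto simp: lsc_cost_def\<close>)
  also have "\<dots> = (\<integral>x. C x x \<partial>\<mu>)"
    using lsc_cost_measurable[OF C sets_pair_measure_cong[OF \<mu>(2) \<mu>(2)]]
    by (subst integral_distr) auto
  also have "\<dots> = (\<integral>x. 0 \<partial>\<mu>)"
    by (intro Bochner_Integration.integral_cong refl zero) (simp add: sp)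
  finally show ?thesis by simp
qed

section \<open>Starting point and weak continuity of the laws\<close>

context diffusion
begin

lemma law: "prob_space (Pr x)" "sets (Pr x) = sets path_space"
  using law_prob[of x] by (auto simp: space_prob_algebra)

text \<open>The law of the position at the single time 0 is \<open>fdd\<close> with
  \<open>n = 0\<close>, a point mass at \<open>x\<close>.\<close>

lemma law_start: "AE \<omega> in Pr x. \<omega> 0 = x"
proof -
  have "AE y in return borel x. y = x" by (subst AE_return) auto
  then have "AE f in distr (return borel x) (\<Pi>\<^sub>M i\<in>{..0::nat}. borel) (\<lambda>y. \<lambda>i\<in>{..0}. y). f 0 = x"
    by (subst AE_distr_iff) auto
  also have "distr (return borel x) (\<Pi>\<^sub>M i\<in>{..0::nat}. borel) (\<lambda>y. \<lambda>i\<in>{..0}. y) =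
      distr (Pr x) (\<Pi>\<^sub>M i\<in>{..0::nat}. borel) (\<lambda>\<omega>. \<lambda>i\<in>{..0}. \<omega> 0)"
    by (rule law_fdd[where t = "\<lambda>_. 0" and x = x and n = 0, OF refl monoI, unfolded fdd.simps, symmetric]) simp
  finally have "AE f in distr (Pr x) (\<Pi>\<^sub>M i\<in>{..0::nat}. borel) (\<lambda>\<omega>. \<lambda>i\<in>{..0}. \<omega> 0). f 0 = x" .
  moreover have "(\<lambda>\<omega>. \<lambda>i\<in>{..0::nat}. \<omega> 0) \<in> measurable (Pr x) (\<Pi>\<^sub>M i\<in>{..0}. borel)"
    using measurable_path_eval[of 0] by (intro measurable_restrict) (simp add: measurable_cong_sets[OF law(2) refl])
  ultimately have "AE \<omega> in Pr x. (\<lambda>i\<in>{..0::nat}. \<omega> 0) 0 = x" by (rule AE_distrD[rotated])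
  then show ?thesis by simp
qed

lemma uniform_metric_upper: "0 \<le> t \<Longrightarrow> \<Delta> (\<omega> t) (\<omega>' t) \<le> uniform_metric \<Delta> \<omega> \<omega>'"
  unfolding uniform_metric_def
  by (intro cSUP_upper bdd_aboveI2[where M = 1] metric_le_1) simp

lemma uniform_metric_least: "(\<And>t. 0 \<le> t \<Longrightarrow> \<Delta> (\<omega> t) (\<omega>' t) \<le> a) \<Longrightarrow> uniform_metric \<Delta> \<omega> \<omega>' \<le> a"
  unfolding uniform_metric_def by (intro cSUP_least) auto

lemma Metric_space_paths: "Metric_space paths (uniform_metric \<Delta>)"
proof
  show nonneg: "0 \<le> uniform_metric \<Delta> \<omega> \<omega>'" for \<omega> \<omega>'
    using uniform_metric_upper[of 0 \<omega> \<omega>'] \<Delta>_nonneg order_trans by blast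
  show "uniform_metric \<Delta> \<omega> \<omega>' = uniform_metric \<Delta> \<omega>' \<omega>" for \<omega> \<omega>'
    by (simp add: uniform_metric_def \<Delta>_commute)
  show "uniform_metric \<Delta> \<omega> \<omega>' = 0 \<longleftrightarrow> \<omega> = \<omega>'" if "\<omega> \<in> paths" "\<omega>' \<in> paths" for \<omega> \<omega>'
  proof
    assume 0: "uniform_metric \<Delta> \<omega> \<omega>' = 0"
    have "\<omega> t = \<omega>' t" if "0 \<le> t" for t
      using uniform_metric_upper[OF that, of \<omega> \<omega>'] 0 \<Delta>_nonneg[of "\<omega> t" "\<omega>' t"] by (simp add: \<Delta>_zero_iff)
    moreover have "\<omega> t = \<omega>' t" if "\<not> 0 \<le> t" for t
      using that \<open>\<omega> \<in> paths\<close> \<open>\<omega>' \<in> paths\<close> by (simp add: paths_def extensional_def)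
    ultimately show "\<omega> = \<omega>'" by blast
  next
    assume "\<omega> = \<omega>'"
    then have "uniform_metric \<Delta> \<omega> \<omega>' \<le> 0" by (intro uniform_metric_least) simp
    then show "uniform_metric \<Delta> \<omega> \<omega>' = 0" using nonneg[of \<omega> \<omega>'] by simp
  qed
  show "uniform_metric \<Delta> \<omega> \<omega>'' \<le> uniform_metric \<Delta> \<omega> \<omega>' + uniform_metric \<Delta> \<omega>' \<omega>''" for \<omega> \<omega>' \<omega>''
  proof (rule uniform_metric_least)
    fix t :: real assume "0 \<le> t"
    then show "\<Delta> (\<omega> t) (\<omega>'' t) \<le> uniform_metric \<Delta> \<omega> \<omega>' + uniform_metric \<Delta> \<omega>' \<omega>''"
      using \<Delta>_triangle[of "\<omega> t" "\<omega>'' t" "\<omega>' t"] uniform_metric_upper[of t \<omega> \<omega>'] uniform_metric_upper[of t \<omega>' \<omega>''] by linarith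
  qed
qed

text \<open>Each coordinate of the code is Lipschitz for the uniform metric, so the topology of
  codes is the coarser one. This is the bridge from \<open>weakly_continuous\<close>, whose test
  functions refer to the uniform metric, to weak convergence on the cube.\<close>

lemma continuous_path_code:
  "continuous_map (Metric_space.mtopology paths (uniform_metric \<Delta>)) euclidean path_code"
proof -
  interpret U: Metric_space paths "uniform_metric \<Delta>" by (rule Metric_space_paths)
  have "continuous_map U.mtopology euclideanreal (\<lambda>\<omega>. path_code \<omega> k)" for k
    unfolding continuous_map_def
  proof (intro conjI allI impI)
    fix S :: "real set" assume "openin euclideanreal S"
    then have S: "open S" by simp
    show "openin U.mtopology {\<omega> \<in> topspace U.mtopology. path_code \<omega> k \<in> S}"
      unfolding U.openin_mtopology
    proof (intro conjI allI impI)
      fix \<omega> assume \<omega>: "\<omega> \<in> {\<omega> \<in> topspace U.mtopology. path_code \<omega> k \<in> S}"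
      then obtain e where e: "e > 0" "\<And>y. dist y (path_code \<omega> k) < e \<Longrightarrow> y \<in> S"
        using S unfolding open_dist by blast
      have "path_code \<omega>' k \<in> S" if "uniform_metric \<Delta> \<omega> \<omega>' < e" for \<omega>'
      proof (rule e(2))
        have "\<bar>path_code \<omega>' k - path_code \<omega> k\<bar> \<le> \<Delta> (\<omega> (ratio (fst k))) (\<omega>' (ratio (fst k)))"
          using abs_\<Delta>_diff_le[of "\<omega>' (ratio (fst k))" "dense_seq (snd k)" "\<omega> (ratio (fst k))"]
            \<Delta>_nonneg[of "\<omega> (ratio (fst k))" "\<omega>' (ratio (fst k))"]
          by (simp add: path_code_def embed_def \<Delta>_commute flip: diff_divide_distrib)
        also have "\<dots> < e" using uniform_metric_upper[of "ratio (fst k)" \<omega> \<omega>'] that by simp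
        finally show "dist (path_code \<omega>' k) (path_code \<omega> k) < e" by (simp add: dist_real_def)
      qed
      then show "\<exists>r>0. U.mball \<omega> r \<subseteq> {\<omega> \<in> topspace U.mtopology. path_code \<omega> k \<in> S}"
        using e(1) by (intro exI[of _ e]) auto
    qed auto
  qed simp
  then show ?thesis
    using continuous_map_componentwise_UNIV[of U.mtopology "\<lambda>_. euclideanreal" path_code]
    by (simp add: euclidean_product_topology)
qed

lemma law_limit:
  fixes F :: "((nat \<times> nat) \<times> nat \<Rightarrow> real) \<Rightarrow> real"
  assumes F: "continuous_on UNIV F" "\<And>u. \<bar>F u\<bar> \<le> 1" and x: "X \<longlonglongrightarrow> x"
  shows "(\<lambda>n. \<integral>\<omega>. F (path_code \<omega>) \<partial>Pr (X n)) \<longlonglongrightarrow> (\<integral>\<omega>. F (path_code \<omega>) \<partial>Pr x)"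
proof -
  have "continuous_map euclidean euclideanreal F" using F(1) by simp
  from continuous_map_compose[OF continuous_path_code this]
  have "continuous_map (Metric_space.mtopology paths (uniform_metric \<Delta>)) euclideanreal (\<lambda>\<omega>. F (path_code \<omega>))"
    by (simp add: comp_def)
  moreover have "(\<lambda>\<omega>. F (path_code \<omega>)) \<in> borel_measurable path_space"
    using coded_path_space by (intro measurable_compose[OF _ borel_measurable_continuous_onI[OF F(1)]]) (simp add: coded_def)
  ultimately have "continuous_on UNIV (\<lambda>x. \<integral>\<omega>. F (path_code \<omega>) \<partial>Pr x)"
    using law_continuous[unfolded weakly_continuous_def, rule_format, of "\<lambda>\<omega>. F (path_code \<omega>)"] F(2) by blast
  from continuous_on_tendsto_compose[OF this x] show ?thesis by simp
qed

lemma law_transport_limit: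
  assumes "X \<longlonglongrightarrow> x" "Y \<longlonglongrightarrow> y" and \<gamma>: "\<And>n. \<gamma> n \<in> couplings (Pr (X n)) (Pr (Y n))"
  obtains r \<kappa> where "strict_mono (r :: nat \<Rightarrow> nat)" "\<kappa> \<in> couplings (Pr x) (Pr y)"
    "\<And>C a l N. lsc_cost path_space path_code C \<Longrightarrow>
       (\<And>n. N \<le> n \<Longrightarrow> (\<integral>p. C (fst p) (snd p) \<partial>\<gamma> (r n)) \<le> a n) \<Longrightarrow> a \<longlonglongrightarrow> l
       \<Longrightarrow> (\<integral>p. C (fst p) (snd p) \<partial>\<kappa>) \<le> l"
  by (rule transport_limit[OF coded_path_space law law law law law_limit law_limit \<gamma>])
     (use assms in auto)

end

section \<open>The discounted uniform cost\<close>

locale discounted_diffusion = diffusion \<Delta> Phat P Pr obs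
  for \<Delta> :: "'a::{t2_space, second_countable_topology} \<Rightarrow> 'a \<Rightarrow> real" and Phat P Pr obs +
  fixes c :: real
  assumes c: "0 < c" "c < 1"
begin

lemma discount_bounds: "0 \<le> t \<Longrightarrow> 0 < c powr t \<and> c powr t \<le> 1"
  using c by (simp add: powr_le1)

lemma discounted_term_bounds:
  assumes "lsc_pseudometric m" "0 \<le> t"
  shows "0 \<le> c powr t * m x y" "c powr t * m x y \<le> 1"
  using discount_bounds[OF assms(2)] lsc_pseudometricD(1,2)[OF assms(1), of x y]
  by (auto intro: mult_le_one)

lemma discounted_uniform_upper:
  assumes "lsc_pseudometric m" "0 \<le> t"
  shows "c powr t * m (\<omega> t) (\<omega>' t) \<le> discounted_uniform c m \<omega> \<omega>'"
  unfolding discounted_uniform_def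
  by (intro cSUP_upper bdd_aboveI2[where M = 1] discounted_term_bounds) (use assms in auto)

lemma discounted_uniform_least:
  assumes "\<And>t. 0 \<le> t \<Longrightarrow> c powr t * m (\<omega> t) (\<omega>' t) \<le> a"
  shows "discounted_uniform c m \<omega> \<omega>' \<le> a"
  unfolding discounted_uniform_def by (intro cSUP_least) (use assms in auto)

lemma discounted_uniform_bounds:
  assumes "lsc_pseudometric m"
  shows "0 \<le> discounted_uniform c m \<omega> \<omega>'" "discounted_uniform c m \<omega> \<omega>' \<le> 1"
proof -
  show "0 \<le> discounted_uniform c m \<omega> \<omega>'"
    by (rule order_trans[OF discounted_term_bounds(1)[OF assms order_refl] discounted_uniform_upper[OF assms order_refl]])
  show "discounted_uniform c m \<omega> \<omega>' \<le> 1"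
    by (intro discounted_uniform_least discounted_term_bounds assms)
qed

text \<open>A lower semicontinuous function of time exceeds \<open>a\<close> on a relatively open set, so the supremum
  over all times is attained along rational ones.\<close>

lemma less_discounted_uniform_iff:
  assumes m: "lsc_pseudometric m" and \<omega>: "\<omega> \<in> paths" "\<omega>' \<in> paths"
  shows "a < discounted_uniform c m \<omega> \<omega>' \<longleftrightarrow> (\<exists>q. a < c powr ratio q * m (\<omega> (ratio q)) (\<omega>' (ratio q)))"
proof
  assume "a < discounted_uniform c m \<omega> \<omega>'"
  then have "\<not> (\<forall>t\<ge>0. c powr t * m (\<omega> t) (\<omega>' t) \<le> a)"
    using discounted_uniform_least[of m \<omega> \<omega>' a] by auto
  then obtain t where t: "0 \<le> t" "a < c powr t * m (\<omega> t) (\<omega>' t)" by auto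
  have ct: "0 < c powr t" using discount_bounds[OF t(1)] by simp
  \<comment> \<open>\<open>b\<close> separates the two factors: near \<open>t\<close> the lower
    semicontinuous \<open>m\<close> stays above \<open>b\<close>, while the discount varies
    continuously, so the discounted \<open>b\<close> stays above \<open>a\<close>.\<close>
  obtain b where b: "a / c powr t < b" "b < m (\<omega> t) (\<omega>' t)"
    using dense[of "a / c powr t" "m (\<omega> t) (\<omega>' t)"] t(2) ct by (auto simp: field_simps)
  have "(\<lambda>n. (\<omega> (ratio (approx t n)), \<omega>' (ratio (approx t n)))) \<longlonglongrightarrow> (\<omega> t, \<omega>' t)"
    by (intro tendsto_Pair path_limit \<omega> t(1))
  from topological_tendstoD[OF this lsc_pseudometricD(6)[OF m, of b]] b(2)
  have ev1: "\<forall>\<^sub>F n in sequentially. b < m (\<omega> (ratio (approx t n))) (\<omega>' (ratio (approx t n)))" by simp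
  have "(\<lambda>n. c powr ratio (approx t n) * b) \<longlonglongrightarrow> c powr t * b"
    using c by (intro tendsto_intros ratio_approx_tendsto t(1)) auto
  moreover have "a < c powr t * b" using b(1) ct by (simp add: field_simps)
  ultimately have ev2: "\<forall>\<^sub>F n in sequentially. a < c powr ratio (approx t n) * b"
    by (rule order_tendstoD)
  have "\<forall>\<^sub>F n in sequentially. a < c powr ratio (approx t n) * m (\<omega> (ratio (approx t n))) (\<omega>' (ratio (approx t n)))"
    using ev1 ev2
  proof eventually_elim
    case (elim n)
    have "c powr ratio (approx t n) * b \<le> c powr ratio (approx t n) * m (\<omega> (ratio (approx t n))) (\<omega>' (ratio (approx t n)))"
      using elim(1) by (intro mult_left_mono) auto
    then show ?case using elim(2) by linarith
  qed
  then obtain n where "a < c powr ratio (approx t n) * m (\<omega> (ratio (approx t n))) (\<omega>' (ratio (approx t n)))"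
    using eventually_happens by fastforce
  then show "\<exists>q. a < c powr ratio q * m (\<omega> (ratio q)) (\<omega>' (ratio q))" by blast
next
  assume "\<exists>q. a < c powr ratio q * m (\<omega> (ratio q)) (\<omega>' (ratio q))"
  then show "a < discounted_uniform c m \<omega> \<omega>'"
    using discounted_uniform_upper[OF m ratio_nonneg] less_le_trans by blast
qed

text \<open>A value above \<open>a\<close> is witnessed at one rational time, and codes record
  positions at exactly those times. So the witness persists on an open set of pairs of codes, and
  the set of pairs of paths with cost above \<open>a\<close> is a countable union of measurable
  sets.\<close>

lemma lsc_cost_discounted_uniform:
  assumes m: "lsc_pseudometric m"
  shows "lsc_cost path_space path_code (discounted_uniform c m)"
  unfolding lsc_cost_def
proof (intro conjI ballI allI impI)
  have ev: "(\<lambda>p. c powr ratio q * m (fst p (ratio q)) (snd p (ratio q))) \<in> borel_measurable (path_space \<Otimes>\<^sub>M path_space)" for q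
  proof -
    have "(\<lambda>p. (fst p (ratio q), snd p (ratio q))) \<in> measurable (path_space \<Otimes>\<^sub>M path_space) (borel \<Otimes>\<^sub>M (borel :: 'a measure))"
      by (intro measurable_Pair measurable_compose[OF measurable_fst measurable_path_eval]
          measurable_compose[OF measurable_snd measurable_path_eval]) auto
    from measurable_compose[OF this lsc_pseudometric_measurable[OF m]]
    show ?thesis by (intro borel_measurable_times borel_measurable_const) simp
  qed
  show "(\<lambda>p. discounted_uniform c m (fst p) (snd p)) \<in> borel_measurable (path_space \<Otimes>\<^sub>M path_space)"
    unfolding borel_measurable_iff_greater
  proof
    fix a
    have "{p \<in> space (path_space \<Otimes>\<^sub>M path_space). a < discounted_uniform c m (fst p) (snd p)} =
      {p \<in> space (path_space \<Otimes>\<^sub>M path_space). \<exists>q. a < c powr ratio q * m (fst p (ratio q)) (snd p (ratio q))}"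
      by (intro Collect_cong conj_cong refl less_discounted_uniform_iff[OF m])
         (auto simp: space_pair_measure space_path_space)
    also have "\<dots> \<in> sets (path_space \<Otimes>\<^sub>M path_space)"
      using ev unfolding borel_measurable_iff_greater by (intro sets.sets_Collect_countable_Ex) blast
    finally show "{p \<in> space (path_space \<Otimes>\<^sub>M path_space). a < discounted_uniform c m (fst p) (snd p)} \<in> sets (path_space \<Otimes>\<^sub>M path_space)" .
  qed
  show "0 \<le> discounted_uniform c m \<omega> \<omega>'" "discounted_uniform c m \<omega> \<omega>' \<le> 1" for \<omega> \<omega>'
    using discounted_uniform_bounds[OF m] .
  fix \<omega> \<omega>' a
  assume sp: "\<omega> \<in> space path_space" "\<omega>' \<in> space path_space" and a: "a < discounted_uniform c m \<omega> \<omega>'"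
  then obtain q where q: "a < c powr ratio q * m (\<omega> (ratio q)) (\<omega>' (ratio q))"
    using less_discounted_uniform_iff[OF m] by (auto simp: space_path_space)
  have cq: "0 < c powr ratio q" using discount_bounds[OF ratio_nonneg] by simp
  have "(\<omega> (ratio q), \<omega>' (ratio q)) \<in> {p. a / c powr ratio q < m (fst p) (snd p)}"
    using q cq by (simp add: field_simps)
  from open_prod_elim[OF lsc_pseudometricD(6)[OF m] this]
  obtain A B where "open A" "open B" "(\<omega> (ratio q), \<omega>' (ratio q)) \<in> A \<times> B"
    "A \<times> B \<subseteq> {p. a / c powr ratio q < m (fst p) (snd p)}" .
  then have AB: "open A" "open B" "\<omega> (ratio q) \<in> A" "\<omega>' (ratio q) \<in> B"
    "A \<times> B \<subseteq> {p. a / c powr ratio q < m (fst p) (snd p)}" by simp_all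
  obtain V where V: "open V" "embed (\<omega> (ratio q)) \<in> V" "embed -` V \<subseteq> A"
    by (rule embed_nbhd[OF AB(1,3)])
  obtain W where W: "open W" "embed (\<omega>' (ratio q)) \<in> W" "embed -` W \<subseteq> B"
    by (rule embed_nbhd[OF AB(2,4)])
  \<comment> \<open>\<open>slice\<close> keeps the coordinates at the witnessing time, which turns
    neighbourhoods of the two positions into open sets of codes.\<close>
  define slice where "slice u = (\<lambda>j. u (q, j))" for u :: "(nat \<times> nat) \<times> nat \<Rightarrow> real"
  have slice: "continuous_on UNIV slice"
    unfolding slice_def by (intro continuous_on_coordinatewise_then_product continuous_on_product_coordinates)
  have slice_code: "slice (path_code \<omega>) = embed (\<omega> (ratio q))" for \<omega>
    by (simp add: slice_def path_code_def)
  have "open (slice -` V \<times> slice -` W)"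
    using V(1) W(1) slice by (intro open_Times) (auto simp: open_vimage)
  moreover have "(path_code \<omega>, path_code \<omega>') \<in> slice -` V \<times> slice -` W"
    using V(2) W(2) by (simp add: slice_code)
  moreover have "a < discounted_uniform c m \<eta> \<eta>'"
    if "\<eta> \<in> space path_space" "\<eta>' \<in> space path_space" "(path_code \<eta>, path_code \<eta>') \<in> slice -` V \<times> slice -` W" for \<eta> \<eta>'
  proof -
    have "(\<eta> (ratio q), \<eta>' (ratio q)) \<in> A \<times> B" using V(3) W(3) that(3) by (auto simp: slice_code)
    then have "a / c powr ratio q < m (\<eta> (ratio q)) (\<eta>' (ratio q))" using AB(5) by auto
    then have "a < c powr ratio q * m (\<eta> (ratio q)) (\<eta>' (ratio q))" using cq by (simp add: field_simps)
    then show ?thesis using discounted_uniform_upper[OF m ratio_nonneg] less_le_trans by blast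
  qed
  ultimately show "\<exists>V. open V \<and> (path_code \<omega>, path_code \<omega>') \<in> V \<and>
      (\<forall>\<eta>\<in>space path_space. \<forall>\<eta>'\<in>space path_space. (path_code \<eta>, path_code \<eta>') \<in> V \<longrightarrow> a < discounted_uniform c m \<eta> \<eta>')"
    by blast
qed

lemma coupling_integrable:
  assumes "lsc_pseudometric m" "\<gamma> \<in> couplings (Pr x) (Pr y)"
  shows "integrable \<gamma> (\<lambda>p. discounted_uniform c m (fst p) (snd p))"
  using couplings_sets[OF assms(2)] sets_pair_measure_cong[OF law(2)[of x] law(2)[of y]]
  by (intro lsc_cost_integrable[OF lsc_cost_discounted_uniform[OF assms(1)] couplings_prob[OF assms(2) law(1)]]) simp

section \<open>Order properties and lower semicontinuity of the functional\<close>

lemma transport_functional_le: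
  assumes "lsc_pseudometric m" "\<gamma> \<in> couplings (Pr x) (Pr y)"
  shows "transport_functional Pr c m x y \<le> (\<integral>p. discounted_uniform c m (fst p) (snd p) \<partial>\<gamma>)"
  unfolding transport_functional_def
  by (rule transport_cost_le[OF assms(2)]) (rule discounted_uniform_bounds[OF assms(1)])

lemma transport_functional_greatest:
  assumes "\<And>\<gamma>. \<gamma> \<in> couplings (Pr x) (Pr y) \<Longrightarrow> a \<le> (\<integral>p. discounted_uniform c m (fst p) (snd p) \<partial>\<gamma>)"
  shows "a \<le> transport_functional Pr c m x y"
  unfolding transport_functional_def by (intro transport_cost_greatest law assms)

lemma discounted_uniform_mono:
  assumes "lsc_pseudometric m'" "m \<le> m'"
  shows "discounted_uniform c m \<omega> \<omega>' \<le> discounted_uniform c m' \<omega> \<omega>'"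
proof (rule discounted_uniform_least)
  fix t :: real assume t: "0 \<le> t"
  have "c powr t * m (\<omega> t) (\<omega>' t) \<le> c powr t * m' (\<omega> t) (\<omega>' t)"
    using assms(2) by (intro mult_left_mono) (auto simp: le_fun_def)
  also have "\<dots> \<le> discounted_uniform c m' \<omega> \<omega>'" by (rule discounted_uniform_upper[OF assms(1) t])
  finally show "c powr t * m (\<omega> t) (\<omega>' t) \<le> discounted_uniform c m' \<omega> \<omega>'" .
qed

lemma coupling_cost_mono:
  assumes "lsc_pseudometric m" "lsc_pseudometric m'" "m \<le> m'" "\<gamma> \<in> couplings (Pr x) (Pr y)"
  shows "(\<integral>p. discounted_uniform c m (fst p) (snd p) \<partial>\<gamma>) \<le> (\<integral>p. discounted_uniform c m' (fst p) (snd p) \<partial>\<gamma>)"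
  by (rule integral_mono[OF coupling_integrable[OF assms(1,4)] coupling_integrable[OF assms(2,4)]
        discounted_uniform_mono[OF assms(2,3)]])

lemma transport_functional_mono:
  assumes "lsc_pseudometric m" "lsc_pseudometric m'" "m \<le> m'"
  shows "transport_functional Pr c m \<le> transport_functional Pr c m'"
proof (intro le_funI transport_functional_greatest)
  fix x y \<gamma> assume \<gamma>: "\<gamma> \<in> couplings (Pr x) (Pr y)"
  show "transport_functional Pr c m x y \<le> (\<integral>p. discounted_uniform c m' (fst p) (snd p) \<partial>\<gamma>)"
    using transport_functional_le[OF assms(1) \<gamma>] coupling_cost_mono[OF assms \<gamma>] by linarith
qed

lemma transport_functional_ge:
  assumes m: "lsc_pseudometric m"
  shows "m \<le> transport_functional Pr c m"
proof (intro le_funI transport_functional_greatest)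
  fix x y \<gamma> assume \<gamma>: "\<gamma> \<in> couplings (Pr x) (Pr y)"
  interpret \<gamma>: prob_space \<gamma> by (rule couplings_prob[OF \<gamma> law(1)])
  have meas: "fst \<in> measurable \<gamma> (Pr x)" "snd \<in> measurable \<gamma> (Pr y)"
    using couplings_sets[OF \<gamma>] by (simp_all cong: measurable_cong_sets)
  have d: "distr \<gamma> (Pr x) fst = Pr x" "distr \<gamma> (Pr y) snd = Pr y" using \<gamma> by (auto simp: couplings_def)
  have 1: "AE \<omega> in distr \<gamma> (Pr x) fst. \<omega> 0 = x" unfolding d by (rule law_start)
  have 2: "AE \<omega> in distr \<gamma> (Pr y) snd. \<omega> 0 = y" unfolding d by (rule law_start)
  from AE_distrD[OF meas(1) 1] AE_distrD[OF meas(2) 2] have "AE p in \<gamma>. m x y \<le> discounted_uniform c m (fst p) (snd p)"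
  proof eventually_elim
    case (elim p)
    \<comment> \<open>Since \<open>0 powr 0\<close> is 0, it is positivity of \<open>c\<close> that
      makes the discount at time 0 equal to 1.\<close>
    then show ?case using discounted_uniform_upper[OF m, of 0 "fst p" "snd p"] c by simp
  qed
  then have "(\<integral>p. m x y \<partial>\<gamma>) \<le> (\<integral>p. discounted_uniform c m (fst p) (snd p) \<partial>\<gamma>)"
    by (intro integral_mono_AE coupling_integrable[OF m \<gamma>]) auto
  then show "m x y \<le> (\<integral>p. discounted_uniform c m (fst p) (snd p) \<partial>\<gamma>)" by (simp add: \<gamma>.prob_space)
qed

text \<open>The algebraic axioms come from swapping, gluing and the diagonal coupling. For lower
  semicontinuity the sublevel sets are shown closed; the space is second countable, so sequences
  suffice, and the laws converge along with the starting points.\<close>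

lemma lsc_pseudometric_transport_functional:
  assumes m: "lsc_pseudometric m"
  shows "lsc_pseudometric (transport_functional Pr c m)"
proof -
  note cost = lsc_cost_discounted_uniform[OF m]
  have sym: "transport_functional Pr c m x y \<le> transport_functional Pr c m y x" for x y
    unfolding transport_functional_def
    by (rule transport_cost_swap[OF cost _ law law]) (simp add: discounted_uniform_def lsc_pseudometricD(4)[OF m])
  have tri: "transport_functional Pr c m x z \<le> transport_functional Pr c m x y + transport_functional Pr c m y z" for x y z
    unfolding transport_functional_def
  proof (rule transport_cost_triangle[OF coded_path_space cost _ law law law])
    fix \<omega> \<omega>' \<omega>'' :: "real \<Rightarrow> 'a"
    show "discounted_uniform c m \<omega> \<omega>'' \<le> discounted_uniform c m \<omega> \<omega>' + discounted_uniform c m \<omega>' \<omega>''"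
    proof (rule discounted_uniform_least)
      fix t :: real assume t: "0 \<le> t"
      have "c powr t * m (\<omega> t) (\<omega>'' t) \<le> c powr t * (m (\<omega> t) (\<omega>' t) + m (\<omega>' t) (\<omega>'' t))"
        by (intro mult_left_mono lsc_pseudometricD(5)[OF m]) simp
      then show "c powr t * m (\<omega> t) (\<omega>'' t) \<le> discounted_uniform c m \<omega> \<omega>' + discounted_uniform c m \<omega>' \<omega>''"
        using discounted_uniform_upper[OF m t, of \<omega> \<omega>'] discounted_uniform_upper[OF m t, of \<omega>' \<omega>'']
        unfolding distrib_left by linarith
    qed
  qed
  have nonneg: "0 \<le> transport_functional Pr c m x y" for x y
    by (rule order_trans[OF lsc_pseudometricD(1)[OF m] le_funD[OF le_funD[OF transport_functional_ge[OF m]]]])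
  have self: "transport_functional Pr c m x x = 0" for x
  proof (rule antisym[OF _ nonneg])
    show "transport_functional Pr c m x x \<le> 0"
      unfolding transport_functional_def
      by (rule transport_cost_self[OF cost _ law]) (simp add: discounted_uniform_def lsc_pseudometricD(3)[OF m])
  qed
  have le1: "transport_functional Pr c m x y \<le> 1" for x y
  proof -
    obtain \<gamma> where \<gamma>: "\<gamma> \<in> couplings (Pr x) (Pr y)" using couplings_nonempty[OF law(1) law(1)] by blast
    interpret \<gamma>: prob_space \<gamma> by (rule couplings_prob[OF \<gamma> law(1)])
    have "(\<integral>p. discounted_uniform c m (fst p) (snd p) \<partial>\<gamma>) \<le> (\<integral>p. 1 \<partial>\<gamma>)"
      by (intro integral_mono coupling_integrable[OF m \<gamma>] discounted_uniform_bounds[OF m]) simp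
    then show ?thesis using transport_functional_le[OF m \<gamma>] by (simp add: \<gamma>.prob_space)
  qed
  have "open {p. a < transport_functional Pr c m (fst p) (snd p)}" for a
  proof -
    have "closed {p. transport_functional Pr c m (fst p) (snd p) \<le> a}"
      unfolding closed_sequential_limits
    proof (intro allI impI, elim conjE)
      fix Z and z :: "'a \<times> 'a"
      assume Z: "\<forall>n. Z n \<in> {p. transport_functional Pr c m (fst p) (snd p) \<le> a}" and lim: "Z \<longlonglongrightarrow> z"
      \<comment> \<open>The slack \<open>1 / real (Suc n)\<close> yields a coupling without the
        infimum being attained, and disappears in the limit.\<close>
      have "\<exists>\<gamma>. \<gamma> \<in> couplings (Pr (fst (Z n))) (Pr (snd (Z n))) \<and>
          (\<integral>p. discounted_uniform c m (fst p) (snd p) \<partial>\<gamma>) < a + 1 / real (Suc n)" for n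
      proof -
        have "transport_cost (discounted_uniform c m) (Pr (fst (Z n))) (Pr (snd (Z n))) < a + 1 / real (Suc n)"
          by (rule le_less_trans[of _ a]) (use Z in \<open>simp_all add: transport_functional_def\<close>)
        from almost_optimal_coupling[OF law(1) law(1) this] show ?thesis by blast
      qed
      then have "\<exists>\<gamma>. \<forall>n. \<gamma> n \<in> couplings (Pr (fst (Z n))) (Pr (snd (Z n))) \<and>
          (\<integral>p. discounted_uniform c m (fst p) (snd p) \<partial>\<gamma> n) < a + 1 / real (Suc n)"
        by (intro choice allI)
      then obtain \<gamma> where "\<forall>n. \<gamma> n \<in> couplings (Pr (fst (Z n))) (Pr (snd (Z n))) \<and>
          (\<integral>p. discounted_uniform c m (fst p) (snd p) \<partial>\<gamma> n) < a + 1 / real (Suc n)" ..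
      then have \<gamma>: "\<And>n. \<gamma> n \<in> couplings (Pr (fst (Z n))) (Pr (snd (Z n)))"
        "\<And>n. (\<integral>p. discounted_uniform c m (fst p) (snd p) \<partial>\<gamma> n) < a + 1 / real (Suc n)" by simp_all
      show "z \<in> {p. transport_functional Pr c m (fst p) (snd p) \<le> a}"
      proof (rule law_transport_limit[OF tendsto_fst[OF lim] tendsto_snd[OF lim] \<gamma>(1)])
        fix r :: "nat \<Rightarrow> nat" and \<kappa>
        assume r: "strict_mono r" and \<kappa>: "\<kappa> \<in> couplings (Pr (fst z)) (Pr (snd z))"
          and limit: "\<And>C b l N. lsc_cost path_space path_code C \<Longrightarrow>
             (\<And>n. N \<le> n \<Longrightarrow> (\<integral>p. C (fst p) (snd p) \<partial>\<gamma> (r n)) \<le> b n) \<Longrightarrow> b \<longlonglongrightarrow> l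
             \<Longrightarrow> (\<integral>p. C (fst p) (snd p) \<partial>\<kappa>) \<le> l"
        have "(\<lambda>n. a + 1 / real (Suc n)) \<longlonglongrightarrow> a"
          using tendsto_add[OF tendsto_const[of a] LIMSEQ_Suc[OF lim_1_over_n]] by simp
        from LIMSEQ_subseq_LIMSEQ[OF this r]
        have "(\<integral>p. discounted_uniform c m (fst p) (snd p) \<partial>\<kappa>) \<le> a"
          by (intro limit[OF cost, of 0]) (use \<gamma>(2) in \<open>auto intro: less_imp_le simp: comp_def\<close>)
        then show ?thesis using transport_functional_le[OF m \<kappa>] by simp
      qed
    qed
    moreover have "{p. a < transport_functional Pr c m (fst p) (snd p)} = - {p. transport_functional Pr c m (fst p) (snd p) \<le> a}"
      by auto
    ultimately show ?thesis by (simp add: open_Compl)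
  qed
  then show ?thesis
    unfolding lsc_pseudometric_def using nonneg le1 self sym tri by (simp add: antisym)
qed

section \<open>The iterates and their supremum\<close>

lemma lsc_pseudometric_obs_dist: "lsc_pseudometric (obs_dist obs)"
proof -
  have "open {p :: 'a \<times> 'a. a < \<bar>obs (fst p) - obs (snd p)\<bar>}" for a
  proof -
    have "continuous_on UNIV (\<lambda>p :: 'a \<times> 'a. obs (fst p))"
      by (rule continuous_on_compose2[OF obs_continuous continuous_on_fst[OF continuous_on_id]]) simp
    moreover have "continuous_on UNIV (\<lambda>p :: 'a \<times> 'a. obs (snd p))"
      by (rule continuous_on_compose2[OF obs_continuous continuous_on_snd[OF continuous_on_id]]) simp
    ultimately show ?thesis
      by (intro open_Collect_less continuous_on_const continuous_on_rabs continuous_on_diff)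
  qed
  moreover have "\<bar>obs x - obs y\<bar> \<le> 1" for x y
    using obs_range[of x] obs_range[of y] by auto
  ultimately show ?thesis by (auto simp: lsc_pseudometric_def obs_dist_def)
qed

lemma lsc_pseudometric_seq: "lsc_pseudometric (pseudometric_seq Pr obs c n)"
  by (induction n) (simp_all add: lsc_pseudometric_obs_dist lsc_pseudometric_transport_functional)

lemma incseq_pseudometric_seq: "incseq (pseudometric_seq Pr obs c)"
  by (rule incseq_SucI) (simp add: transport_functional_ge lsc_pseudometric_seq)

lemma dbar_eq: "dbar Pr obs c = (\<lambda>x y. SUP n. pseudometric_seq Pr obs c n x y)"
  by (intro ext) (simp add: dbar_def)

lemma lsc_pseudometric_dbar: "lsc_pseudometric (dbar Pr obs c)"
  unfolding dbar_eq by (intro lsc_pseudometric_SUP lsc_pseudometric_seq)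

lemma bdd_above_seq: "bdd_above (range (\<lambda>n. pseudometric_seq Pr obs c n x y))"
  by (intro bdd_aboveI2[where M = 1] lsc_pseudometricD(2) lsc_pseudometric_seq)

lemma pseudometric_seq_le_dbar: "pseudometric_seq Pr obs c n \<le> dbar Pr obs c"
  unfolding dbar_eq by (intro le_funI cSUP_upper[OF UNIV_I bdd_above_seq])

text \<open>Suprema over times and over \<open>n\<close> commute: whatever lies below the supremum
  for \<open>dbar\<close> is exceeded at one time by one iterate \<open>k\<close>, and then by every
  later iterate.\<close>

lemma discounted_uniform_seq_tendsto:
  "(\<lambda>n. discounted_uniform c (pseudometric_seq Pr obs c n) \<omega> \<omega>') \<longlonglongrightarrow> discounted_uniform c (dbar Pr obs c) \<omega> \<omega>'"
proof (rule order_tendstoI)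
  let ?d = "pseudometric_seq Pr obs c"
  fix a assume "a < discounted_uniform c (dbar Pr obs c) \<omega> \<omega>'"
  then have "\<not> (\<forall>t\<ge>0. c powr t * dbar Pr obs c (\<omega> t) (\<omega>' t) \<le> a)"
    using discounted_uniform_least[of "dbar Pr obs c" \<omega> \<omega>' a] by auto
  then obtain t where t: "0 \<le> t" "a < c powr t * dbar Pr obs c (\<omega> t) (\<omega>' t)" by auto
  have ct: "0 < c powr t" using discount_bounds[OF t(1)] by simp
  have "a / c powr t < (SUP n. ?d n (\<omega> t) (\<omega>' t))" using t(2) ct by (simp add: dbar_def field_simps)
  then obtain k where "a / c powr t < ?d k (\<omega> t) (\<omega>' t)"
    by (auto simp: less_cSUP_iff[OF _ bdd_above_seq])
  then have k: "a < c powr t * ?d k (\<omega> t) (\<omega>' t)" using ct by (simp add: field_simps)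
  have "a < discounted_uniform c (?d n) \<omega> \<omega>'" if "k \<le> n" for n
    using k discounted_uniform_upper[OF lsc_pseudometric_seq[of k] t(1), of \<omega> \<omega>']
      discounted_uniform_mono[OF lsc_pseudometric_seq[of n] incseqD[OF incseq_pseudometric_seq that], of \<omega> \<omega>']
    by linarith
  then show "\<forall>\<^sub>F n in sequentially. a < discounted_uniform c (?d n) \<omega> \<omega>'"
    unfolding eventually_sequentially by blast
next
  fix a assume "discounted_uniform c (dbar Pr obs c) \<omega> \<omega>' < a"
  then show "\<forall>\<^sub>F n in sequentially. discounted_uniform c (pseudometric_seq Pr obs c n) \<omega> \<omega>' < a"
    using discounted_uniform_mono[OF lsc_pseudometric_dbar pseudometric_seq_le_dbar] le_less_trans
    by (blast intro: always_eventually)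
qed

text \<open>The point is to exchange the infimum over couplings with the supremum over
  \<open>n\<close>, which compactness permits. The \<open>\<gamma> n\<close> are almost optimal for
  different costs, but for fixed \<open>k\<close> and \<open>n \<ge> k\<close> the cost from iterate
  \<open>k\<close> is below that from iterate \<open>r n\<close>. Thus \<open>\<kappa>\<close> has
  cost at most \<open>dbar Pr obs c x y\<close> for every iterate, and \<open>k\<close> is sent to
  infinity with \<open>\<kappa>\<close> fixed.\<close>

lemma transport_functional_dbar_le: "transport_functional Pr c (dbar Pr obs c) x y \<le> dbar Pr obs c x y"
proof -
  let ?d = "pseudometric_seq Pr obs c"
  let ?l = "dbar Pr obs c x y"
  have "\<exists>\<gamma>. \<gamma> \<in> couplings (Pr x) (Pr y) \<and>
      (\<integral>p. discounted_uniform c (?d n) (fst p) (snd p) \<partial>\<gamma>) < ?l + 1 / real (Suc n)" for n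
  proof -
    \<comment> \<open>Index shift: the functional of iterate \<open>n\<close> is iterate
      \<open>Suc n\<close>, still below the supremum.\<close>
    have "?d (Suc n) x y \<le> ?l" by (rule le_funD[OF le_funD[OF pseudometric_seq_le_dbar]])
    then have "transport_cost (discounted_uniform c (?d n)) (Pr x) (Pr y) < ?l + 1 / real (Suc n)"
      by (simp add: transport_functional_def add_strict_increasing2 le_less_trans)
    from almost_optimal_coupling[OF law(1) law(1) this] show ?thesis by blast
  qed
  then have "\<exists>\<gamma>. \<forall>n. \<gamma> n \<in> couplings (Pr x) (Pr y) \<and>
      (\<integral>p. discounted_uniform c (?d n) (fst p) (snd p) \<partial>\<gamma> n) < ?l + 1 / real (Suc n)"
    by (intro choice allI)
  then obtain \<gamma> where "\<forall>n. \<gamma> n \<in> couplings (Pr x) (Pr y) \<and>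
      (\<integral>p. discounted_uniform c (?d n) (fst p) (snd p) \<partial>\<gamma> n) < ?l + 1 / real (Suc n)" ..
  then have \<gamma>: "\<And>n. \<gamma> n \<in> couplings (Pr x) (Pr y)"
    "\<And>n. (\<integral>p. discounted_uniform c (?d n) (fst p) (snd p) \<partial>\<gamma> n) < ?l + 1 / real (Suc n)" by simp_all
  show ?thesis
  \<comment> \<open>The starting points do not move here; compactness is applied with constant
    marginals.\<close>
  proof (rule law_transport_limit[OF tendsto_const tendsto_const \<gamma>(1)])
    fix r :: "nat \<Rightarrow> nat" and \<kappa>
    assume r: "strict_mono r" and \<kappa>: "\<kappa> \<in> couplings (Pr x) (Pr y)"
      and limit: "\<And>C b l N. lsc_cost path_space path_code C \<Longrightarrow>
         (\<And>n. N \<le> n \<Longrightarrow> (\<integral>p. C (fst p) (snd p) \<partial>\<gamma> (r n)) \<le> b n) \<Longrightarrow> b \<longlonglongrightarrow> l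
         \<Longrightarrow> (\<integral>p. C (fst p) (snd p) \<partial>\<kappa>) \<le> l"
    interpret \<kappa>: prob_space \<kappa> by (rule couplings_prob[OF \<kappa> law(1)])
    have "(\<lambda>n. ?l + 1 / real (Suc n)) \<longlonglongrightarrow> ?l"
      using tendsto_add[OF tendsto_const[of ?l] LIMSEQ_Suc[OF lim_1_over_n]] by simp
    from LIMSEQ_subseq_LIMSEQ[OF this r]
    have lim: "(\<lambda>n. ?l + 1 / real (Suc (r n))) \<longlonglongrightarrow> ?l" by (simp add: comp_def)
    have "(\<integral>p. discounted_uniform c (?d k) (fst p) (snd p) \<partial>\<kappa>) \<le> ?l" for k
    \<comment> \<open>The threshold is \<open>k\<close>, because a strictly increasing
      \<open>r\<close> satisfies \<open>n \<le> r n\<close>.\<close>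
    proof (rule limit[OF lsc_cost_discounted_uniform[OF lsc_pseudometric_seq] _ lim, of k])
      fix n assume "k \<le> n"
      then have "k \<le> r n" using seq_suble[OF r, of n] by linarith
      then have "(\<integral>p. discounted_uniform c (?d k) (fst p) (snd p) \<partial>\<gamma> (r n)) \<le>
          (\<integral>p. discounted_uniform c (?d (r n)) (fst p) (snd p) \<partial>\<gamma> (r n))"
        by (intro coupling_cost_mono[OF lsc_pseudometric_seq lsc_pseudometric_seq _ \<gamma>(1)]
            incseqD[OF incseq_pseudometric_seq])
      then show "(\<integral>p. discounted_uniform c (?d k) (fst p) (snd p) \<partial>\<gamma> (r n)) \<le> ?l + 1 / real (Suc (r n))"
        using \<gamma>(2)[of "r n"] by linarith
    qed
    moreover have "(\<lambda>k. \<integral>p. discounted_uniform c (?d k) (fst p) (snd p) \<partial>\<kappa>) \<longlonglongrightarrow>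
        (\<integral>p. discounted_uniform c (dbar Pr obs c) (fst p) (snd p) \<partial>\<kappa>)"
    proof (rule integral_dominated_convergence[where w = "\<lambda>_. 1"])
      show "AE p in \<kappa>. norm (discounted_uniform c (?d k) (fst p) (snd p)) \<le> 1" for k
        using discounted_uniform_bounds[OF lsc_pseudometric_seq] by simp
    qed (use coupling_integrable[OF lsc_pseudometric_seq \<kappa>] coupling_integrable[OF lsc_pseudometric_dbar \<kappa>]
           discounted_uniform_seq_tendsto in auto)
    ultimately have "(\<integral>p. discounted_uniform c (dbar Pr obs c) (fst p) (snd p) \<partial>\<kappa>) \<le> ?l"
      by (intro LIMSEQ_le_const2) auto
    then show ?thesis using transport_functional_le[OF lsc_pseudometric_dbar \<kappa>] by linarith
  qed
qed

text \<open>Minimality is Kleene's argument: a fixpoint above the initial pseudometric dominates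
  every iterate by monotonicity, hence also their supremum.\<close>

lemma dbar_least_fixpoint:
  "lsc_pseudometric (dbar Pr obs c) \<and>
   obs_dist obs \<le> dbar Pr obs c \<and>
   transport_functional Pr c (dbar Pr obs c) = dbar Pr obs c \<and>
   (\<forall>m. lsc_pseudometric m \<and> obs_dist obs \<le> m \<and> transport_functional Pr c m = m \<longrightarrow> dbar Pr obs c \<le> m)"
proof (intro conjI allI impI)
  show "lsc_pseudometric (dbar Pr obs c)" by (rule lsc_pseudometric_dbar)
  show "obs_dist obs \<le> dbar Pr obs c" using pseudometric_seq_le_dbar[of 0] by simp
  show "transport_functional Pr c (dbar Pr obs c) = dbar Pr obs c"
    by (intro antisym le_funI transport_functional_dbar_le transport_functional_ge lsc_pseudometric_dbar)
  fix m assume m: "lsc_pseudometric m \<and> obs_dist obs \<le> m \<and> transport_functional Pr c m = m"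
  have "pseudometric_seq Pr obs c n \<le> m" for n
  proof (induction n)
    case 0
    then show ?case using m by simp
  next
    case (Suc n)
    then show ?case
      using transport_functional_mono[OF lsc_pseudometric_seq _ Suc.IH] m by simp
  qed
  then show "dbar Pr obs c \<le> m"
    unfolding dbar_eq by (intro le_funI cSUP_least) (auto simp: le_fun_def)
qed

end

theorem theorem4p11:
  fixes \<Delta> :: "'a::{t2_space, second_countable_topology} \<Rightarrow> 'a \<Rightarrow> real"
    and Phat :: "real \<Rightarrow> ('a \<Rightarrow> real) \<Rightarrow> ('a \<Rightarrow> real)"
    and P :: "real \<Rightarrow> 'a \<Rightarrow> 'a measure"
    and Pr :: "'a \<Rightarrow> (real \<Rightarrow> 'a) measure"
    and obs :: "'a \<Rightarrow> real"
    and c :: real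
  assumes "diffusion \<Delta> Phat P Pr obs"
    and "0 < c" and "c < 1"
  shows "lsc_pseudometric (dbar Pr obs c) \<and>
         obs_dist obs \<le> dbar Pr obs c \<and>
         transport_functional Pr c (dbar Pr obs c) = dbar Pr obs c \<and>
         (\<forall>m. lsc_pseudometric m \<and> obs_dist obs \<le> m \<and> transport_functional Pr c m = m \<longrightarrow> dbar Pr obs c \<le> m)"
proof -
  interpret discounted_diffusion \<Delta> Phat P Pr obs c
    using assms by (simp add: discounted_diffusion_def discounted_diffusion_axioms_def)
  show ?thesis by (rule dbar_least_fixpoint)
qed

end
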